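(* Let $M$ be a real $2m$-dimensional (pseudo-)Riemannian manifold with metric $g$, equipped with a real non-degenerate diagonalisable conformal Killing-Yano tensor $\phi$ with distinct eigenvalues. Let $\{\theta^\mu,\theta_\mu\}_{\mu=1}^m$ be a (local, complex) null coframe in which $\phi=\sum_\mu\lambda_\mu\,\theta^\mu\wedge\theta_\mu$, and let $\{V_\mu,V^\mu\}_{\mu=1}^m$ be the dual frame. Suppose that the $3$-form $\tau=d\phi$ satisfies $$\theta^\mu\wedge\tau(V^\mu,\cdot,\cdot)=0,\qquad \theta_\mu\wedge\tau(V_\mu,\cdot,\cdot)=0,$$ for each $\mu=1,\dots,m$ (no summation). Then the $2^m$ maximal isotropic distributions associated to $\phi$ are integrable. In Euclidean signature they define $2^m$ distinct complex structures, whereas in Lorentzian signature they define just two geodesic congruences, each associated with $2^{m-1}$ integrable maximal isotropic distributions.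
   Context: All statements are local. $\nabla$ is the Levi-Civita connection of $g$, and $X^*=g(X,\cdot)$. A conformal Killing-Yano tensor on an $n$-dimensional (pseudo-)Riemannian manifold is a $2$-form $\phi$ such that for all vector fields $X$ $$\nabla_X\phi=\tfrac13\,X\lrcorner\tau+\tfrac1{n-1}X^*\wedge K$$ for some $3$-form $\tau$ and $1$-form $K$; necessarily $\tau=d\phi$ and $K=-d^*\phi$. The eigenvalues of $\phi$ are those of the endomorphism of the complexified tangent bundle $T_{\mathbb C}M$ obtained by raising one index of $\phi$ with $g$; they come in pairs $\pm\lambda_\mu$. Non-degenerate means that this endomorphism is invertible. When $\phi$ has distinct eigenvalues there is locally a complex coframe $\{\theta^\mu,\theta_\mu\}_{\mu=1}^m$, null in the sense that $g=c\sum_\mu\theta^\mu\odot\theta_\mu$ for a normalisation constant $c$ ($\odot$ is the symmetric product), such that $\phi=\sum_\mu\lambda_\mu\theta^\mu\wedge\theta_\mu$. The dual frame satisfies $\theta^\mu(V_\nu)=\delta^\mu_\nu=\theta_\nu(V^\mu)$, with all other pairings zero. $\tau(V,\cdot,\cdot)$ denotes the $2$-form obtained by inserting $V$ in the first slot of $\tau$. The $2^m$ maximal isotropic distributions associated to $\phi$ are the rank-$m$ subbundles of $T_{\mathbb C}M$ obtained as common annihilators of $m$ one-forms, one chosen from each pair $\{\theta^\mu,\theta_\mu\}$, $\mu=1,\dots,m$. A complex distribution $\mathcal D\subset T_{\mathbb C}M$ is integrable if $[\mathcal D,\mathcal D]\subset\mathcal D$. In Euclidean signature a maximal isotropic distribution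 satisfies $\mathcal D\cap\overline{\mathcal D}=0$ and so is the same as a metric-compatible almost complex structure. In Lorentzian signature $\mathcal D\cap\overline{\mathcal D}$ is one-dimensional and defines a real null line field; the congruences in the claim are the families of integral curves of these line fields. *)

theory Defs
  imports "HOL-Analysis.Analysis"
begin

(* The geometry takes place on an open set U of real^'n, i.e. in the domain of one coordinate
   chart.  Tensor fields are given by their components: a vector or a one-form is a vector, a
   2-tensor A is a matrix with A $ i $ j = A(e_i, e_j), and similarly for 3-tensors.  The
   complexified tangent space at each point is complex^'n. *)

section \<open>Smoothness and complexification\<close>

primrec ck_on ::
  "nat \<Rightarrow> 'a::real_normed_vector set \<Rightarrow> ('a \<Rightarrow> 'b::real_normed_vector) \<Rightarrow> bool" where
  "ck_on 0 S f = continuous_on S f"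
| "ck_on (Suc k) S f =
     ((\<forall>x\<in>S. f differentiable (at x)) \<and> (\<forall>v. ck_on k S (\<lambda>x. frechet_derivative f (at x) v)))"

(* S is meant to be open. *)
definition smooth_on ::
  "'a::real_normed_vector set \<Rightarrow> ('a \<Rightarrow> 'b::real_normed_vector) \<Rightarrow> bool" where
  "smooth_on S f \<longleftrightarrow> (\<forall>k. ck_on k S f)"

definition pderiv_coord ::
  "'n::finite \<Rightarrow> (real^'n \<Rightarrow> 'b::real_normed_vector) \<Rightarrow> real^'n \<Rightarrow> 'b" where
  "pderiv_coord i f x = frechet_derivative f (at x) (axis i 1)"

definition cvec :: "real^'n \<Rightarrow> complex^'n" where
  "cvec v = (\<chi> i. complex_of_real (v $ i))"

definition cmat :: "real^'n^'m \<Rightarrow> complex^'n^'m" where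
  "cmat A = (\<chi> i. cvec (A $ i))"

definition cten :: "real^'n^'m^'k \<Rightarrow> complex^'n^'m^'k" where
  "cten T = (\<chi> i. cmat (T $ i))"

definition cnj_vec :: "complex^'n \<Rightarrow> complex^'n" where
  "cnj_vec z = (\<chi> i. cnj (z $ i))"

section \<open>Pointwise multilinear algebra\<close>

(* Complex-bilinear, in contrast to the inner product. *)
definition pairing :: "'a::comm_ring_1^'n \<Rightarrow> 'a^'n \<Rightarrow> 'a" where
  "pairing \<alpha> X = (\<Sum>i\<in>UNIV. \<alpha> $ i * X $ i)"

definition wedge11 :: "'a::comm_ring_1^'n \<Rightarrow> 'a^'n \<Rightarrow> 'a^'n^'n" where
  "wedge11 \<alpha> \<beta> = (\<chi> i j. \<alpha> $ i * \<beta> $ j - \<alpha> $ j * \<beta> $ i)"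

definition wedge12 :: "'a::comm_ring_1^'n \<Rightarrow> 'a^'n^'n \<Rightarrow> 'a^'n^'n^'n" where
  "wedge12 \<alpha> \<omega> = (\<chi> i j k. \<alpha> $ i * \<omega> $ j $ k + \<alpha> $ j * \<omega> $ k $ i + \<alpha> $ k * \<omega> $ i $ j)"

definition sym_prod :: "'a::field^'n \<Rightarrow> 'a^'n \<Rightarrow> 'a^'n^'n" where
  "sym_prod \<alpha> \<beta> = (\<chi> i j. (\<alpha> $ i * \<beta> $ j + \<alpha> $ j * \<beta> $ i) / 2)"

(* The 2-form T(X, -, -). *)
definition insert_first :: "'a::comm_ring_1^'n \<Rightarrow> 'a^'n^'n^'n \<Rightarrow> 'a^'n^'n" where
  "insert_first X T = (\<chi> i j. \<Sum>k\<in>UNIV. X $ k * T $ k $ i $ j)"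

definition eigenvalues_of :: "complex^'n^'n \<Rightarrow> complex set" where
  "eigenvalues_of A = {l. \<exists>v. v \<noteq> 0 \<and> A *v v = l *s v}"

definition diagonalisable :: "complex^'n^'n \<Rightarrow> bool" where
  "diagonalisable A \<longleftrightarrow> vec.span {v. \<exists>l. A *v v = l *s v} = UNIV"

section \<open>Metrics, forms and the Levi-Civita connection\<close>

definition pseudo_metric_on :: "(real^'n) set \<Rightarrow> (real^'n \<Rightarrow> real^'n^'n) \<Rightarrow> bool" where
  "pseudo_metric_on U g \<longleftrightarrow>
     smooth_on U g \<and> (\<forall>x\<in>U. transpose (g x) = g x \<and> invertible (g x))"

definition euclidean_form :: "real^'n^'n \<Rightarrow> bool" where
  "euclidean_form G \<longleftrightarrow> (\<forall>v. v \<noteq> 0 \<longrightarrow> v \<bullet> (G *v v) > 0)"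

(* Both sign conventions (-+...+) and (+-...-) are admitted; b is a pseudo-orthonormal basis. *)
definition lorentzian_form :: "real^'n^'n \<Rightarrow> bool" where
  "lorentzian_form G \<longleftrightarrow>
     (\<exists>(s::real) (b::'n \<Rightarrow> real^'n) i0. (s = 1 \<or> s = -1) \<and>
        (\<forall>i j. b i \<bullet> (G *v b j) = (if i \<noteq> j then 0 else if i = i0 then - s else s)))"

definition one_form_on :: "(real^'n) set \<Rightarrow> (real^'n \<Rightarrow> real^'n) \<Rightarrow> bool" where
  "one_form_on U \<alpha> \<longleftrightarrow> smooth_on U \<alpha>"

definition two_form_on :: "(real^'n) set \<Rightarrow> (real^'n \<Rightarrow> real^'n^'n) \<Rightarrow> bool" where
  "two_form_on U \<omega> \<longleftrightarrow> smooth_on U \<omega> \<and> (\<forall>x\<in>U. transpose (\<omega> x) = - \<omega> x)"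

definition three_form_on :: "(real^'n) set \<Rightarrow> (real^'n \<Rightarrow> real^'n^'n^'n) \<Rightarrow> bool" where
  "three_form_on U T \<longleftrightarrow> smooth_on U T \<and>
     (\<forall>x\<in>U. \<forall>i j k. T x $ i $ j $ k = - T x $ j $ i $ k \<and> T x $ i $ j $ k = - T x $ i $ k $ j)"

definition ext_deriv2 :: "(real^'n \<Rightarrow> real^'n^'n) \<Rightarrow> real^'n \<Rightarrow> real^'n^'n^'n" where
  "ext_deriv2 \<omega> x = (\<chi> i j k. pderiv_coord i \<omega> x $ j $ k + pderiv_coord j \<omega> x $ k $ i
                              + pderiv_coord k \<omega> x $ i $ j)"

(* christoffel g x k i j is the symbol with upper index k and lower indices i, j. *)
definition christoffel :: "(real^'n \<Rightarrow> real^'n^'n) \<Rightarrow> real^'n \<Rightarrow> 'n \<Rightarrow> 'n \<Rightarrow> 'n \<Rightarrow> real" where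
  "christoffel g x k i j = (\<Sum>l\<in>UNIV. matrix_inv (g x) $ k $ l *
     (pderiv_coord i g x $ j $ l + pderiv_coord j g x $ i $ l - pderiv_coord l g x $ i $ j)) / 2"

(* nabla_X of a 2-form at the point x, for the Levi-Civita connection of g. *)
definition nabla2 ::
  "(real^'n \<Rightarrow> real^'n^'n) \<Rightarrow> (real^'n \<Rightarrow> real^'n^'n) \<Rightarrow> real^'n \<Rightarrow> real^'n \<Rightarrow> real^'n^'n" where
  "nabla2 g \<omega> x X = (\<chi> i j. \<Sum>k\<in>UNIV. X $ k *
     (pderiv_coord k \<omega> x $ i $ j
      - (\<Sum>l\<in>UNIV. christoffel g x l k i * \<omega> x $ l $ j)
      - (\<Sum>l\<in>UNIV. christoffel g x l k j * \<omega> x $ i $ l)))"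

(* Both sides are tensorial in X, so a vector X at each point replaces a vector field. *)
definition conformal_killing_yano ::
  "(real^'n) set \<Rightarrow> (real^'n \<Rightarrow> real^'n^'n) \<Rightarrow> (real^'n \<Rightarrow> real^'n^'n) \<Rightarrow> bool" where
  "conformal_killing_yano U g \<phi> \<longleftrightarrow> two_form_on U \<phi> \<and>
     (\<exists>T K. three_form_on U T \<and> one_form_on U K \<and>
        (\<forall>x\<in>U. \<forall>X. nabla2 g \<phi> x X =
           (1/3) *\<^sub>R insert_first X (T x)
           + (1 / (real CARD('n) - 1)) *\<^sub>R wedge11 (g x *v X) (K x)))"

(* The endomorphism with components g^{ik} phi_{kj}.  Raising the other index instead changes its
   sign, which affects none of the notions below. *)
definition raise_index :: "real^'n^'n \<Rightarrow> real^'n^'n \<Rightarrow> real^'n^'n" where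
  "raise_index G A = matrix_inv G ** A"

section \<open>Null coframes and dual frames\<close>

(* \<theta>u, \<theta>l are the one-forms with upper and lower index. *)
definition null_coframe ::
  "(real^'n) set \<Rightarrow> (real^'n \<Rightarrow> real^'n^'n) \<Rightarrow> complex \<Rightarrow>
   ('m::finite \<Rightarrow> real^'n \<Rightarrow> complex^'n) \<Rightarrow> ('m \<Rightarrow> real^'n \<Rightarrow> complex^'n) \<Rightarrow> bool" where
  "null_coframe U g c \<theta>u \<theta>l \<longleftrightarrow>
     (\<forall>\<mu>. smooth_on U (\<theta>u \<mu>) \<and> smooth_on U (\<theta>l \<mu>)) \<and>
     (\<forall>x\<in>U. cmat (g x) = map_matrix ((*) c) (\<Sum>\<mu>\<in>UNIV. sym_prod (\<theta>u \<mu> x) (\<theta>l \<mu> x)))"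

(* Vl, Vu are the vector fields with lower and upper index: Vl is dual to \<theta>u, and Vu to \<theta>l. *)
definition dual_frame ::
  "(real^'n) set \<Rightarrow>
   ('m::finite \<Rightarrow> real^'n \<Rightarrow> complex^'n) \<Rightarrow> ('m \<Rightarrow> real^'n \<Rightarrow> complex^'n) \<Rightarrow>
   ('m \<Rightarrow> real^'n \<Rightarrow> complex^'n) \<Rightarrow> ('m \<Rightarrow> real^'n \<Rightarrow> complex^'n) \<Rightarrow> bool" where
  "dual_frame U \<theta>u \<theta>l Vl Vu \<longleftrightarrow>
     (\<forall>\<mu>. smooth_on U (Vl \<mu>) \<and> smooth_on U (Vu \<mu>)) \<and>
     (\<forall>x\<in>U. \<forall>\<mu> \<nu>.
        pairing (\<theta>u \<mu> x) (Vl \<nu> x) = (if \<mu> = \<nu> then 1 else 0) \<and>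
        pairing (\<theta>l \<mu> x) (Vu \<nu> x) = (if \<mu> = \<nu> then 1 else 0) \<and>
        pairing (\<theta>u \<mu> x) (Vu \<nu> x) = 0 \<and>
        pairing (\<theta>l \<mu> x) (Vl \<nu> x) = 0)"

section \<open>Complex distributions\<close>

(* Distributions on U are functions of the base point that are extensional outside U, so that they
   can be counted. *)

definition complex_subbundle :: "(real^'n) set \<Rightarrow> nat \<Rightarrow> (real^'n \<Rightarrow> (complex^'n) set) \<Rightarrow> bool" where
  "complex_subbundle U r D \<longleftrightarrow>
     (\<forall>x\<in>U. \<exists>W E. open W \<and> x \<in> W \<and> W \<subseteq> U \<and> (\<forall>i<r. smooth_on W (E i)) \<and>
        (\<forall>y\<in>W. D y = vec.span ((\<lambda>i::nat. E i y) ` {..<r}) \<and> vec.dim (D y) = r))"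

definition maximal_isotropic ::
  "(real^'n) set \<Rightarrow> (real^'n \<Rightarrow> real^'n^'n) \<Rightarrow> (real^'n \<Rightarrow> (complex^'n) set) \<Rightarrow> bool" where
  "maximal_isotropic U g D \<longleftrightarrow> complex_subbundle U (CARD('n) div 2) D \<and>
     (\<forall>x\<in>U. \<forall>X\<in>D x. \<forall>Y\<in>D x. pairing X (cmat (g x) *v Y) = 0)"

(* Used both for real and for complex vector fields. *)
definition lie_bracket ::
  "(real^'n \<Rightarrow> 'a::real_normed_field^'n) \<Rightarrow> (real^'n \<Rightarrow> 'a^'n) \<Rightarrow> real^'n \<Rightarrow> 'a^'n" where
  "lie_bracket X Y x = (\<Sum>j\<in>UNIV. X x $ j *s pderiv_coord j Y x - Y x $ j *s pderiv_coord j X x)"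

definition integrable_distribution ::
  "(real^'n) set \<Rightarrow> (real^'n \<Rightarrow> (complex^'n) set) \<Rightarrow> bool" where
  "integrable_distribution U D \<longleftrightarrow>
     (\<forall>W X Y. open W \<and> W \<subseteq> U \<and> smooth_on W X \<and> smooth_on W Y \<and>
        (\<forall>x\<in>W. X x \<in> D x \<and> Y x \<in> D x) \<longrightarrow> (\<forall>x\<in>W. lie_bracket X Y x \<in> D x))"

(* S is the set of those indices for which the upper one-form is chosen from the pair. *)
definition annihilator_distribution ::
  "(real^'n) set \<Rightarrow> ('m::finite \<Rightarrow> real^'n \<Rightarrow> complex^'n) \<Rightarrow>
   ('m \<Rightarrow> real^'n \<Rightarrow> complex^'n) \<Rightarrow> 'm set \<Rightarrow> real^'n \<Rightarrow> (complex^'n) set" where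
  "annihilator_distribution U \<theta>u \<theta>l S =
     (\<lambda>x\<in>U. {Z. \<forall>\<mu>. pairing (if \<mu> \<in> S then \<theta>u \<mu> x else \<theta>l \<mu> x) Z = 0})"

definition assoc_distributions ::
  "(real^'n) set \<Rightarrow> ('m::finite \<Rightarrow> real^'n \<Rightarrow> complex^'n) \<Rightarrow>
   ('m \<Rightarrow> real^'n \<Rightarrow> complex^'n) \<Rightarrow> (real^'n \<Rightarrow> (complex^'n) set) set" where
  "assoc_distributions U \<theta>u \<theta>l = range (annihilator_distribution U \<theta>u \<theta>l)"

section \<open>Complex structures\<close>

definition nijenhuis ::
  "(real^'n \<Rightarrow> real^'n^'n) \<Rightarrow> (real^'n \<Rightarrow> real^'n) \<Rightarrow> (real^'n \<Rightarrow> real^'n) \<Rightarrow> real^'n \<Rightarrow> real^'n"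
  where
  "nijenhuis J X Y x =
     lie_bracket (\<lambda>y. J y *v X y) (\<lambda>y. J y *v Y y) x
     - J x *v lie_bracket (\<lambda>y. J y *v X y) Y x
     - J x *v lie_bracket X (\<lambda>y. J y *v Y y) x
     - lie_bracket X Y x"

(* Metric-compatible almost complex structures with vanishing Nijenhuis tensor. *)
definition compatible_complex_structure ::
  "(real^'n) set \<Rightarrow> (real^'n \<Rightarrow> real^'n^'n) \<Rightarrow> (real^'n \<Rightarrow> real^'n^'n) \<Rightarrow> bool" where
  "compatible_complex_structure U g J \<longleftrightarrow>
     smooth_on U J \<and>
     (\<forall>x\<in>U. J x ** J x = - mat 1 \<and> transpose (J x) ** g x ** J x = g x) \<and>
     (\<forall>W X Y. open W \<and> W \<subseteq> U \<and> smooth_on W X \<and> smooth_on W Y \<longrightarrow>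
        (\<forall>x\<in>W. nijenhuis J X Y x = 0))"

(* The bundle T^{1,0}. *)
definition T10 :: "(real^'n) set \<Rightarrow> (real^'n \<Rightarrow> real^'n^'n) \<Rightarrow> real^'n \<Rightarrow> (complex^'n) set" where
  "T10 U J = (\<lambda>x\<in>U. {Z. cmat (J x) *v Z = \<i> *s Z})"

section \<open>Geodesic congruences\<close>

definition line_field :: "(real^'n) set \<Rightarrow> (real^'n \<Rightarrow> (real^'n) set) \<Rightarrow> bool" where
  "line_field U L \<longleftrightarrow>
     (\<forall>x\<in>U. \<exists>W k. open W \<and> x \<in> W \<and> W \<subseteq> U \<and> smooth_on W k \<and>
        (\<forall>y\<in>W. k y \<noteq> 0 \<and> L y = span {k y}))"

(* The real points of the intersection of D with its complex conjugate.  That intersection is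
   invariant under conjugation, hence it is the complexification of its real points. *)
definition real_points ::
  "(real^'n) set \<Rightarrow> (real^'n \<Rightarrow> (complex^'n) set) \<Rightarrow> real^'n \<Rightarrow> (real^'n) set" where
  "real_points U D = (\<lambda>x\<in>U. {v. cvec v \<in> D x \<inter> cnj_vec ` D x})"

definition integral_curve ::
  "(real^'n) set \<Rightarrow> (real^'n \<Rightarrow> (real^'n) set) \<Rightarrow> real set \<Rightarrow> (real \<Rightarrow> real^'n) \<Rightarrow> bool" where
  "integral_curve U L I \<gamma> \<longleftrightarrow> open I \<and> is_interval I \<and> smooth_on I \<gamma> \<and>
     (\<forall>t\<in>I. \<gamma> t \<in> U \<and> vector_derivative \<gamma> (at t) \<noteq> 0 \<and> vector_derivative \<gamma> (at t) \<in> L (\<gamma> t))"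

(* Affinely parametrised geodesics. *)
definition geodesic :: "(real^'n \<Rightarrow> real^'n^'n) \<Rightarrow> real set \<Rightarrow> (real \<Rightarrow> real^'n) \<Rightarrow> bool" where
  "geodesic g I \<gamma> \<longleftrightarrow> (\<exists>v. \<forall>s\<in>I. (\<gamma> has_vector_derivative v s) (at s) \<and>
     (v has_vector_derivative
        (\<chi> k. - (\<Sum>i\<in>UNIV. \<Sum>j\<in>UNIV. christoffel g (\<gamma> s) k i j * v s $ i * v s $ j))) (at s))"

(* A congruence is given by its line field, its members being the integral curves.  These carry no
   preferred parameter, so they are required to be geodesics after a reparametrisation h. *)
definition null_geodesic_congruence ::
  "(real^'n) set \<Rightarrow> (real^'n \<Rightarrow> real^'n^'n) \<Rightarrow> (real^'n \<Rightarrow> (real^'n) set) \<Rightarrow> bool" where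
  "null_geodesic_congruence U g L \<longleftrightarrow> line_field U L \<and>
     (\<forall>x\<in>U. \<forall>v\<in>L x. v \<bullet> (g x *v v) = 0) \<and>
     (\<forall>I \<gamma>. integral_curve U L I \<gamma> \<longrightarrow>
        (\<exists>J h. open J \<and> is_interval J \<and> bij_betw h J I \<and>
           (\<forall>s\<in>J. \<exists>d. (h has_real_derivative d) (at s) \<and> d \<noteq> 0) \<and>
           geodesic g J (\<gamma> \<circ> h)))"

end

theory Submission
  imports Defs
begin

text \<open>
  Choose one covector from each pair of the null coframe.  Call the chosen covectors \<open>\<alpha>\<^sub>\<mu>\<close>, the others
  \<open>\<beta>\<^sub>\<mu>\<close>, and let \<open>e\<^sub>\<mu>\<close>, \<open>f\<^sub>\<mu>\<close> be the dual frame with \<open>\<beta>\<^sub>\<mu>(e\<^sub>\<nu>) = \<alpha>\<^sub>\<mu>(f\<^sub>\<nu>) = \<delta>\<close>.  The distribution \<open>D\<close> annihilated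
  by the \<open>\<alpha>\<^sub>\<mu>\<close> is spanned by the \<open>e\<^sub>\<mu>\<close>, it is isotropic, and \<open>\<phi>(-, e\<^sub>\<mu>) = \<kappa>\<^sub>\<mu> \<alpha>\<^sub>\<mu>\<close> where \<open>\<kappa>\<^sub>\<mu> = \<plusminus>\<lambda>\<^sub>\<mu>\<close>.
  Differentiating \<open>g(e\<^sub>\<mu>, e\<^sub>\<nu>) = 0\<close> and \<open>\<phi>(e\<^sub>\<mu>, e\<^sub>\<nu>) = 0\<close> in the direction \<open>X\<close> yields
  \<open>(\<nabla>\<^sub>X \<phi>)(e\<^sub>\<mu>, e\<^sub>\<nu>) = -(\<kappa>\<^sub>\<mu> + \<kappa>\<^sub>\<nu>) \<alpha>\<^sub>\<nu>(\<nabla>\<^sub>X e\<^sub>\<mu>)\<close>.  For \<open>X\<close> in \<open>D\<close> the trace part of the conformal Killing-Yano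
  equation drops out, because \<open>D\<close> is isotropic, and the left-hand side is \<open>\<tau>(X, e\<^sub>\<mu>, e\<^sub>\<nu>)/3\<close>; the algebraic
  condition on \<open>\<tau>\<close> says that it is zero.  The factor \<open>\<kappa>\<^sub>\<mu> + \<kappa>\<^sub>\<nu>\<close> is not zero because the \<open>2m\<close> eigenvalues
  are distinct.  So \<open>(\<nabla>\<^sub>X \<alpha>\<^sub>\<nu>)(Y) = 0\<close> for all \<open>X\<close> and \<open>Y\<close> in \<open>D\<close> (\<open>nabla_coform_vanishes\<close>).  As the connection
  is torsion-free, \<open>D\<close> is integrable (\<open>integrable_eigendist\<close>); and a curve with velocity in \<open>D\<close> has its
  covariant acceleration in \<open>D\<close> (\<open>acceleration_in_eigendist\<close>).  Since the hypotheses are symmetric under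
  exchanging the members of a pair (\<open>select\<close>), this treats all \<open>2\<^sup>m\<close> distributions at once.

  The statements about signature rest on the fact that complex conjugation maps eigenvectors of the
  real tensor \<open>\<phi>\<close> to eigenvectors for the conjugate eigenvalue.  In Euclidean signature all eigenvalues
  are imaginary, so conjugation interchanges the lines of \<open>e\<^sub>\<mu>\<close> and \<open>f\<^sub>\<mu>\<close>.  The endomorphism equal to \<open>i\<close>
  on \<open>D\<close> and to \<open>-i\<close> on the complementary distribution is then real: it is an orthogonal almost complex
  structure, and its Nijenhuis tensor vanishes because \<open>D\<close> is integrable
  (\<open>eigenstructure_complex_structure\<close>).

  In Lorentzian signature a Hermitian version of the fact that there are no null or negative
  planes (\<open>lorentzian_form_planes\<close>) shows that exactly one pair of eigenvalues is real and that all
  others are imaginary (\<open>eigval_lorentzian\<close>).  By connectedness the index of the real pair does not depend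
  on the point.  The real vectors in \<open>D\<close> form the real line in the direction of the one frame vector
  of \<open>D\<close> that belongs to this pair; there are two such lines, and each of them arises from half of the
  choices.  The acceleration of an integral curve lies in the same line, so that an affine parameter can
  be found by integration (\<open>geodesic_reparametrisation\<close>).
\<close>

section \<open>Smooth functions\<close>

lemma ck_on_subset: "ck_on k S f \<Longrightarrow> T \<subseteq> S \<Longrightarrow> ck_on k T f"
  by (induction k arbitrary: f) (auto intro: continuous_on_subset)

lemma frechet_derivative_cong_open:
  assumes "open S" "x \<in> S" "\<And>y. y \<in> S \<Longrightarrow> f y = g y"
  shows "frechet_derivative f (at x) = frechet_derivative g (at x)"
proof -
  have "(f has_derivative D) (at x) = (g has_derivative D) (at x)" for D
    using has_derivative_transform_within_open[OF _ assms(1,2)] assms(3) by metis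
  then show ?thesis
    by (simp add: frechet_derivative_def)
qed

lemma differentiable_cong_open:
  assumes "f differentiable (at x)" "open S" "x \<in> S" "\<And>y. y \<in> S \<Longrightarrow> f y = g y"
  shows "g differentiable (at x)"
  using assms has_derivative_transform_within_open unfolding differentiable_def by blast

text \<open>The Frechet derivative at a point of an open set sees only the values nearby, so the
  congruence passes to all derivatives.\<close>

lemma ck_on_cong:
  assumes "open S" "\<And>x. x \<in> S \<Longrightarrow> f x = g x" "ck_on k S f"
  shows "ck_on k S g"
  using assms(2,3)
proof (induction k arbitrary: f g)
  case 0
  then show ?case by (simp cong: continuous_on_cong)
next
  case (Suc k)
  have "frechet_derivative f (at x) v = frechet_derivative g (at x) v" if "x \<in> S" for x v
    using frechet_derivative_cong_open[OF assms(1) that, of f g] Suc.prems(1) by simp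
  then have "ck_on k S (\<lambda>x. frechet_derivative g (at x) v)" for v
    using Suc.prems(2) Suc.IH[of "\<lambda>x. frechet_derivative f (at x) v" "\<lambda>x. frechet_derivative g (at x) v"]
    by simp
  moreover have "g differentiable (at x)" if "x \<in> S" for x
    using differentiable_cong_open[OF _ assms(1) that Suc.prems(1)] Suc.prems(2) that by simp
  ultimately show ?case by simp
qed

lemma ck_on_Suc_imp: "ck_on (Suc k) S f \<Longrightarrow> ck_on k S f"
proof (induction k arbitrary: f)
  case 0
  then show ?case
    by (auto simp del: ck_on.simps(1) simp: ck_on.simps(1)[of S f]
        intro!: continuous_at_imp_continuous_on differentiable_imp_continuous_within)
next
  case (Suc k)
  have "ck_on (Suc k) S (\<lambda>x. frechet_derivative f (at x) v)" for v
    using Suc.prems by simp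
  then have "ck_on k S (\<lambda>x. frechet_derivative f (at x) v)" for v
    by (rule Suc.IH)
  with Suc.prems show ?case by simp
qed

lemma ck_on_const: "ck_on k S (\<lambda>x. a)"
  by (induction k arbitrary: a) (auto simp: frechet_derivative_const)

lemma ck_on_add:
  assumes "open S" "ck_on k S f" "ck_on k S g"
  shows "ck_on k S (\<lambda>x. f x + g x)"
  using assms(2,3)
proof (induction k arbitrary: f g)
  case 0
  then show ?case by (simp add: continuous_on_add)
next
  case (Suc k)
  have *: "((\<lambda>x. f x + g x) has_derivative
      (\<lambda>v. frechet_derivative f (at x) v + frechet_derivative g (at x) v)) (at x)"
    if "x \<in> S" for x
    using Suc.prems that by (intro has_derivative_add) (auto simp: frechet_derivative_works)
  have "ck_on k S (\<lambda>x. frechet_derivative f (at x) v + frechet_derivative g (at x) v)" for v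
    using Suc.prems by (intro Suc.IH) simp_all
  then have "ck_on k S (\<lambda>x. frechet_derivative (\<lambda>x. f x + g x) (at x) v)" for v
    by (rule ck_on_cong[OF assms(1), rotated]) (simp add: frechet_derivative_at[OF *, symmetric])
  with * show ?case unfolding ck_on.simps differentiable_def by blast
qed

text \<open>The derivative of a product is a sum of two products whose factors are one order less smooth
  at worst; the induction therefore has to range over both factors.\<close>

lemma ck_on_bilinear:
  assumes "bounded_bilinear p" "open S" "ck_on k S f" "ck_on k S g"
  shows "ck_on k S (\<lambda>x. p (f x) (g x))"
  using assms(3,4)
proof (induction k arbitrary: f g)
  case 0
  then show ?case
    unfolding ck_on.simps by (rule bounded_bilinear.continuous_on[OF assms(1)])
next
  case (Suc k)
  have *: "((\<lambda>x. p (f x) (g x)) has_derivative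
      (\<lambda>v. p (f x) (frechet_derivative g (at x) v) + p (frechet_derivative f (at x) v) (g x))) (at x)"
    if "x \<in> S" for x
    using Suc.prems that
    by (intro bounded_bilinear.FDERIV[OF assms(1)]) (auto simp: frechet_derivative_works)
  have "ck_on k S (\<lambda>x. p (f x) (frechet_derivative g (at x) v) + p (frechet_derivative f (at x) v) (g x))"
    for v
    using ck_on_Suc_imp[OF Suc.prems(1)] ck_on_Suc_imp[OF Suc.prems(2)] Suc.prems
    by (intro ck_on_add assms(2) Suc.IH) auto
  then have "ck_on k S (\<lambda>x. frechet_derivative (\<lambda>x. p (f x) (g x)) (at x) v)" for v
    by (rule ck_on_cong[OF assms(2), rotated]) (simp add: frechet_derivative_at[OF *, symmetric])
  with * show ?case unfolding ck_on.simps differentiable_def by blast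
qed

lemma ck_on_linear:
  assumes "bounded_linear h" "open S" "ck_on k S f"
  shows "ck_on k S (\<lambda>x. h (f x))"
  using assms(3)
proof (induction k arbitrary: f)
  case 0
  then show ?case
    unfolding ck_on.simps by (rule bounded_linear.continuous_on[OF assms(1)])
next
  case (Suc k)
  have *: "((\<lambda>x. h (f x)) has_derivative (\<lambda>v. h (frechet_derivative f (at x) v))) (at x)"
    if "x \<in> S" for x
    using Suc.prems that
    by (intro bounded_linear.has_derivative[OF assms(1)]) (auto simp: frechet_derivative_works)
  have "ck_on k S (\<lambda>x. h (frechet_derivative f (at x) v))" for v
    using Suc.prems by (intro Suc.IH) auto
  then have "ck_on k S (\<lambda>x. frechet_derivative (\<lambda>x. h (f x)) (at x) v)" for v
    by (rule ck_on_cong[OF assms(2), rotated]) (simp add: frechet_derivative_at[OF *, symmetric])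
  with * show ?case unfolding ck_on.simps differentiable_def by blast
qed

lemma smooth_on_subset: "smooth_on S f \<Longrightarrow> T \<subseteq> S \<Longrightarrow> smooth_on T f"
  by (auto simp: smooth_on_def intro: ck_on_subset)

lemma smooth_on_cong:
  "open S \<Longrightarrow> (\<And>x. x \<in> S \<Longrightarrow> f x = g x) \<Longrightarrow> smooth_on S f \<Longrightarrow> smooth_on S g"
  using ck_on_cong unfolding smooth_on_def by metis

lemma smooth_on_linear:
  "bounded_linear h \<Longrightarrow> open S \<Longrightarrow> smooth_on S f \<Longrightarrow> smooth_on S (\<lambda>x. h (f x))"
  by (auto simp: smooth_on_def intro: ck_on_linear)

lemma smooth_on_bilinear:
  "bounded_bilinear p \<Longrightarrow> open S \<Longrightarrow> smooth_on S f \<Longrightarrow> smooth_on S g \<Longrightarrow> smooth_on S (\<lambda>x. p (f x) (g x))"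
  by (auto simp: smooth_on_def intro: ck_on_bilinear)

lemma smooth_on_add:
  "open S \<Longrightarrow> smooth_on S f \<Longrightarrow> smooth_on S g \<Longrightarrow> smooth_on S (\<lambda>x. f x + g x)"
  by (auto simp: smooth_on_def intro: ck_on_add)

lemma smooth_on_diff:
  "open S \<Longrightarrow> smooth_on S f \<Longrightarrow> smooth_on S g \<Longrightarrow> smooth_on S (\<lambda>x. f x - g x)"
  using smooth_on_add[of S f "\<lambda>x. - g x"] smooth_on_linear[OF bounded_linear_minus[OF bounded_linear_ident]]
  by auto

lemma smooth_on_sum:
  "open S \<Longrightarrow> (\<And>i. i \<in> I \<Longrightarrow> smooth_on S (f i)) \<Longrightarrow> smooth_on S (\<lambda>x. \<Sum>i\<in>I. f i x)"
  by (induction I rule: infinite_finite_induct)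
    (auto simp: smooth_on_def ck_on_const intro!: ck_on_add)

lemma smooth_on_imp_differentiable: "smooth_on S f \<Longrightarrow> x \<in> S \<Longrightarrow> f differentiable (at x)"
  unfolding smooth_on_def by (metis ck_on.simps(2))

lemma smooth_on_imp_continuous: "smooth_on S f \<Longrightarrow> continuous_on S f"
  unfolding smooth_on_def by (metis ck_on.simps(1))

lemma smooth_on_frechet_derivative:
  "smooth_on S f \<Longrightarrow> smooth_on S (\<lambda>x. frechet_derivative f (at x) v)"
  unfolding smooth_on_def by (metis ck_on.simps(2))

section \<open>The complex-bilinear pairing and complexification\<close>

lemma pairing_simps [simp]:
  "pairing (X + Y) Z = pairing X Z + pairing Y Z"
  "pairing Z (X + Y) = pairing Z X + pairing Z Y"
  "pairing (X - Y) Z = pairing X Z - pairing Y Z"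
  "pairing Z (X - Y) = pairing Z X - pairing Z Y"
  "pairing (- X) Z = - pairing X Z"
  "pairing Z (- X) = - pairing Z X"
  "pairing (a *s X) Z = a * pairing X Z"
  "pairing Z (a *s X) = a * pairing Z X"
  "pairing 0 Z = 0"
  "pairing Z 0 = 0"
  for X Y Z :: "complex^'n"
  by (auto simp: pairing_def sum.distrib sum_subtractf sum_negf sum_distrib_left algebra_simps)

lemma pairing_sum [simp]:
  "pairing (\<Sum>i\<in>I. X i) Z = (\<Sum>i\<in>I. pairing (X i) Z)"
  "pairing Z (\<Sum>i\<in>I. X i) = (\<Sum>i\<in>I. pairing Z (X i))"
  for Z :: "complex^'n"
  by (induction I rule: infinite_finite_induct) auto

lemma pairing_scaleR [simp]:
  "pairing (r *\<^sub>R X) Z = r *\<^sub>R pairing X Z"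
  "pairing Z (r *\<^sub>R X) = r *\<^sub>R pairing Z X"
  for X Z :: "complex^'n"
  by (auto simp: pairing_def scaleR_sum_right)

lemma pairing_commute: "pairing X Y = pairing Y (X :: complex^'n)"
  by (simp add: pairing_def mult.commute)

lemma pairing_matrix_left: "pairing X (A *v Y) = pairing (transpose A *v X) (Y :: complex^'n)"
  for X :: "complex^'m"
  unfolding pairing_def matrix_vector_mult_def transpose_def
  by (simp add: sum_distrib_left sum_distrib_right mult_ac) (rule sum.swap)

lemma pairing_axis [simp]: "pairing X (axis k a) = X $ k * a" "pairing (axis k a) X = a * X $ k"
  for X :: "complex^'n"
  by (auto simp: pairing_def axis_def if_distrib[where f="\<lambda>z. z * _"] if_distrib[where f="\<lambda>z. _ * z"] cong: if_cong)

lemma pairing_cnj: "pairing (cnj_vec X) (cnj_vec Y) = cnj (pairing X Y)"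
  by (simp add: pairing_def cnj_vec_def)

lemma cnj_vec_simps [simp]:
  "cnj_vec (X + Y) = cnj_vec X + cnj_vec Y"
  "cnj_vec (X - Y) = cnj_vec X - cnj_vec Y"
  "cnj_vec (a *s X) = cnj a *s cnj_vec X"
  "cnj_vec (cnj_vec X) = X"
  "cnj_vec (cvec v) = cvec v"
  "cnj_vec 0 = 0"
  by (auto simp: cnj_vec_def cvec_def vec_eq_iff)

lemma cnj_vec_eq_0 [simp]: "cnj_vec X = 0 \<longleftrightarrow> X = 0"
  by (metis cnj_vec_simps(4,6))

lemma cnj_vec_cmat: "cnj_vec (cmat A *v X) = cmat A *v cnj_vec X"
  by (simp add: cnj_vec_def cmat_def cvec_def matrix_vector_mult_def vec_eq_iff)

lemma cvec_simps [simp]: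
  "cvec (u + v) = cvec u + cvec v"
  "cvec (u - v) = cvec u - cvec v"
  "cvec (- v) = - cvec v"
  "cvec (r *\<^sub>R v) = of_real r *s cvec v"
  "cvec 0 = 0"
  "cvec u = cvec v \<longleftrightarrow> u = v"
  "cvec v $ i = of_real (v $ i)"
  by (auto simp: cvec_def vec_eq_iff)

lemma cvec_eq_0 [simp]: "cvec v = 0 \<longleftrightarrow> v = 0"
  by (metis cvec_simps(5,6))

lemma cmat_nth [simp]: "cmat A $ i $ j = of_real (A $ i $ j)" "cmat A $ i = cvec (A $ i)"
  by (auto simp: cmat_def cvec_def)

lemma cmat_simps:
  "cmat (A + B) = cmat A + cmat B"
  "cmat (A - B) = cmat A - cmat B"
  "cmat (- A) = - cmat A"
  "cmat (A ** C) = cmat A ** cmat C"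
  "cmat (transpose A) = transpose (cmat A)"
  "cmat (mat 1) = mat 1"
  "cmat A *v cvec v = cvec (A *v v)"
  by (auto simp: vec_eq_iff matrix_matrix_mult_def transpose_def mat_def matrix_vector_mult_def)

lemma cmat_inject: "cmat A = cmat B \<longleftrightarrow> A = B"
  by (auto simp: vec_eq_iff)

lemma pairing_cvec: "pairing (cvec u) (cvec v) = of_real (u \<bullet> v)"
  by (simp add: pairing_def inner_vec_def)

lemma matrix_eq_pairing:
  assumes "\<And>X Y. pairing X (A *v Y) = pairing X (B *v (Y :: complex^'n))"
  shows "A = (B :: complex^'n^'m)"
proof -
  have "A *v Y = B *v Y" for Y
    using assms[of "axis _ 1" Y] by (simp add: vec_eq_iff)
  then show ?thesis by (simp add: matrix_eq)
qed

lemma outer_products_mult: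
  fixes a b Z :: "complex^'n"
  shows "sym_prod a b *v Z = (pairing b Z / 2) *s a + (pairing a Z / 2) *s b"
    and "wedge11 a b *v Z = pairing b Z *s a - pairing a Z *s b"
    and "map_matrix ((*) k) A *v Z = k *s (A *v Z)"
  by (auto simp: sym_prod_def wedge11_def map_matrix_def matrix_vector_mult_def vec_eq_iff pairing_def
      sum_distrib_left sum_distrib_right sum_divide_distrib sum.distrib sum_subtractf algebra_simps
      add_divide_distrib)

lemma sum_matrix_mult: "(\<Sum>i\<in>I. A i) *v Z = (\<Sum>i\<in>I. A i *v (Z::'a::comm_ring_1^'n))"
  by (induction I rule: infinite_finite_induct) (auto simp: matrix_vector_mult_add_rdistrib)

text \<open>The three cyclic terms of the wedge product are brought to the same contraction by renaming
  the summation indices cyclically.\<close>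

lemma wedge12_contract:
  fixes \<alpha> X Y Z :: "complex^'n"
  shows "(\<Sum>i\<in>UNIV. \<Sum>j\<in>UNIV. \<Sum>k\<in>UNIV. X $ i * Y $ j * Z $ k * wedge12 \<alpha> \<omega> $ i $ j $ k)
    = pairing \<alpha> X * pairing Y (\<omega> *v Z) + pairing \<alpha> Y * pairing Z (\<omega> *v X)
      + pairing \<alpha> Z * pairing X (\<omega> *v Y)"
proof -
  let ?s = "\<lambda>h :: 'n \<Rightarrow> 'n \<Rightarrow> 'n \<Rightarrow> complex. \<Sum>i\<in>UNIV. \<Sum>j\<in>UNIV. \<Sum>k\<in>UNIV. h i j k"
  have contract: "pairing \<alpha> X * pairing Y (\<omega> *v Z) = ?s (\<lambda>i j k. X $ i * Y $ j * Z $ k * (\<alpha> $ i * \<omega> $ j $ k))"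
    for X Y Z
    unfolding pairing_def matrix_vector_mult_def
    by (subst sum_product) (simp add: sum_distrib_left mult_ac)
  have rotate: "?s h = ?s (\<lambda>i j k. h k i j)" for h
  proof -
    have "?s h = (\<Sum>j\<in>UNIV. \<Sum>i\<in>UNIV. \<Sum>k\<in>UNIV. h i j k)" by (rule sum.swap)
    also have "\<dots> = (\<Sum>j\<in>UNIV. \<Sum>k\<in>UNIV. \<Sum>i\<in>UNIV. h i j k)"
      by (rule sum.cong[OF refl], rule sum.swap)
    finally show ?thesis .
  qed
  have "?s (\<lambda>i j k. Z $ i * X $ j * Y $ k * (\<alpha> $ i * \<omega> $ j $ k))
      = ?s (\<lambda>i j k. X $ i * Y $ j * Z $ k * (\<alpha> $ k * \<omega> $ i $ j))"
    using rotate[of "\<lambda>i j k. Z $ i * X $ j * Y $ k * (\<alpha> $ i * \<omega> $ j $ k)"] by (simp only: mult_ac)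
  moreover have "?s (\<lambda>i j k. Y $ i * Z $ j * X $ k * (\<alpha> $ i * \<omega> $ j $ k))
      = ?s (\<lambda>i j k. X $ i * Y $ j * Z $ k * (\<alpha> $ j * \<omega> $ k $ i))"
    using rotate[of "\<lambda>i j k. X $ i * Y $ j * Z $ k * (\<alpha> $ j * \<omega> $ k $ i)"] by (simp only: mult_ac)
  ultimately show ?thesis
    unfolding contract wedge12_def
    by (simp add: sum.distrib distrib_left)
qed

section \<open>Coordinate derivatives\<close>

lemma has_derivative_pderiv_coord:
  assumes "f differentiable (at x)"
  shows "(f has_derivative (\<lambda>v. \<Sum>k\<in>UNIV. v $ k *\<^sub>R pderiv_coord k f x)) (at x)"
proof -
  interpret linear "frechet_derivative f (at x)"
    using assms by (rule linear_frechet_derivative)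
  have "frechet_derivative f (at x) v = (\<Sum>k\<in>UNIV. v $ k *\<^sub>R pderiv_coord k f x)" for v
  proof -
    have "frechet_derivative f (at x) v = frechet_derivative f (at x) (\<Sum>k\<in>UNIV. v $ k *\<^sub>R axis k 1)"
      using basis_expansion[of v] by (simp add: scalar_mult_eq_scaleR)
    also have "\<dots> = (\<Sum>k\<in>UNIV. v $ k *\<^sub>R pderiv_coord k f x)"
      by (simp add: sum scale pderiv_coord_def)
    finally show ?thesis .
  qed
  then have "frechet_derivative f (at x) = (\<lambda>v. \<Sum>k\<in>UNIV. v $ k *\<^sub>R pderiv_coord k f x)"
    by blast
  then show ?thesis
    using assms by (metis frechet_derivative_works)
qed

lemma pderiv_coord_at: "(f has_derivative D) (at x) \<Longrightarrow> pderiv_coord k f x = D (axis k 1)"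
  by (simp add: pderiv_coord_def frechet_derivative_at[symmetric])

lemma pderiv_coord_linear:
  assumes "bounded_linear h" "f differentiable (at x)"
  shows "pderiv_coord k (\<lambda>y. h (f y)) x = h (pderiv_coord k f x)"
  using bounded_linear.has_derivative[OF assms(1), of f "frechet_derivative f (at x)" "at x"] assms(2)
  by (subst pderiv_coord_at) (auto simp: frechet_derivative_works pderiv_coord_def)

lemma pderiv_coord_bilinear:
  assumes "bounded_bilinear p" "f differentiable (at x)" "g differentiable (at x)"
  shows "pderiv_coord k (\<lambda>y. p (f y) (g y)) x = p (f x) (pderiv_coord k g x) + p (pderiv_coord k f x) (g x)"
  using bounded_bilinear.FDERIV[OF assms(1), of f "frechet_derivative f (at x)" x UNIV g
      "frechet_derivative g (at x)"] assms(2,3)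
  by (subst pderiv_coord_at) (auto simp: frechet_derivative_works pderiv_coord_def)

lemma pderiv_coord_cong_open:
  assumes "open S" "x \<in> S" "\<And>y. y \<in> S \<Longrightarrow> f y = g y"
  shows "pderiv_coord k f x = pderiv_coord k g x"
  using frechet_derivative_cong_open[OF assms] by (simp add: pderiv_coord_def)

text \<open>The form in which every pointwise identity between the frame fields is differentiated.\<close>

lemma pderiv_coord_const_on:
  assumes "open S" "x \<in> S" "\<And>y. y \<in> S \<Longrightarrow> f y = a"
  shows "pderiv_coord k f x = 0"
  using pderiv_coord_cong_open[OF assms, where k=k] by (simp add: pderiv_coord_def)

lemma bounded_bilinear_pairing: "bounded_bilinear (pairing :: complex^'n \<Rightarrow> complex^'n \<Rightarrow> complex)"
  by (auto simp: bilinear_conv_bounded_bilinear[symmetric] bilinear_def intro!: linearI)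

lemma bounded_bilinear_matrix_vector_mult:
  "bounded_bilinear ((*v) :: complex^'n^'m \<Rightarrow> complex^'n \<Rightarrow> complex^'m)"
  by (auto simp: bilinear_conv_bounded_bilinear[symmetric] bilinear_def vec_eq_iff matrix_vector_mult_def
      sum.distrib scaleR_sum_right algebra_simps intro!: linearI)

lemma bounded_linear_cmat: "bounded_linear (cmat :: real^'n^'m \<Rightarrow> _)"
  by (auto simp: linear_conv_bounded_linear[symmetric] vec_eq_iff scaleR_conv_of_real[where 'a=complex] intro!: linearI)

lemma bounded_linear_cvec: "bounded_linear (cvec :: real^'n \<Rightarrow> _)"
  by (auto simp: linear_conv_bounded_linear[symmetric] vec_eq_iff scaleR_conv_of_real[where 'a=complex] intro!: linearI)

lemma bounded_linear_transpose: "bounded_linear (transpose :: real^'n^'m \<Rightarrow> _)"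
  by (auto simp: linear_conv_bounded_linear[symmetric] vec_eq_iff transpose_def intro!: linearI)

section \<open>The Levi-Civita connection in coordinates\<close>

definition christoffel_matrix :: "(real^'n \<Rightarrow> real^'n^'n) \<Rightarrow> real^'n \<Rightarrow> 'n \<Rightarrow> real^'n^'n" where
  "christoffel_matrix g x k = (\<chi> l j. christoffel g x l k j)"

text \<open>Components \<open>\<nabla>\<^sub>k Y\<close> and \<open>\<nabla>\<^sub>k B\<close> of the covariant derivatives of a complexified vector field and of a
  real bilinear form, with the Christoffel symbols \<open>\<Gamma>\<^sup>l\<^sub>k\<^sub>j\<close> collected in one matrix for each \<open>k\<close>.\<close>

definition nabla_vector ::
  "(real^'n \<Rightarrow> real^'n^'n) \<Rightarrow> 'n \<Rightarrow> (real^'n \<Rightarrow> complex^'n) \<Rightarrow> real^'n \<Rightarrow> complex^'n" where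
  "nabla_vector g k Y x = pderiv_coord k Y x + cmat (christoffel_matrix g x k) *v Y x"

definition nabla_bilinear ::
  "(real^'n \<Rightarrow> real^'n^'n) \<Rightarrow> 'n \<Rightarrow> (real^'n \<Rightarrow> real^'n^'n) \<Rightarrow> real^'n \<Rightarrow> real^'n^'n" where
  "nabla_bilinear g k B x = pderiv_coord k B x
     - transpose (christoffel_matrix g x k) ** B x - B x ** christoffel_matrix g x k"

lemma nabla_bilinear_eq_nabla2: "nabla_bilinear g k B x = nabla2 g B x (axis k 1)"
  by (simp add: nabla_bilinear_def nabla2_def vec_eq_iff christoffel_matrix_def matrix_matrix_mult_def
      transpose_def axis_def if_distrib[where f="\<lambda>z. z * _"] mult.commute cong: if_cong)

lemma cmat_linear_ops:
  "cmat (A + B) *v Z = cmat A *v Z + cmat B *v Z"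
  "cmat (A - B) *v Z = cmat A *v Z - cmat B *v Z"
  "cmat (A ** C) *v Z' = cmat A *v (cmat C *v Z')"
  by (simp_all add: cmat_simps matrix_vector_mult_add_rdistrib matrix_vector_mult_diff_rdistrib
      matrix_vector_mul_assoc)

text \<open>The Leibniz rule for the scalar \<open>B(Y, Z)\<close>: the Christoffel terms of the three covariant
  derivatives cancel.\<close>

lemma nabla_leibniz:
  assumes "B differentiable (at x)" "Y differentiable (at x)" "Z differentiable (at x)"
  shows "pderiv_coord k (\<lambda>y. pairing (Y y) (cmat (B y) *v Z y)) x
    = pairing (Y x) (cmat (nabla_bilinear g k B x) *v Z x)
      + pairing (nabla_vector g k Y x) (cmat (B x) *v Z x)
      + pairing (Y x) (cmat (B x) *v nabla_vector g k Z x)"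
proof -
  have B: "(\<lambda>y. cmat (B y)) differentiable (at x)"
    using assms(1) bounded_linear.has_derivative[OF bounded_linear_cmat] unfolding differentiable_def
    by blast
  have BZ: "(\<lambda>y. cmat (B y) *v Z y) differentiable (at x)"
    using B assms(3) bounded_bilinear.FDERIV[OF bounded_bilinear_matrix_vector_mult]
    unfolding differentiable_def by blast
  have "pderiv_coord k (\<lambda>y. pairing (Y y) (cmat (B y) *v Z y)) x
     = pairing (Y x) (cmat (B x) *v pderiv_coord k Z x + cmat (pderiv_coord k B x) *v Z x)
       + pairing (pderiv_coord k Y x) (cmat (B x) *v Z x)"
    by (simp add: pderiv_coord_bilinear[OF bounded_bilinear_pairing assms(2) BZ]
        pderiv_coord_bilinear[OF bounded_bilinear_matrix_vector_mult B assms(3)]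
        pderiv_coord_linear[OF bounded_linear_cmat assms(1)])
  also have "\<dots> = pairing (Y x) (cmat (nabla_bilinear g k B x) *v Z x)
      + pairing (nabla_vector g k Y x) (cmat (B x) *v Z x)
      + pairing (Y x) (cmat (B x) *v nabla_vector g k Z x)"
    using pairing_matrix_left[of "Y x" "cmat (transpose (christoffel_matrix g x k))"]
    by (simp add: nabla_bilinear_def nabla_vector_def cmat_linear_ops matrix_vector_right_distrib
        cmat_simps(5) transpose_transpose del: vector_transpose_matrix transpose_matrix_vector)
  finally show ?thesis .
qed

lemma symmetric_matrix_nth:
  assumes "transpose A = A"
  shows "A $ i $ j = A $ j $ i"
proof -
  have "transpose A $ i $ j = A $ j $ i"
    by (simp add: transpose_def)
  with assms show ?thesis by simp
qed

lemma symmetric_pderiv_coord: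
  assumes "open U" "x \<in> U" "pseudo_metric_on U g"
  shows "pderiv_coord k g x $ i $ j = pderiv_coord k g x $ j $ i"
proof -
  have d: "g differentiable (at x)"
    using assms by (auto simp: pseudo_metric_on_def intro: smooth_on_imp_differentiable)
  have "pderiv_coord k g x = pderiv_coord k (\<lambda>y. transpose (g y)) x"
    using assms by (intro pderiv_coord_cong_open[of U]) (auto simp: pseudo_metric_on_def)
  also have "\<dots> = transpose (pderiv_coord k g x)"
    by (rule pderiv_coord_linear[OF bounded_linear_transpose d])
  finally show ?thesis
    by (rule symmetric_matrix_nth[OF sym])
qed

lemma christoffel_symmetric:
  assumes "open U" "x \<in> U" "pseudo_metric_on U g"
  shows "christoffel g x k i j = christoffel g x k j i"
  unfolding christoffel_def using symmetric_pderiv_coord[OF assms]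
  by (metis (no_types, lifting) add.commute)

lemma matrix_mul_matrix_inv: "invertible A \<Longrightarrow> A ** matrix_inv A = mat 1"
  unfolding invertible_def matrix_inv_def by (rule someI2_ex) auto

text \<open>Lowering the index of the Christoffel symbols cancels the inverse metric.  The result involves
  only first derivatives of \<open>g\<close>, which makes it convenient for symmetry and continuity arguments.\<close>

lemma metric_christoffel:
  assumes "open U" "x \<in> U" "pseudo_metric_on U g"
  shows "(\<Sum>l\<in>UNIV. g x $ p $ l * christoffel g x l i j)
    = (pderiv_coord i g x $ j $ p + pderiv_coord j g x $ i $ p - pderiv_coord p g x $ i $ j) / 2"
proof -
  let ?b = "\<chi> p. pderiv_coord i g x $ j $ p + pderiv_coord j g x $ i $ p - pderiv_coord p g x $ i $ j"
  have inv: "invertible (g x)"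
    using assms by (auto simp: pseudo_metric_on_def)
  have "(\<Sum>l\<in>UNIV. g x $ p $ l * christoffel g x l i j) = (g x *v (matrix_inv (g x) *v ?b)) $ p / 2"
    by (simp add: christoffel_def matrix_vector_mult_def flip: sum_divide_distrib)
  also have "g x *v (matrix_inv (g x) *v ?b) = ?b"
    by (simp add: matrix_vector_mul_assoc matrix_mul_matrix_inv[OF inv])
  finally show ?thesis by simp
qed

lemma nabla_metric:
  assumes "open U" "x \<in> U" "pseudo_metric_on U g"
  shows "nabla_bilinear g k g x = 0"
proof -
  have sym: "g x $ i $ j = g x $ j $ i" for i j
    using assms by (intro symmetric_matrix_nth) (auto simp: pseudo_metric_on_def)
  have "nabla_bilinear g k g x $ i $ j = pderiv_coord k g x $ i $ j
     - (\<Sum>l\<in>UNIV. g x $ j $ l * christoffel g x l k i) - (\<Sum>l\<in>UNIV. g x $ i $ l * christoffel g x l k j)"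
    for i j
    by (simp add: nabla_bilinear_def christoffel_matrix_def matrix_matrix_mult_def transpose_def
        sym[of _ j] mult.commute)
  then show ?thesis
    unfolding metric_christoffel[OF assms] using symmetric_pderiv_coord[OF assms]
    by (simp add: vec_eq_iff field_simps)
qed

text \<open>Antisymmetrising the conformal Killing-Yano equation removes both the Christoffel symbols and
  the terms with \<open>K\<close>, so the three-form in that equation is the exterior derivative.\<close>

lemma cky_three_form_eq_ext_deriv2:
  fixes g \<phi> :: "real^'n \<Rightarrow> real^'n^'n"
  assumes "open U" "x \<in> U" "pseudo_metric_on U g" "two_form_on U \<phi>" "three_form_on U T"
    and eq: "\<And>X. nabla2 g \<phi> x X = (1/3) *\<^sub>R insert_first X (T x)
       + (1 / (real CARD('n) - 1)) *\<^sub>R wedge11 (g x *v X) (K x)"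
  shows "T x = ext_deriv2 \<phi> x"
proof -
  let ?d = "1 / (real CARD('n) - 1)"
  have sym: "g x $ i $ j = g x $ j $ i" for i j
    using assms by (intro symmetric_matrix_nth) (auto simp: pseudo_metric_on_def)
  have skew: "\<phi> x $ i $ j = - \<phi> x $ j $ i" for i j
  proof -
    have "transpose (\<phi> x) = - \<phi> x"
      using assms by (auto simp: two_form_on_def)
    then have "transpose (\<phi> x) $ j $ i = - \<phi> x $ j $ i" by simp
    then show ?thesis by (simp add: transpose_def)
  qed
  have T: "T x $ i $ j $ k = T x $ j $ k $ i" "T x $ i $ j $ k = T x $ k $ i $ j" for i j k
    using assms(2,5) unfolding three_form_on_def by metis+
  define S where "S i j k = (\<Sum>l\<in>UNIV. christoffel g x l i j * \<phi> x $ l $ k)" for i j k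
  have S: "S i j k = S j i k" for i j k
    unfolding S_def using christoffel_symmetric[OF assms(1-3)] by metis
  have comp: "pderiv_coord k \<phi> x $ i $ j = S k i j - S k j i
        + T x $ k $ i $ j / 3 + ?d * (g x $ k $ i * K x $ j - g x $ k $ j * K x $ i)" for i j k
  proof -
    have "nabla2 g \<phi> x (axis k 1) $ i $ j = pderiv_coord k \<phi> x $ i $ j
       - (\<Sum>l\<in>UNIV. christoffel g x l k i * \<phi> x $ l $ j) - (\<Sum>l\<in>UNIV. christoffel g x l k j * \<phi> x $ i $ l)"
      by (simp add: nabla2_def axis_def if_distrib[where f="\<lambda>z. z * _"] cong: if_cong)
    moreover have "(\<Sum>l\<in>UNIV. christoffel g x l k j * \<phi> x $ i $ l)
        = - (\<Sum>l\<in>UNIV. christoffel g x l k j * \<phi> x $ l $ i)"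
      by (subst skew) (simp add: sum_negf)
    moreover have "insert_first (axis k 1) (T x) $ i $ j = T x $ k $ i $ j"
      by (simp add: insert_first_def axis_def if_distrib[where f="\<lambda>z. z * _"] cong: if_cong)
    moreover have "(g x *v axis k 1) $ i = g x $ k $ i" for i
      by (simp add: matrix_vector_mult_basis column_def sym)
    ultimately show ?thesis
      using arg_cong[OF eq[of "axis k 1"], of "\<lambda>A. A $ i $ j"]
      by (simp add: wedge11_def mult.commute S_def)
  qed
  have "ext_deriv2 \<phi> x $ i $ j $ k = T x $ i $ j $ k" for i j k
  proof -
    have "ext_deriv2 \<phi> x $ i $ j $ k
        = pderiv_coord i \<phi> x $ j $ k + pderiv_coord j \<phi> x $ k $ i + pderiv_coord k \<phi> x $ i $ j"
      by (simp add: ext_deriv2_def)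
    also have "\<dots> = T x $ i $ j $ k"
      unfolding comp
      using T[of i j k] S[of i j k] S[of j k i] S[of k i j] sym[of i j] sym[of j k] sym[of k i]
      by (simp add: right_diff_distrib)
    finally show ?thesis .
  qed
  then show ?thesis by (simp add: vec_eq_iff)
qed

section \<open>Null frames at a point\<close>

text \<open>The covectors \<open>\<alpha>\<^sub>\<mu>\<close> are the ones chosen from the pairs and \<open>\<beta>\<^sub>\<mu>\<close> the remaining ones.  The frame is
  labelled so that \<open>e\<^sub>\<mu>\<close> is dual to \<open>\<beta>\<^sub>\<mu>\<close> and annihilated by all \<open>\<alpha>\<^sub>\<nu>\<close>; hence the \<open>e\<^sub>\<mu>\<close> span the common
  kernel of the chosen covectors.\<close>

locale null_frame =
  fixes G :: "real^'n^'n" and c :: complex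
    and \<alpha> \<beta> e f :: "'m::finite \<Rightarrow> complex^'n"
  assumes metric: "cmat G = map_matrix ((*) c) (\<Sum>\<mu>\<in>UNIV. sym_prod (\<alpha> \<mu>) (\<beta> \<mu>))"
    and inv: "invertible G"
    and dual: "\<And>\<mu> \<nu>. pairing (\<alpha> \<mu>) (f \<nu>) = (if \<mu> = \<nu> then 1 else 0)"
      "\<And>\<mu> \<nu>. pairing (\<beta> \<mu>) (e \<nu>) = (if \<mu> = \<nu> then 1 else 0)"
      "\<And>\<mu> \<nu>. pairing (\<alpha> \<mu>) (e \<nu>) = 0"
      "\<And>\<mu> \<nu>. pairing (\<beta> \<mu>) (f \<nu>) = 0"
begin

lemma flip: "null_frame G c \<beta> \<alpha> f e"
proof
  have "sym_prod (\<beta> \<mu>) (\<alpha> \<mu>) = sym_prod (\<alpha> \<mu>) (\<beta> \<mu>)" for \<mu>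
    by (simp add: sym_prod_def vec_eq_iff algebra_simps)
  then show "cmat G = map_matrix ((*) c) (\<Sum>\<mu>\<in>UNIV. sym_prod (\<beta> \<mu>) (\<alpha> \<mu>))"
    by (simp add: metric)
qed (simp_all add: inv dual)

lemma metric_pairing:
  "pairing X (cmat G *v Y)
    = c / 2 * (\<Sum>\<mu>\<in>UNIV. pairing (\<alpha> \<mu>) X * pairing (\<beta> \<mu>) Y + pairing (\<beta> \<mu>) X * pairing (\<alpha> \<mu>) Y)"
  by (simp add: metric outer_products_mult sum_matrix_mult sum_distrib_left pairing_commute[of X]
      algebra_simps)

lemma metric_commute: "pairing X (cmat G *v Y) = pairing Y (cmat G *v X)"
  by (simp add: metric_pairing algebra_simps)

lemma metric_e: "cmat G *v e \<mu> = (c / 2) *s \<alpha> \<mu>"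
  by (simp add: metric outer_products_mult sum_matrix_mult dual if_distrib[where f="\<lambda>z. z / _"]
      if_distrib[where f="\<lambda>z. z *s _"] vector_smult_assoc cong: if_cong)

lemma metric_f: "cmat G *v f \<mu> = (c / 2) *s \<beta> \<mu>"
  using null_frame.metric_e[OF flip] .

lemma metric_nondegenerate:
  assumes "cmat G *v Z = 0"
  shows "Z = 0"
proof -
  obtain H where "H ** G = mat 1"
    using inv by (auto simp: invertible_def)
  then have "cmat H *v (cmat G *v Z) = Z"
    by (metis cmat_simps(4,6) matrix_vector_mul_assoc matrix_vector_mul_lid)
  with assms show ?thesis by simp
qed

text \<open>Completeness of the frame comes from the metric rather than from a count of dimensions: a
  vector annihilated by the whole coframe is in the kernel of \<open>G\<close>.\<close>

lemma eq_0I: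
  assumes "\<And>\<mu>. pairing (\<alpha> \<mu>) Z = 0" "\<And>\<mu>. pairing (\<beta> \<mu>) Z = 0"
  shows "Z = 0"
  by (rule metric_nondegenerate) (simp add: metric outer_products_mult sum_matrix_mult assms)

lemma frame_expansion:
  "Z = (\<Sum>\<mu>\<in>UNIV. pairing (\<beta> \<mu>) Z *s e \<mu>) + (\<Sum>\<mu>\<in>UNIV. pairing (\<alpha> \<mu>) Z *s f \<mu>)"
proof -
  have "Z - ((\<Sum>\<mu>\<in>UNIV. pairing (\<beta> \<mu>) Z *s e \<mu>) + (\<Sum>\<mu>\<in>UNIV. pairing (\<alpha> \<mu>) Z *s f \<mu>)) = 0"
    by (rule eq_0I) (simp_all add: dual if_distrib[where f="\<lambda>z. _ * z"] cong: if_cong)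
  then show ?thesis by simp
qed

lemma e_nonzero: "e \<mu> \<noteq> 0"
  using dual(2)[of \<mu> \<mu>] by auto

lemma c_nonzero: "c \<noteq> 0"
  using metric_e metric_nondegenerate e_nonzero by fastforce

definition D :: "(complex^'n) set" where
  "D = {Z. \<forall>\<mu>. pairing (\<alpha> \<mu>) Z = 0}"

lemma D_expansion: "Z \<in> D \<Longrightarrow> Z = (\<Sum>\<mu>\<in>UNIV. pairing (\<beta> \<mu>) Z *s e \<mu>)"
  using frame_expansion[of Z] by (simp add: D_def)

lemma D_isotropic: "X \<in> D \<Longrightarrow> Y \<in> D \<Longrightarrow> pairing X (cmat G *v Y) = 0"
  by (simp add: D_def metric_pairing)

lemma D_eq_span: "D = vec.span (range e)"
proof
  show "D \<subseteq> vec.span (range e)"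
  proof
    fix Z assume "Z \<in> D"
    moreover have "(\<Sum>\<mu>\<in>UNIV. pairing (\<beta> \<mu>) Z *s e \<mu>) \<in> vec.span (range e)"
      by (rule vec.span_sum, rule vec.span_scale, rule vec.span_base) simp
    ultimately show "Z \<in> vec.span (range e)"
      using D_expansion by metis
  qed
  have "vec.subspace D"
    by (auto simp: vec.subspace_def D_def)
  then show "vec.span (range e) \<subseteq> D"
    by (intro vec.span_minimal) (auto simp: D_def dual)
qed

lemma inj_e: "inj e"
proof (rule injI)
  fix \<mu> \<nu> assume "e \<mu> = e \<nu>"
  then show "\<mu> = \<nu>"
    using dual(2)[of \<mu> \<mu>] dual(2)[of \<mu> \<nu>] by (auto split: if_splits)
qed

lemma dim_D: "vec.dim D = CARD('m)"
proof -
  have "vec.independent (range e)"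
  proof (rule ccontr)
    assume "\<not> vec.independent (range e)"
    then obtain u v where uv: "v \<in> range e" "u v \<noteq> 0" "(\<Sum>v\<in>range e. u v *s v) = 0"
      by (subst (asm) vec.dependent_finite) auto
    then obtain \<mu> where \<mu>: "v = e \<mu>" by auto
    have "(\<Sum>\<nu>\<in>UNIV. u (e \<nu>) *s e \<nu>) = 0"
      using uv(3) by (simp add: sum.reindex[OF inj_e])
    then have "pairing (\<beta> \<mu>) (\<Sum>\<nu>\<in>UNIV. u (e \<nu>) *s e \<nu>) = 0" by simp
    then have "u (e \<mu>) = 0"
      by (simp add: dual if_distrib[where f="\<lambda>z. _ * z"] cong: if_cong del: pairing_commute)
    with uv \<mu> show False by simp
  qed
  then show ?thesis
    by (simp add: D_eq_span vec.dim_eq_card_independent card_image[OF inj_e])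
qed

end

section \<open>Eigenvalues and conjugation\<close>

lemma re_im_decomposition:
  obtains u v where "Z = cvec u + \<i> *s cvec v" "cnj_vec Z = cvec u - \<i> *s cvec v"
proof
  show "Z = cvec (\<chi> i. Re (Z $ i)) + \<i> *s cvec (\<chi> i. Im (Z $ i))"
    "cnj_vec Z = cvec (\<chi> i. Re (Z $ i)) - \<i> *s cvec (\<chi> i. Im (Z $ i))"
    by (simp_all add: vec_eq_iff complex_eq_iff cnj_vec_def)
qed

locale form_null_frame = null_frame G c \<alpha> \<beta> e f
  for G :: "real^'n^'n" and c :: complex and \<alpha> \<beta> e f :: "'m::finite \<Rightarrow> complex^'n" +
  fixes \<Phi> :: "real^'n^'n" and \<kappa> :: "'m \<Rightarrow> complex"
  assumes form: "cmat \<Phi> = (\<Sum>\<mu>\<in>UNIV. map_matrix ((*) (\<kappa> \<mu>)) (wedge11 (\<alpha> \<mu>) (\<beta> \<mu>)))"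
begin

text \<open>Since \<open>\<Phi> e\<^sub>\<mu> = \<kappa>\<^sub>\<mu> \<alpha>\<^sub>\<mu>\<close> and \<open>G e\<^sub>\<mu> = (c/2) \<alpha>\<^sub>\<mu>\<close>, this is the eigenvalue of \<open>G\<^sup>-\<^sup>1 \<Phi>\<close> on \<open>e\<^sub>\<mu>\<close>; the one
  on \<open>f\<^sub>\<mu>\<close> is its negative.\<close>

definition eigval :: "'m \<Rightarrow> complex" where
  "eigval \<mu> = 2 * \<kappa> \<mu> / c"

lemma eigval_add: "eigval \<mu> + eigval \<nu> = 2 * (\<kappa> \<mu> + \<kappa> \<nu>) / c"
  by (simp add: eigval_def distrib_left add_divide_distrib)

lemma form_e: "cmat \<Phi> *v e \<mu> = \<kappa> \<mu> *s \<alpha> \<mu>"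
  by (simp add: form outer_products_mult sum_matrix_mult dual if_distrib[where f="\<lambda>z. z *s _"]
      if_distrib[where f="\<lambda>z. _ *s z"] cong: if_cong)

lemma form_eigen_e: "cmat \<Phi> *v e \<mu> = eigval \<mu> *s (cmat G *v e \<mu>)"
  using c_nonzero by (simp add: form_e metric_e eigval_def vector_smult_assoc)

text \<open>An eigenvector with a nonzero component along a frame vector shares its eigenvalue with that
  frame vector.  The components along \<open>f\<^sub>\<mu>\<close> and \<open>e\<^sub>\<mu>\<close> are read off by \<open>\<alpha>\<^sub>\<mu>\<close> and \<open>\<beta>\<^sub>\<mu>\<close>.\<close>

lemma eigenvalue_cases:
  assumes "cmat \<Phi> *v Z = l *s (cmat G *v Z)"
  shows "pairing (\<alpha> \<mu>) Z \<noteq> 0 \<Longrightarrow> l = - eigval \<mu>" "pairing (\<beta> \<mu>) Z \<noteq> 0 \<Longrightarrow> l = eigval \<mu>"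
proof -
  have cancel: "l * c = 2 * k" if "k * P = l * (c / 2 * P)" "P \<noteq> 0" for k P
    using that by (simp add: field_simps)
  have \<Phi>: "pairing X (cmat \<Phi> *v Z) = (\<Sum>\<mu>\<in>UNIV. \<kappa> \<mu> * (pairing (\<alpha> \<mu>) X * pairing (\<beta> \<mu>) Z
      - pairing (\<beta> \<mu>) X * pairing (\<alpha> \<mu>) Z))" for X
    by (simp add: form outer_products_mult sum_matrix_mult pairing_commute[of X] algebra_simps)
  have "pairing (f \<mu>) (cmat \<Phi> *v Z) = \<kappa> \<mu> * pairing (\<beta> \<mu>) Z"
    by (simp add: \<Phi> dual if_distrib[where f="\<lambda>z. z * _"] if_distrib[where f="\<lambda>z. _ * z"] cong: if_cong)
  moreover have "pairing (f \<mu>) (cmat G *v Z) = c / 2 * pairing (\<beta> \<mu>) Z"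
    by (simp add: metric_commute[of "f \<mu>"] metric_f pairing_commute[of Z])
  ultimately have "\<kappa> \<mu> * pairing (\<beta> \<mu>) Z = l * (c / 2 * pairing (\<beta> \<mu>) Z)"
    by (metis assms pairing_simps(8))
  then have "pairing (\<beta> \<mu>) Z \<noteq> 0 \<Longrightarrow> l * c = 2 * \<kappa> \<mu>"
    by (rule cancel)
  then show "pairing (\<beta> \<mu>) Z \<noteq> 0 \<Longrightarrow> l = eigval \<mu>"
    using c_nonzero by (simp add: eigval_def eq_divide_eq)
  have "pairing (e \<mu>) (cmat \<Phi> *v Z) = - \<kappa> \<mu> * pairing (\<alpha> \<mu>) Z"
    by (simp add: \<Phi> dual sum_negf if_distrib[where f="\<lambda>z. z * _"] if_distrib[where f="\<lambda>z. _ * z"] cong: if_cong)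
  moreover have "pairing (e \<mu>) (cmat G *v Z) = c / 2 * pairing (\<alpha> \<mu>) Z"
    by (simp add: metric_commute[of "e \<mu>"] metric_e pairing_commute[of Z])
  ultimately have "- \<kappa> \<mu> * pairing (\<alpha> \<mu>) Z = l * (c / 2 * pairing (\<alpha> \<mu>) Z)"
    by (metis assms pairing_simps(8))
  then have "pairing (\<alpha> \<mu>) Z \<noteq> 0 \<Longrightarrow> l * c = 2 * - \<kappa> \<mu>"
    by (rule cancel)
  then show "pairing (\<alpha> \<mu>) Z \<noteq> 0 \<Longrightarrow> l = - eigval \<mu>"
    using c_nonzero nonzero_eq_divide_eq[OF c_nonzero, of l "2 * - \<kappa> \<mu>"] by (simp add: eigval_def)
qed

lemma eigenvalues_subset:
  "eigenvalues_of (cmat (raise_index G \<Phi>)) \<subseteq> range eigval \<union> range (\<lambda>\<mu>. - eigval \<mu>)"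
proof
  fix l assume "l \<in> eigenvalues_of (cmat (raise_index G \<Phi>))"
  then obtain v where v: "v \<noteq> 0" "cmat (raise_index G \<Phi>) *v v = l *s v"
    by (auto simp: eigenvalues_of_def)
  have "G ** raise_index G \<Phi> = \<Phi>"
    by (simp add: raise_index_def matrix_mul_assoc matrix_mul_matrix_inv[OF inv])
  then have "cmat \<Phi> *v v = cmat G *v (cmat (raise_index G \<Phi>) *v v)"
    by (metis cmat_linear_ops(3))
  then have E: "cmat \<Phi> *v v = l *s (cmat G *v v)"
    by (simp add: v(2) vector_scalar_commute)
  obtain \<mu> where "pairing (\<alpha> \<mu>) v \<noteq> 0 \<or> pairing (\<beta> \<mu>) v \<noteq> 0"
    using eq_0I v(1) by blast
  then show "l \<in> range eigval \<union> range (\<lambda>\<mu>. - eigval \<mu>)"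
    using eigenvalue_cases[OF E] by auto
qed

text \<open>An endomorphism with \<open>2m\<close> eigenvalues leaves no room for coincidences among the \<open>2m\<close> numbers
  \<open>\<plusminus>\<kappa>\<^sub>\<mu>\<close>.\<close>

lemma eigenvalues_distinct:
  assumes "card (eigenvalues_of (cmat (raise_index G \<Phi>))) = 2 * CARD('m)"
  shows "\<kappa> \<mu> + \<kappa> \<nu> \<noteq> 0" "inj \<kappa>"
proof -
  let ?a = "range eigval" and ?b = "range (\<lambda>\<mu>. - eigval \<mu>)"
  have "2 * CARD('m) \<le> card (?a \<union> ?b)"
    using card_mono[OF _ eigenvalues_subset] assms by simp
  moreover have "card (?a \<union> ?b) + card (?a \<inter> ?b) = card ?a + card ?b"
    by (rule card_Un_Int[symmetric]) simp_all
  moreover have "card ?a \<le> CARD('m)" "card ?b \<le> CARD('m)"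
    by (simp_all add: card_image_le)
  ultimately have "card ?a = CARD('m)" "card (?a \<inter> ?b) = 0"
    by linarith+
  then have "inj eigval" and disjoint: "?a \<inter> ?b = {}"
    by (simp_all add: eq_card_imp_inj_on)
  then show "inj \<kappa>"
    by (simp add: inj_def eigval_def)
  show "\<kappa> \<mu> + \<kappa> \<nu> \<noteq> 0"
  proof
    assume "\<kappa> \<mu> + \<kappa> \<nu> = 0"
    then have "eigval \<mu> = - eigval \<nu>"
      using eigval_add[of \<mu> \<nu>] unfolding eq_neg_iff_add_eq_0 by simp
    with disjoint show False by auto
  qed
qed

end

locale skew_null_frame = form_null_frame G c \<alpha> \<beta> e f \<Phi> \<kappa>
  for G :: "real^'n^'n" and c :: complex and \<alpha> \<beta> e f :: "'m::finite \<Rightarrow> complex^'n"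
    and \<Phi> :: "real^'n^'n" and \<kappa> :: "'m \<Rightarrow> complex" +
  assumes sum_nonzero: "\<And>\<mu> \<nu>. \<kappa> \<mu> + \<kappa> \<nu> \<noteq> 0"
    and inj_eigenvalue: "inj \<kappa>"
begin

lemma flip_skew: "skew_null_frame G c \<beta> \<alpha> f e \<Phi> (\<lambda>\<mu>. - \<kappa> \<mu>)"
proof -
  interpret flip: null_frame G c \<beta> \<alpha> f e by (rule flip)
  have "map_matrix ((*) (- \<kappa> \<mu>)) (wedge11 (\<beta> \<mu>) (\<alpha> \<mu>)) = map_matrix ((*) (\<kappa> \<mu>)) (wedge11 (\<alpha> \<mu>) (\<beta> \<mu>))"
    for \<mu>
    by (simp add: wedge11_def map_matrix_def vec_eq_iff algebra_simps)
  moreover have "- \<kappa> \<mu> + - \<kappa> \<nu> \<noteq> 0" for \<mu> \<nu>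
    using sum_nonzero[of \<mu> \<nu>] by (metis add.inverse_distrib_swap add.commute neg_equal_0_iff_equal)
  ultimately show ?thesis
    using inj_eigenvalue by unfold_locales (auto simp: form inj_def)
qed

lemma eigval_neq: "eigval \<mu> \<noteq> - eigval \<nu>" "eigval \<mu> = eigval \<nu> \<longleftrightarrow> \<mu> = \<nu>"
proof -
  show "eigval \<mu> \<noteq> - eigval \<nu>"
    using eigval_add[of \<mu> \<nu>] sum_nonzero[of \<mu> \<nu>] c_nonzero
    by (simp add: eq_neg_iff_add_eq_0 del: distrib_left_numeral)
  show "eigval \<mu> = eigval \<nu> \<longleftrightarrow> \<mu> = \<nu>"
    using inj_eigenvalue c_nonzero by (auto simp: eigval_def inj_def)
qed

text \<open>Because \<open>G\<close> and \<open>\<Phi>\<close> are real, the conjugate of an eigenvector is an eigenvector for the conjugate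
  eigenvalue, so its components are restricted by \<open>eigenvalue_cases\<close>.\<close>

lemma cnj_e_cases:
  "pairing (\<alpha> \<nu>) (cnj_vec (e \<mu>)) \<noteq> 0 \<Longrightarrow> cnj (eigval \<mu>) = - eigval \<nu>"
  "pairing (\<beta> \<nu>) (cnj_vec (e \<mu>)) \<noteq> 0 \<Longrightarrow> cnj (eigval \<mu>) = eigval \<nu>"
proof -
  have E: "cmat \<Phi> *v cnj_vec (e \<mu>) = cnj (eigval \<mu>) *s (cmat G *v cnj_vec (e \<mu>))"
    by (simp add: form_eigen_e flip: cnj_vec_cmat)
  show "pairing (\<alpha> \<nu>) (cnj_vec (e \<mu>)) \<noteq> 0 \<Longrightarrow> cnj (eigval \<mu>) = - eigval \<nu>"
    "pairing (\<beta> \<nu>) (cnj_vec (e \<mu>)) \<noteq> 0 \<Longrightarrow> cnj (eigval \<mu>) = eigval \<nu>"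
    using eigenvalue_cases[OF E] by blast+
qed

lemma hermitian_e: "pairing (cnj_vec (e \<mu>)) (cmat G *v e \<nu>) = c / 2 * pairing (\<alpha> \<nu>) (cnj_vec (e \<mu>))"
  by (simp add: metric_e pairing_commute)

text \<open>Conjugating an imaginary eigenvalue changes its sign, so conjugation interchanges the lines of
  \<open>e\<^sub>\<mu>\<close> and \<open>f\<^sub>\<mu>\<close>.\<close>

lemma cnj_e_imaginary:
  assumes "Re (eigval \<mu>) = 0"
  shows "cnj_vec (e \<mu>) = pairing (\<alpha> \<mu>) (cnj_vec (e \<mu>)) *s f \<mu>"
    and "pairing (\<alpha> \<mu>) (cnj_vec (e \<mu>)) \<noteq> 0"
proof -
  have cnj: "cnj (eigval \<mu>) = - eigval \<mu>"
    using assms by (simp add: complex_eq_iff)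
  then have \<beta>: "pairing (\<beta> \<nu>) (cnj_vec (e \<mu>)) = 0" for \<nu>
    using cnj_e_cases(2)[of \<nu> \<mu>] eigval_neq(1)[of \<nu> \<mu>] by auto
  have \<alpha>: "pairing (\<alpha> \<nu>) (cnj_vec (e \<mu>)) = 0" if "\<nu> \<noteq> \<mu>" for \<nu>
    using cnj_e_cases(1)[of \<nu> \<mu>] eigval_neq(2)[of \<mu> \<nu>] cnj that by auto
  have "(\<Sum>\<nu>\<in>UNIV. pairing (\<alpha> \<nu>) (cnj_vec (e \<mu>)) *s f \<nu>)
      = (\<Sum>\<nu>\<in>UNIV. if \<nu> = \<mu> then pairing (\<alpha> \<mu>) (cnj_vec (e \<mu>)) *s f \<mu> else 0)"
    by (intro sum.cong) (auto simp: \<alpha>)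
  then show eq: "cnj_vec (e \<mu>) = pairing (\<alpha> \<mu>) (cnj_vec (e \<mu>)) *s f \<mu>"
    using frame_expansion[of "cnj_vec (e \<mu>)"] \<beta> by simp
  show "pairing (\<alpha> \<mu>) (cnj_vec (e \<mu>)) \<noteq> 0"
  proof
    assume "pairing (\<alpha> \<mu>) (cnj_vec (e \<mu>)) = 0"
    with eq have "cnj_vec (e \<mu>) = 0" by simp
    then show False using e_nonzero by simp
  qed
qed

text \<open>The dual statement, obtained from \<open>cnj_e_imaginary\<close> by lowering the index with the real metric:
  conjugation interchanges \<open>\<alpha>\<^sub>\<mu>\<close> and \<open>\<beta>\<^sub>\<mu>\<close> up to a nonzero factor.\<close>

lemma coform_cnj_imaginary:
  assumes "Re (eigval \<mu>) = 0"
  obtains k where "k \<noteq> 0" "\<And>Y. pairing (\<alpha> \<mu>) (cnj_vec Y) = k * cnj (pairing (\<beta> \<mu>) Y)"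
proof
  let ?p = "pairing (\<alpha> \<mu>) (cnj_vec (e \<mu>))"
  show "2 / c * cnj (?p * c / 2) \<noteq> 0"
    using c_nonzero cnj_e_imaginary(2)[OF assms] by simp
  fix Y
  have "c / 2 * pairing (\<alpha> \<mu>) (cnj_vec Y) = pairing (cmat G *v e \<mu>) (cnj_vec Y)"
    by (simp add: metric_e)
  also have "\<dots> = cnj (pairing (cmat G *v cnj_vec (e \<mu>)) Y)"
    using pairing_cnj[of "cmat G *v cnj_vec (e \<mu>)" Y] by (simp add: cnj_vec_cmat)
  also have "cmat G *v cnj_vec (e \<mu>) = (?p * c / 2) *s \<beta> \<mu>"
    by (subst cnj_e_imaginary(1)[OF assms])
      (simp add: vector_scalar_commute metric_f vector_smult_assoc)
  finally show "pairing (\<alpha> \<mu>) (cnj_vec Y) = 2 / c * cnj (?p * c / 2) * cnj (pairing (\<beta> \<mu>) Y)"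
    using c_nonzero by (simp add: field_simps)
qed

lemma cnj_e_real:
  assumes "Im (eigval \<mu>) = 0"
  shows "cnj_vec (e \<mu>) = pairing (\<beta> \<mu>) (cnj_vec (e \<mu>)) *s e \<mu>"
proof -
  have cnj: "cnj (eigval \<mu>) = eigval \<mu>"
    using assms by (simp add: complex_eq_iff)
  then have \<alpha>: "pairing (\<alpha> \<nu>) (cnj_vec (e \<mu>)) = 0" for \<nu>
    using cnj_e_cases(1)[of \<nu> \<mu>] eigval_neq(1)[of \<mu> \<nu>] by auto
  have \<beta>: "pairing (\<beta> \<nu>) (cnj_vec (e \<mu>)) = 0" if "\<nu> \<noteq> \<mu>" for \<nu>
    using cnj_e_cases(2)[of \<nu> \<mu>] eigval_neq(2)[of \<mu> \<nu>] cnj that by auto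
  have "(\<Sum>\<nu>\<in>UNIV. pairing (\<beta> \<nu>) (cnj_vec (e \<mu>)) *s e \<nu>)
      = (\<Sum>\<nu>\<in>UNIV. if \<nu> = \<mu> then pairing (\<beta> \<mu>) (cnj_vec (e \<mu>)) *s e \<mu> else 0)"
    by (intro sum.cong) (auto simp: \<beta>)
  then show ?thesis
    using frame_expansion[of "cnj_vec (e \<mu>)"] \<alpha> by simp
qed

subsection \<open>Euclidean signature\<close>

text \<open>The endomorphism \<open>G\<^sup>-\<^sup>1 \<Phi>\<close> is skew with respect to the Hermitian form \<open>G(cnj Z, W)\<close>, which is positive
  definite here.\<close>

lemma eigval_imaginary_euclidean:
  assumes "euclidean_form G"
  shows "Re (eigval \<mu>) = 0"
proof -
  obtain u v where uv: "e \<mu> = cvec u + \<i> *s cvec v" "cnj_vec (e \<mu>) = cvec u - \<i> *s cvec v"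
    by (rule re_im_decomposition)
  have sym: "v \<bullet> (G *v u) = u \<bullet> (G *v v)"
    using metric_commute[of "cvec u" "cvec v"] by (simp add: cmat_simps pairing_cvec)
  have h: "pairing (cnj_vec (e \<mu>)) (cmat G *v e \<mu>) = of_real (u \<bullet> (G *v u) + v \<bullet> (G *v v))"
    unfolding uv by (simp add: matrix_vector_right_distrib vector_scalar_commute cmat_simps sym
        pairing_cvec algebra_simps)
  have "u \<noteq> 0 \<or> v \<noteq> 0"
    using e_nonzero[of \<mu>] uv(1) by auto
  moreover have "x \<bullet> (G *v x) \<ge> 0" "x \<noteq> 0 \<Longrightarrow> x \<bullet> (G *v x) > 0" for x
    using assms by (auto simp: euclidean_form_def less_imp_le intro: order.strict_implies_order)
      (metis inner_zero_left less_eq_real_def)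
  ultimately have "u \<bullet> (G *v u) + v \<bullet> (G *v v) > 0"
    by (metis add_nonneg_pos add_pos_nonneg)
  then have "pairing (cnj_vec (e \<mu>)) (cmat G *v e \<mu>) \<noteq> 0"
    unfolding h by (simp add: of_real_eq_0_iff del: of_real_add)
  then have "cnj (eigval \<mu>) = - eigval \<mu>"
    using cnj_e_cases(1)[of \<mu> \<mu>] by (auto simp: hermitian_e)
  then show ?thesis by (simp add: complex_eq_iff)
qed

end

subsection \<open>Lorentzian signature\<close>

text \<open>Every complex plane contains a nonzero vector without component along the single timelike
  basis vector, and on such vectors the Hermitian form has the spacelike sign.  Hence a plane on
  which the form is null or has the timelike sign is degenerate.\<close>

lemma lorentzian_form_planes:
  assumes "lorentzian_form (G :: real^'n^'n)"
  obtains s t where "s = 1 \<or> s = -1" "s * (t \<bullet> (G *v t)) < 0"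
    "\<And>u v. (\<And>p q. s * Re (pairing (cnj_vec (p *s u + q *s v)) (cmat G *v (p *s u + q *s v))) \<le> 0)
       \<Longrightarrow> \<exists>p q. (p \<noteq> 0 \<or> q \<noteq> 0) \<and> p *s u + q *s v = 0"
proof -
  obtain s :: real and b :: "'n \<Rightarrow> real^'n" and i0 where s: "s = 1 \<or> s = -1"
    and b: "\<And>i j. b i \<bullet> (G *v b j) = (if i \<noteq> j then 0 else if i = i0 then - s else s)"
    using assms unfolding lorentzian_form_def by blast
  define B where "B = (\<chi> i j. b j $ i)"
  define d where "d i = (if i = i0 then - s else s)" for i
  have d: "d i * d i = 1" for i
    using s by (auto simp: d_def)
  define \<Delta> where "\<Delta> = (\<chi> i j. if i = j then d i else 0)"
  have gram: "transpose B ** (G ** B) = \<Delta>"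
  proof -
    have col: "B *v axis j 1 = b j" for j
      by (simp add: B_def matrix_vector_mult_basis column_def vec_eq_iff)
    have "(transpose B ** (G ** B)) $ i $ j = \<Delta> $ i $ j" for i j
    proof -
      have "(transpose B ** (G ** B)) $ i $ j = axis i 1 \<bullet> ((transpose B ** (G ** B)) *v axis j 1)"
        by (simp add: inner_axis' matrix_vector_mult_basis column_def)
      also have "\<dots> = b i \<bullet> (G *v b j)"
        by (simp add: col flip: matrix_vector_mul_assoc)
           (metis col dot_lmul_matrix transpose_matrix_vector transpose_transpose)
      finally show ?thesis by (simp add: b \<Delta>_def d_def)
    qed
    then show ?thesis by (simp add: vec_eq_iff)
  qed
  \<comment> \<open>Since \<open>\<Delta>\<close> is its own inverse, \<open>C\<close> computes the coordinates in the basis \<open>b\<close>.\<close>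
  define C where "C = \<Delta> ** transpose B ** G"
  have "\<Delta> ** \<Delta> = mat 1"
    by (simp add: \<Delta>_def matrix_matrix_mult_def mat_def vec_eq_iff d if_distrib[where f="\<lambda>z. z * _"]
        cong: if_cong)
  then have "C ** B = mat 1"
    using gram by (simp add: C_def matrix_mul_assoc[symmetric])
  then have BC: "B ** C = mat 1"
    by (simp add: matrix_left_right_inverse)
  have herm: "s * Re (pairing (cnj_vec w) (cmat G *v w))
      = (\<Sum>i\<in>UNIV. (if i = i0 then - 1 else 1) * (cmod ((cmat C *v w) $ i))\<^sup>2)" for w
  proof -
    let ?w = "cmat C *v w"
    have w: "w = cmat B *v ?w"
      using BC by (metis cmat_simps(4,6) matrix_vector_mul_assoc matrix_vector_mul_lid)
    have "pairing (cnj_vec w) (cmat G *v w) = pairing (cmat B *v cnj_vec ?w) (cmat G *v (cmat B *v ?w))"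
      using w by (metis cnj_vec_cmat)
    also have "\<dots> = pairing (cnj_vec ?w) (cmat (transpose B ** (G ** B)) *v ?w)"
      by (simp add: cmat_simps pairing_matrix_left[of _ "transpose (cmat B)"] transpose_transpose
          del: transpose_matrix_vector flip: matrix_vector_mul_assoc)
    also have "\<dots> = (\<Sum>i\<in>UNIV. of_real (d i) * (?w $ i * cnj (?w $ i)))"
      unfolding gram pairing_def cnj_vec_def matrix_vector_mult_def
      by (simp add: \<Delta>_def if_distrib[where f="\<lambda>z. z * _"] if_distrib[where f="of_real"] mult_ac cong: if_cong)
    also have "\<dots> = of_real (\<Sum>i\<in>UNIV. d i * (cmod (?w $ i))\<^sup>2)"
      by (simp add: complex_norm_square[symmetric])
    finally show ?thesis
      using s by (auto simp: d_def sum_distrib_left intro!: sum.cong)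
  qed
  show thesis
  proof
    show "s = 1 \<or> s = -1" by fact
    show "s * (b i0 \<bullet> (G *v b i0)) < 0"
      using s by (auto simp: b)
    fix u v
    assume neg: "\<And>p q. s * Re (pairing (cnj_vec (p *s u + q *s v)) (cmat G *v (p *s u + q *s v))) \<le> 0"
    obtain p q where pq: "p \<noteq> 0 \<or> q \<noteq> 0" "p * (cmat C *v u) $ i0 + q * (cmat C *v v) $ i0 = 0"
    proof (cases "(cmat C *v u) $ i0 = 0")
      case True
      then show thesis by (intro that[of 1 0]) auto
    next
      case False
      then show thesis by (intro that[of "(cmat C *v v) $ i0" "- (cmat C *v u) $ i0"]) (auto simp: mult.commute)
    qed
    define w where "w = p *s u + q *s v"
    have "(cmat C *v w) $ i0 = 0"
      using pq(2) by (simp add: w_def matrix_vector_right_distrib vector_scalar_commute)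
    then have "s * Re (pairing (cnj_vec w) (cmat G *v w)) = (\<Sum>i\<in>UNIV. (cmod ((cmat C *v w) $ i))\<^sup>2)"
      unfolding herm by (intro sum.cong) auto
    with neg[of p q] have "(\<Sum>i\<in>UNIV. (cmod ((cmat C *v w) $ i))\<^sup>2) \<le> 0"
      by (simp add: w_def)
    then have "(\<Sum>i\<in>UNIV. (cmod ((cmat C *v w) $ i))\<^sup>2) = 0"
      by (intro order.antisym sum_nonneg) auto
    then have "cmat C *v w = 0"
      by (simp add: sum_nonneg_eq_0_iff vec_eq_iff)
    then have "w = 0"
      using BC by (metis cmat_simps(4,6) matrix_vector_mul_assoc matrix_vector_mul_lid matrix_vector_mult_0_right)
    with pq(1) show "\<exists>p q. (p \<noteq> 0 \<or> q \<noteq> 0) \<and> p *s u + q *s v = 0"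
      by (auto simp: w_def)
  qed
qed

context skew_null_frame
begin

text \<open>Write \<open>h\<close> for the Hermitian form \<open>G(cnj Z, W)\<close>.  Skewness gives \<open>h(e\<^sub>\<mu>, e\<^sub>\<nu>) = 0\<close> unless
  \<open>cnj \<lambda>\<^sub>\<mu> = - \<lambda>\<^sub>\<nu>\<close>.  For a nonreal eigenvalue \<open>e\<^sub>\<mu>\<close> and \<open>cnj e\<^sub>\<mu>\<close> are independent and \<open>h\<close>-orthogonal of
  equal length, so this length has the spacelike sign by \<open>lorentzian_form_planes\<close>; in particular it is
  not zero, and \<open>\<lambda>\<^sub>\<mu>\<close> is imaginary.  If all eigenvalues were imaginary, \<open>h\<close> would be diagonal in the
  frame with all entries of the spacelike sign, and no timelike vector could exist.  Eigenvectors
  from two real pairs would span an \<open>h\<close>-null plane.\<close>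

lemma eigval_lorentzian:
  assumes "lorentzian_form G"
  shows "Re (eigval \<mu>) \<noteq> 0 \<Longrightarrow> Im (eigval \<mu>) = 0"
    and "\<exists>\<mu>. Re (eigval \<mu>) \<noteq> 0"
    and "Re (eigval \<mu>) \<noteq> 0 \<Longrightarrow> Re (eigval \<nu>) \<noteq> 0 \<Longrightarrow> \<mu> = \<nu>"
proof -
  obtain s t where s: "s = 1 \<or> s = -1" and t: "s * (t \<bullet> (G *v t)) < 0"
    and plane: "\<And>u v. (\<And>p q. s * Re (pairing (cnj_vec (p *s u + q *s v)) (cmat G *v (p *s u + q *s v))) \<le> 0)
       \<Longrightarrow> \<exists>p q. (p \<noteq> 0 \<or> q \<noteq> 0) \<and> p *s u + q *s v = 0"
    using lorentzian_form_planes[OF assms] by metis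
  define h where "h \<mu> \<nu> = pairing (cnj_vec (e \<mu>)) (cmat G *v e \<nu>)" for \<mu> \<nu>
  have h0: "h \<mu> \<nu> = 0" if "cnj (eigval \<mu>) \<noteq> - eigval \<nu>" for \<mu> \<nu>
    using that cnj_e_cases(1)[of \<nu> \<mu>] by (auto simp: h_def hermitian_e)
  have nonreal: "s * Re (h \<mu> \<mu>) > 0" if "Im (eigval \<mu>) \<noteq> 0" for \<mu>
  proof (rule ccontr)
    assume "\<not> s * Re (h \<mu> \<mu>) > 0"
    then have le: "s * Re (h \<mu> \<mu>) \<le> 0" by simp
    have 0: "pairing (e \<mu>) (cmat G *v e \<mu>) = 0"
      by (simp add: metric_e dual pairing_commute)
    then have 1: "pairing (cnj_vec (e \<mu>)) (cmat G *v cnj_vec (e \<mu>)) = 0"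
      using pairing_cnj[of "e \<mu>" "cmat G *v e \<mu>"] by (simp add: cnj_vec_cmat)
    have "s * Re (pairing (cnj_vec (p *s e \<mu> + q *s cnj_vec (e \<mu>)))
            (cmat G *v (p *s e \<mu> + q *s cnj_vec (e \<mu>)))) = ((cmod p)\<^sup>2 + (cmod q)\<^sup>2) * (s * Re (h \<mu> \<mu>))" for p q
    proof -
      have "pairing (cnj_vec (p *s e \<mu> + q *s cnj_vec (e \<mu>)))
            (cmat G *v (p *s e \<mu> + q *s cnj_vec (e \<mu>))) = (p * cnj p + q * cnj q) * h \<mu> \<mu>"
        using metric_commute[of "cnj_vec (e \<mu>)" "e \<mu>"]
        by (simp add: matrix_vector_right_distrib vector_scalar_commute 0 1 h_def algebra_simps)
      also have "p * cnj p + q * cnj q = of_real ((cmod p)\<^sup>2 + (cmod q)\<^sup>2)"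
        by (simp add: complex_norm_square[symmetric])
      finally show ?thesis by simp
    qed
    moreover have "((cmod p)\<^sup>2 + (cmod q)\<^sup>2) * (s * Re (h \<mu> \<mu>)) \<le> 0" for p q
      by (rule mult_nonneg_nonpos[OF _ le]) simp
    ultimately have "\<exists>p q. (p \<noteq> 0 \<or> q \<noteq> 0) \<and> p *s e \<mu> + q *s cnj_vec (e \<mu>) = 0"
      by (intro plane) (simp only:)
    then obtain p q where pq: "p \<noteq> 0 \<or> q \<noteq> 0" "p *s e \<mu> + q *s cnj_vec (e \<mu>) = 0"
      by blast
    have "pairing (\<beta> \<mu>) (cnj_vec (e \<mu>)) = 0"
      using cnj_e_cases(2)[of \<mu> \<mu>] that by (auto simp: complex_eq_iff)
    with arg_cong[OF pq(2), of "pairing (\<beta> \<mu>)"] have "p = 0"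
      by (simp add: dual)
    with pq e_nonzero[of \<mu>] show False by auto
  qed
  show "Im (eigval \<mu>) = 0" if "Re (eigval \<mu>) \<noteq> 0"
  proof (rule ccontr)
    assume "Im (eigval \<mu>) \<noteq> 0"
    moreover have "h \<mu> \<mu> = 0"
      using that by (intro h0) (auto simp: complex_eq_iff)
    ultimately show False using nonreal[of \<mu>] by simp
  qed
  show "\<exists>\<mu>. Re (eigval \<mu>) \<noteq> 0"
  proof (rule ccontr)
    assume "\<nexists>\<mu>. Re (eigval \<mu>) \<noteq> 0"
    then have Re0: "Re (eigval \<mu>) = 0" for \<mu> by auto
    have "eigval \<mu> \<noteq> 0" for \<mu>
      using eigval_neq(1)[of \<mu> \<mu>] by auto
    then have pos: "s * Re (h \<mu> \<mu>) > 0" for \<mu>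
      using Re0 by (intro nonreal) (auto simp: complex_eq_iff)
    have "c * (pairing (\<alpha> \<mu>) (cvec t) * pairing (\<beta> \<mu>) (cvec t))
        = 2 * h \<mu> \<mu> * of_real ((cmod (pairing (\<beta> \<mu>) (cvec t)))\<^sup>2)" for \<mu>
    proof -
      obtain k where k: "\<And>Y. pairing (\<alpha> \<mu>) (cnj_vec Y) = k * cnj (pairing (\<beta> \<mu>) Y)"
        using coform_cnj_imaginary[OF Re0] by metis
      have "h \<mu> \<mu> = c / 2 * k"
        by (simp add: h_def hermitian_e k dual)
      moreover have "pairing (\<alpha> \<mu>) (cvec t) = k * cnj (pairing (\<beta> \<mu>) (cvec t))"
        using k[of "cvec t"] by simp
      ultimately show ?thesis
        using complex_norm_square[of "pairing (\<beta> \<mu>) (cvec t)"] by (simp add: mult_ac)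
    qed
    then have "pairing (cvec t) (cmat G *v cvec t)
        = (\<Sum>\<mu>\<in>UNIV. 2 * h \<mu> \<mu> * of_real ((cmod (pairing (\<beta> \<mu>) (cvec t)))\<^sup>2))"
      unfolding metric_pairing by (simp add: sum_distrib_left flip: mult.commute)
    then have "of_real (t \<bullet> (G *v t))
        = (\<Sum>\<mu>\<in>UNIV. 2 * h \<mu> \<mu> * of_real ((cmod (pairing (\<beta> \<mu>) (cvec t)))\<^sup>2))"
      by (simp add: cmat_simps pairing_cvec)
    then have "t \<bullet> (G *v t) = (\<Sum>\<mu>\<in>UNIV. 2 * Re (h \<mu> \<mu>) * (cmod (pairing (\<beta> \<mu>) (cvec t)))\<^sup>2)"
      by (auto simp: complex_eq_iff)
    then have "s * (t \<bullet> (G *v t)) = (\<Sum>\<mu>\<in>UNIV. 2 * (s * Re (h \<mu> \<mu>)) * (cmod (pairing (\<beta> \<mu>) (cvec t)))\<^sup>2)"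
      by (simp add: sum_distrib_left mult_ac)
    also have "\<dots> \<ge> 0"
      by (intro sum_nonneg mult_nonneg_nonneg[OF mult_nonneg_nonneg] less_imp_le[OF pos]) simp_all
    finally show False using t by simp
  qed
  show "\<mu> = \<nu>" if "Re (eigval \<mu>) \<noteq> 0" "Re (eigval \<nu>) \<noteq> 0" for \<mu> \<nu>
  proof (rule ccontr)
    assume "\<mu> \<noteq> \<nu>"
    have real: "cnj (eigval \<rho>) = eigval \<rho>" if "Re (eigval \<rho>) \<noteq> 0" for \<rho>
      using nonreal[of \<rho>] h0[of \<rho> \<rho>] that by (cases "Im (eigval \<rho>) = 0") (auto simp: complex_eq_iff)
    have "h \<mu> \<mu> = 0" "h \<mu> \<nu> = 0" "h \<nu> \<mu> = 0" "h \<nu> \<nu> = 0"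
      using that by (auto intro!: h0 simp: real eigval_neq(1))
    then have "s * Re (pairing (cnj_vec (p *s e \<mu> + q *s e \<nu>)) (cmat G *v (p *s e \<mu> + q *s e \<nu>))) \<le> 0"
      for p q
      by (simp add: matrix_vector_right_distrib vector_scalar_commute h_def)
    then obtain p q where pq: "p \<noteq> 0 \<or> q \<noteq> 0" "p *s e \<mu> + q *s e \<nu> = 0"
      using plane[of "e \<mu>" "e \<nu>"] by blast
    have "pairing (\<beta> \<rho>) (p *s e \<mu> + q *s e \<nu>) = 0" for \<rho>
      using pq(2) by simp
    from this[of \<mu>] this[of \<nu>] \<open>\<mu> \<noteq> \<nu>\<close> pq(1) show False
      by (auto simp: dual)
  qed
qed

end

section \<open>Integrability of the eigendistributions\<close>

lemma cmat_wedge_scaleR: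
  fixes u v :: "real^'n" and Y Z :: "complex^'n"
  shows "cmat (wedge11 u v) = wedge11 (cvec u) (cvec v)"
    and "cmat (r *\<^sub>R A) *v Z = of_real r *s (cmat A *v Z)"
  by (simp_all add: vec_eq_iff wedge11_def matrix_vector_mult_def sum_distrib_left mult_ac)

lemma skew_matrix_pairing:
  assumes "transpose A = - A"
  shows "pairing X (cmat A *v Y) = - pairing Y (cmat A *v X)"
proof -
  have "pairing X (cmat A *v Y) = pairing (cmat (transpose A) *v X) Y"
    unfolding cmat_simps(5) by (rule pairing_matrix_left)
  also have "\<dots> = - pairing Y (cmat A *v X)"
    by (simp add: assms cmat_simps(3) pairing_commute matrix_vector_mult_def pairing_def sum_negf)
  finally show ?thesis .
qed

text \<open>One choice of a covector from each pair, with \<open>\<kappa>\<^sub>\<mu>\<close> equal to the given eigenvalue coefficient or to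
  its negative according to the choice.  The assumptions on \<open>\<kappa>\<close> express the distinctness of the
  eigenvalues; all assumptions are invariant under exchanging the members of any pairs.\<close>

locale cky_frame =
  fixes U :: "(real^'n) set" and g \<phi> :: "real^'n \<Rightarrow> real^'n^'n" and c :: complex
    and \<kappa> :: "'m::finite \<Rightarrow> real^'n \<Rightarrow> complex"
    and \<alpha> \<beta> e f :: "'m \<Rightarrow> real^'n \<Rightarrow> complex^'n"
  assumes open_U: "open U"
    and pseudo_metric: "pseudo_metric_on U g"
    and cky: "conformal_killing_yano U g \<phi>"
    and coframe: "null_coframe U g c \<alpha> \<beta>"
    and frame: "dual_frame U \<alpha> \<beta> f e"
    and normal_form: "\<And>x. x \<in> U \<Longrightarrow>
      cmat (\<phi> x) = (\<Sum>\<mu>\<in>UNIV. map_matrix ((*) (\<kappa> \<mu> x)) (wedge11 (\<alpha> \<mu> x) (\<beta> \<mu> x)))"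
    and \<kappa>_sum: "\<And>x \<mu> \<nu>. x \<in> U \<Longrightarrow> \<kappa> \<mu> x + \<kappa> \<nu> x \<noteq> 0"
    and \<kappa>_inj: "\<And>x. x \<in> U \<Longrightarrow> inj (\<lambda>\<mu>. \<kappa> \<mu> x)"
    and tau_\<alpha>: "\<And>x \<mu>. x \<in> U \<Longrightarrow>
      wedge12 (\<alpha> \<mu> x) (insert_first (e \<mu> x) (cten (ext_deriv2 \<phi> x))) = 0"
    and tau_\<beta>: "\<And>x \<mu>. x \<in> U \<Longrightarrow>
      wedge12 (\<beta> \<mu> x) (insert_first (f \<mu> x) (cten (ext_deriv2 \<phi> x))) = 0"
begin

definition eigendist :: "real^'n \<Rightarrow> (complex^'n) set" where
  "eigendist = (\<lambda>x\<in>U. {Z. \<forall>\<mu>. pairing (\<alpha> \<mu> x) Z = 0})"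

lemma skew_null_frame_at:
  assumes "x \<in> U"
  shows "skew_null_frame (g x) c (\<lambda>\<mu>. \<alpha> \<mu> x) (\<lambda>\<mu>. \<beta> \<mu> x) (\<lambda>\<mu>. e \<mu> x) (\<lambda>\<mu>. f \<mu> x) (\<phi> x) (\<lambda>\<mu>. \<kappa> \<mu> x)"
  using assms coframe frame pseudo_metric normal_form \<kappa>_sum \<kappa>_inj
  by unfold_locales (auto simp: null_coframe_def dual_frame_def pseudo_metric_on_def)

lemma null_frame_at:
  assumes "x \<in> U"
  shows "null_frame (g x) c (\<lambda>\<mu>. \<alpha> \<mu> x) (\<lambda>\<mu>. \<beta> \<mu> x) (\<lambda>\<mu>. e \<mu> x) (\<lambda>\<mu>. f \<mu> x)"
  using skew_null_frame_at[OF assms] by (simp add: skew_null_frame_def form_null_frame_def)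

lemma form_null_frame_at:
  assumes "x \<in> U"
  shows "form_null_frame (g x) c (\<lambda>\<mu>. \<alpha> \<mu> x) (\<lambda>\<mu>. \<beta> \<mu> x) (\<lambda>\<mu>. e \<mu> x) (\<lambda>\<mu>. f \<mu> x) (\<phi> x) (\<lambda>\<mu>. \<kappa> \<mu> x)"
  using skew_null_frame_at[OF assms] by (simp add: skew_null_frame_def)

lemma eigendist_at: "x \<in> U \<Longrightarrow> eigendist x = null_frame.D (\<lambda>\<mu>. \<alpha> \<mu> x)"
  by (simp add: eigendist_def null_frame.D_def[OF null_frame_at])

lemma smooth_frame: "smooth_on U (\<alpha> \<mu>)" "smooth_on U (\<beta> \<mu>)" "smooth_on U (e \<mu>)" "smooth_on U (f \<mu>)"
  using coframe frame by (auto simp: null_coframe_def dual_frame_def)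

lemma maximal_isotropic_eigendist:
  assumes "CARD('n) = 2 * CARD('m)"
  shows "maximal_isotropic U g eigendist"
  unfolding maximal_isotropic_def complex_subbundle_def
proof (intro conjI ballI)
  fix x assume x: "x \<in> U"
  obtain h where h: "bij_betw h {0..<CARD('m)} (UNIV :: 'm set)"
    using ex_bij_betw_nat_finite[of "UNIV :: 'm set"] by auto
  have "(\<lambda>i. e (h i) y) ` {..<CARD('n) div 2} = range (\<lambda>\<mu>. e \<mu> y)" for y
    using h assms by (simp add: bij_betw_def lessThan_atLeast0 image_image[symmetric, of "\<lambda>\<mu>. e \<mu> y" h])
  moreover have "vec.dim (eigendist y) = CARD('m)" if "y \<in> U" for y
    using that by (simp add: eigendist_at null_frame.dim_D[OF null_frame_at])
  moreover have "eigendist y = vec.span (range (\<lambda>\<mu>. e \<mu> y))" if "y \<in> U" for y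
    using that by (simp add: eigendist_at null_frame.D_eq_span[OF null_frame_at])
  ultimately show "\<exists>W E. open W \<and> x \<in> W \<and> W \<subseteq> U \<and> (\<forall>i<CARD('n) div 2. smooth_on W (E i)) \<and>
      (\<forall>y\<in>W. eigendist y = vec.span ((\<lambda>i::nat. E i y) ` {..<CARD('n) div 2}) \<and> vec.dim (eigendist y) = CARD('n) div 2)"
    using x open_U smooth_frame assms
    by (intro exI[of _ U] exI[of _ "\<lambda>i. e (h i)"]) simp
next
  fix x X Y assume "x \<in> U" "X \<in> eigendist x" "Y \<in> eigendist x"
  then show "pairing X (cmat (g x) *v Y) = 0"
    by (simp add: eigendist_at null_frame.D_isotropic[OF null_frame_at])
qed

text \<open>The covariant derivative \<open>(\<nabla>\<^sub>X \<alpha>\<^sub>\<nu>)(Y)\<close>.  It is tensorial in both arguments, unlike the frame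
  components of the connection.\<close>

definition nabla_coform :: "real^'n \<Rightarrow> 'm \<Rightarrow> complex^'n \<Rightarrow> complex^'n \<Rightarrow> complex" where
  "nabla_coform x \<nu> X Y = (\<Sum>k\<in>UNIV. X $ k * (pairing (pderiv_coord k (\<alpha> \<nu>) x) Y
     - pairing (\<alpha> \<nu> x) (cmat (christoffel_matrix g x k) *v Y)))"

context
  fixes x assumes x: "x \<in> U"
begin

interpretation skew_null_frame "g x" c "\<lambda>\<mu>. \<alpha> \<mu> x" "\<lambda>\<mu>. \<beta> \<mu> x" "\<lambda>\<mu>. e \<mu> x" "\<lambda>\<mu>. f \<mu> x" "\<phi> x" "\<lambda>\<mu>. \<kappa> \<mu> x"
  by (rule skew_null_frame_at[OF x])

lemma differentiable_at:
  "g differentiable (at x)" "\<phi> differentiable (at x)" "e \<mu> differentiable (at x)" "\<alpha> \<mu> differentiable (at x)"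
  using x pseudo_metric cky smooth_frame
  by (auto simp: pseudo_metric_on_def conformal_killing_yano_def two_form_on_def
      intro: smooth_on_imp_differentiable)

text \<open>This is the derivative of \<open>g(e\<^sub>\<mu>, e\<^sub>\<nu>) = 0\<close>, because the connection is metric and \<open>\<alpha>\<^sub>\<nu>\<close> is proportional
  to \<open>g(e\<^sub>\<nu>, -)\<close>.\<close>

lemma nabla_e_skew:
  "pairing (nabla_vector g k (e \<mu>) x) (\<alpha> \<nu> x) + pairing (nabla_vector g k (e \<nu>) x) (\<alpha> \<mu> x) = 0"
proof -
  have "pderiv_coord k (\<lambda>y. pairing (e \<mu> y) (cmat (g y) *v e \<nu> y)) x = 0"
  proof (rule pderiv_coord_const_on[OF open_U x])
    fix y assume "y \<in> U"
    then show "pairing (e \<mu> y) (cmat (g y) *v e \<nu> y) = 0"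
      by (simp add: null_frame.metric_e[OF null_frame_at] null_frame.dual[OF null_frame_at]
          pairing_commute[of "e \<mu> y"])
  qed
  then have "pairing (nabla_vector g k (e \<mu>) x) (cmat (g x) *v e \<nu> x)
      + pairing (e \<mu> x) (cmat (g x) *v nabla_vector g k (e \<nu>) x) = 0"
    using nabla_leibniz[OF differentiable_at(1,3,3), of k \<mu> \<nu> g] nabla_metric[OF open_U x pseudo_metric]
    by (simp add: cmat_def cvec_def matrix_vector_mult_def zero_vec_def pairing_def)
  then have "c / 2 * (pairing (nabla_vector g k (e \<mu>) x) (\<alpha> \<nu> x)
      + pairing (nabla_vector g k (e \<nu>) x) (\<alpha> \<mu> x)) = 0"
    by (simp add: metric_commute[of "e \<mu> x"] metric_e distrib_left)
  then show ?thesis using c_nonzero by simp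
qed

lemma form_skew: "transpose (\<phi> x) = - \<phi> x"
  using cky x by (auto simp: conformal_killing_yano_def two_form_on_def)

text \<open>The derivative of \<open>\<phi>(e\<^sub>\<mu>, e\<^sub>\<nu>) = 0\<close>.  Both remaining terms are multiples of the same
  connection coefficient, by the eigenvector property and the skewness just derived.\<close>

lemma nabla_form_e:
  "pairing (e \<mu> x) (cmat (nabla_bilinear g k \<phi> x) *v e \<nu> x)
    = - (\<kappa> \<mu> x + \<kappa> \<nu> x) * pairing (nabla_vector g k (e \<mu>) x) (\<alpha> \<nu> x)"
proof -
  have "pderiv_coord k (\<lambda>y. pairing (e \<mu> y) (cmat (\<phi> y) *v e \<nu> y)) x = 0"
  proof (rule pderiv_coord_const_on[OF open_U x])
    fix y assume "y \<in> U"
    then show "pairing (e \<mu> y) (cmat (\<phi> y) *v e \<nu> y) = 0"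
      by (simp add: form_null_frame.form_e[OF form_null_frame_at] null_frame.dual[OF null_frame_at]
          pairing_commute[of "e \<mu> y"])
  qed
  then have "pairing (e \<mu> x) (cmat (nabla_bilinear g k \<phi> x) *v e \<nu> x)
      = - pairing (nabla_vector g k (e \<mu>) x) (cmat (\<phi> x) *v e \<nu> x)
        - pairing (e \<mu> x) (cmat (\<phi> x) *v nabla_vector g k (e \<nu>) x)"
    using nabla_leibniz[OF differentiable_at(2,3,3), of k \<mu> \<nu> g] by algebra
  also have "\<dots> = - \<kappa> \<nu> x * pairing (nabla_vector g k (e \<mu>) x) (\<alpha> \<nu> x)
      + \<kappa> \<mu> x * pairing (nabla_vector g k (e \<nu>) x) (\<alpha> \<mu> x)"
    by (simp add: skew_matrix_pairing[OF form_skew, of "e \<mu> x"] form_e)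
  also have "pairing (nabla_vector g k (e \<nu>) x) (\<alpha> \<mu> x) = - pairing (nabla_vector g k (e \<mu>) x) (\<alpha> \<nu> x)"
    using nabla_e_skew[of k \<mu> \<nu>] by (simp add: eq_neg_iff_add_eq_0 add.commute)
  finally show ?thesis by (simp add: algebra_simps)
qed

text \<open>The conformal Killing-Yano equation for complex arguments.  The trace part contains \<open>X\<close> only through
  \<open>g(X, Y)\<close> and \<open>g(X, Z)\<close>, so it vanishes on an isotropic subspace.\<close>

lemma cky_contraction:
  obtains r K where "\<And>X Y Z. (\<Sum>k\<in>UNIV. X $ k * pairing Y (cmat (nabla_bilinear g k \<phi> x) *v Z))
     = 1 / 3 * pairing Y (insert_first X (cten (ext_deriv2 \<phi> x)) *v Z)
       + r * (pairing K Z * pairing X (cmat (g x) *v Y) - pairing K Y * pairing X (cmat (g x) *v Z))"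
proof -
  let ?d = "1 / (real CARD('n) - 1)"
  obtain T K where T: "three_form_on U T"
    and eq: "\<And>X. nabla2 g \<phi> x X = (1/3) *\<^sub>R insert_first X (T x) + ?d *\<^sub>R wedge11 (g x *v X) (K x)"
    using cky x unfolding conformal_killing_yano_def by blast
  have two: "two_form_on U \<phi>"
    using cky by (simp add: conformal_killing_yano_def)
  have T_eq: "T x = ext_deriv2 \<phi> x"
    by (rule cky_three_form_eq_ext_deriv2[where T=T and K=K, OF open_U x pseudo_metric two T eq])
  have "g x *v axis k 1 = g x $ k" for k
  proof -
    have "g x $ i $ k = g x $ k $ i" for i
      using pseudo_metric x by (intro symmetric_matrix_nth) (auto simp: pseudo_metric_on_def)
    then show ?thesis by (simp add: matrix_vector_mult_basis column_def vec_eq_iff)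
  qed
  moreover have "insert_first (axis k 1) (T x) = T x $ k" for k
    by (simp add: insert_first_def axis_def vec_eq_iff if_distrib[where f="\<lambda>z. z * _"] cong: if_cong)
  ultimately have nabla: "nabla_bilinear g k \<phi> x = (1/3) *\<^sub>R T x $ k + ?d *\<^sub>R wedge11 (g x $ k) (K x)" for k
    by (simp add: nabla_bilinear_eq_nabla2 eq)
  have components: "pairing Y (cmat (nabla_bilinear g k \<phi> x) *v Z)
      = 1 / 3 * pairing Y (cmat (T x $ k) *v Z) + of_real ?d * (pairing (cvec (K x)) Z * (cmat (g x) *v Y) $ k
        - pairing (cvec (K x)) Y * (cmat (g x) *v Z) $ k)" for Y Z k
  proof -
    have "pairing (cvec (g x $ k)) Z = (cmat (g x) *v Z) $ k" for Z
      by (simp add: pairing_def matrix_vector_mult_def)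
    then show ?thesis
      unfolding nabla
      by (simp add: cmat_linear_ops cmat_wedge_scaleR outer_products_mult pairing_commute[of Y]
          diff_divide_distrib mult.commute)
  qed
  have "(\<Sum>k\<in>UNIV. X $ k * pairing Y (cmat (T x $ k) *v Z)) = pairing Y (insert_first X (cten (T x)) *v Z)"
    for X Y Z
  proof -
    have "(insert_first X (cten (T x)) *v Z) $ i = (\<Sum>k\<in>UNIV. X $ k *s (cmat (T x $ k) *v Z)) $ i" for i
      by (simp add: insert_first_def cten_def matrix_vector_mult_def sum_distrib_left
          sum_distrib_right mult_ac) (rule sum.swap)
    then have "insert_first X (cten (T x)) *v Z = (\<Sum>k\<in>UNIV. X $ k *s (cmat (T x $ k) *v Z))"
      by (simp add: vec_eq_iff)
    then show ?thesis by simp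
  qed
  moreover have "(\<Sum>k\<in>UNIV. X $ k * pairing Y (cmat (nabla_bilinear g k \<phi> x) *v Z))
      = 1 / 3 * (\<Sum>k\<in>UNIV. X $ k * pairing Y (cmat (T x $ k) *v Z))
        + of_real ?d * (pairing (cvec (K x)) Z * pairing X (cmat (g x) *v Y)
          - pairing (cvec (K x)) Y * pairing X (cmat (g x) *v Z))" for X Y Z
    unfolding components pairing_def[of X] sum_distrib_left
    by (simp add: sum.distrib[symmetric] sum_subtractf[symmetric] sum_distrib_left algebra_simps)
  ultimately show thesis
    by (intro that[of "of_real ?d" "cvec (K x)"]) (simp add: T_eq)
qed

text \<open>On \<open>f\<^sub>\<rho>, e\<^sub>\<mu>, e\<^sub>\<nu>\<close> the three-form \<open>\<alpha>\<^sub>\<rho> \<and> \<tau>(e\<^sub>\<rho>, -, -)\<close> reduces to the value below, because \<open>\<alpha>\<^sub>\<rho>\<close>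
  annihilates the last two vectors.\<close>

lemma tau_vanishes:
  "pairing (e \<mu> x) (insert_first (e \<rho> x) (cten (ext_deriv2 \<phi> x)) *v e \<nu> x) = 0"
  using wedge12_contract[of "f \<rho> x" "e \<mu> x" "e \<nu> x" "\<alpha> \<rho> x" "insert_first (e \<rho> x) (cten (ext_deriv2 \<phi> x))"]
  by (simp add: tau_\<alpha>[OF x] dual)

text \<open>The heart of the argument: \<open>-(\<kappa>\<^sub>\<mu> + \<kappa>\<^sub>\<nu>) \<alpha>\<^sub>\<nu>(\<nabla>\<^sub>X e\<^sub>\<mu>) = (\<nabla>\<^sub>X \<phi>)(e\<^sub>\<mu>, e\<^sub>\<nu>) = \<tau>(X, e\<^sub>\<mu>, e\<^sub>\<nu>)/3 = 0\<close> for
  \<open>X = e\<^sub>\<rho>\<close>, and the first factor is not zero.\<close>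

lemma nabla_e_in_eigendist:
  "(\<Sum>k\<in>UNIV. e \<rho> x $ k * pairing (nabla_vector g k (e \<mu>) x) (\<alpha> \<nu> x)) = 0"
proof -
  obtain r K where K: "\<And>X Y Z. (\<Sum>k\<in>UNIV. X $ k * pairing Y (cmat (nabla_bilinear g k \<phi> x) *v Z))
     = 1 / 3 * pairing Y (insert_first X (cten (ext_deriv2 \<phi> x)) *v Z)
       + r * (pairing K Z * pairing X (cmat (g x) *v Y) - pairing K Y * pairing X (cmat (g x) *v Z))"
    by (rule cky_contraction) blast
  have null: "pairing (e \<mu> x) (cmat (g x) *v e \<nu> x) = 0" for \<mu> \<nu>
    by (simp add: metric_e dual pairing_commute[of "e \<mu> x"])
  have "- (\<kappa> \<mu> x + \<kappa> \<nu> x) * (\<Sum>k\<in>UNIV. e \<rho> x $ k * pairing (nabla_vector g k (e \<mu>) x) (\<alpha> \<nu> x))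
      = (\<Sum>k\<in>UNIV. e \<rho> x $ k * pairing (e \<mu> x) (cmat (nabla_bilinear g k \<phi> x) *v e \<nu> x))"
    unfolding nabla_form_e sum_distrib_left by (simp add: mult_ac)
  also have "\<dots> = 0"
    unfolding K by (simp add: tau_vanishes null)
  finally have "- (\<kappa> \<mu> x + \<kappa> \<nu> x) * (\<Sum>k\<in>UNIV. e \<rho> x $ k * pairing (nabla_vector g k (e \<mu>) x) (\<alpha> \<nu> x)) = 0" .
  then show ?thesis
    using sum_nonzero[of \<mu> \<nu>] unfolding mult_eq_0_iff neg_equal_0_iff_equal by blast
qed

lemma nabla_coform_e: "nabla_coform x \<nu> (e \<rho> x) (e \<mu> x) = 0"
proof -
  have "pairing (pderiv_coord k (\<alpha> \<nu>) x) (e \<mu> x) = - pairing (\<alpha> \<nu> x) (pderiv_coord k (e \<mu>) x)" for k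
  proof -
    have "pderiv_coord k (\<lambda>y. pairing (\<alpha> \<nu> y) (e \<mu> y)) x = 0"
      by (rule pderiv_coord_const_on[OF open_U x]) (simp add: null_frame.dual[OF null_frame_at])
    then show ?thesis
      by (simp add: pderiv_coord_bilinear[OF bounded_bilinear_pairing differentiable_at(4,3)]
          eq_neg_iff_add_eq_0 add.commute)
  qed
  then have "nabla_coform x \<nu> (e \<rho> x) (e \<mu> x)
      = - (\<Sum>k\<in>UNIV. e \<rho> x $ k * pairing (nabla_vector g k (e \<mu>) x) (\<alpha> \<nu> x))"
    by (simp add: nabla_coform_def nabla_vector_def pairing_commute[of _ "\<alpha> \<nu> x"] algebra_simps
        flip: sum_negf)
  then show ?thesis by (simp add: nabla_e_in_eigendist)
qed

text \<open>Tensoriality extends the statement about frame vectors to all vectors of the distribution; in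
  this form it applies to sections and to velocities of curves alike.\<close>

lemma nabla_coform_vanishes:
  assumes "X \<in> eigendist x" "Y \<in> eigendist x"
  shows "nabla_coform x \<nu> X Y = 0"
proof -
  have span: "eigendist x = vec.span (range (\<lambda>\<mu>. e \<mu> x))"
    by (simp add: eigendist_at[OF x] D_eq_span)
  have "nabla_coform x \<nu> (e \<rho> x) Y = 0" for \<rho>
    using assms(2) unfolding span
  proof (induction rule: vec.span_induct)
    case base
    show ?case
      by (auto simp: vec.subspace_def nabla_coform_def matrix_vector_right_distrib vector_scalar_commute
          algebra_simps sum.distrib sum_subtractf sum_distrib_left[symmetric])
  qed (auto simp: nabla_coform_e)
  with assms(1) show ?thesis
    unfolding span
  proof (induction rule: vec.span_induct)
    case base
    show ?case
      by (auto simp: vec.subspace_def nabla_coform_def distrib_right mult.assoc sum.distrib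
          sum_distrib_left[symmetric])
  qed auto
qed

end

text \<open>Differentiating \<open>\<alpha>\<^sub>\<nu>(X) = \<alpha>\<^sub>\<nu>(Y) = 0\<close> turns \<open>\<alpha>\<^sub>\<nu>([X, Y])\<close> into \<open>(\<nabla>\<^sub>Y \<alpha>\<^sub>\<nu>)(X) - (\<nabla>\<^sub>X \<alpha>\<^sub>\<nu>)(Y)\<close>, where
  the Christoffel terms may be inserted because they are symmetric.\<close>

lemma integrable_eigendist: "integrable_distribution U eigendist"
  unfolding integrable_distribution_def
proof (intro allI impI ballI, elim conjE)
  fix W X Y x
  assume W: "open W" "W \<subseteq> U" and X: "smooth_on W X" and Y: "smooth_on W Y"
    and XY: "\<forall>x\<in>W. X x \<in> eigendist x \<and> Y x \<in> eigendist x" and "x \<in> W"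
  then have x: "x \<in> U" by auto
  have deriv: "pairing (\<alpha> \<nu> x) (pderiv_coord k Z x) = - pairing (pderiv_coord k (\<alpha> \<nu>) x) (Z x)"
    if Z: "smooth_on W Z" "\<And>x. x \<in> W \<Longrightarrow> Z x \<in> eigendist x" for Z k \<nu>
  proof -
    have Z': "Z differentiable (at x)"
      using Z(1) \<open>x \<in> W\<close> by (rule smooth_on_imp_differentiable)
    have "pderiv_coord k (\<lambda>y. pairing (\<alpha> \<nu> y) (Z y)) x = 0"
    proof (rule pderiv_coord_const_on[OF W(1) \<open>x \<in> W\<close>])
      fix y assume "y \<in> W"
      with Z(2)[of y] W show "pairing (\<alpha> \<nu> y) (Z y) = 0"
        by (auto simp: eigendist_def)
    qed
    then show ?thesis
      by (simp add: pderiv_coord_bilinear[OF bounded_bilinear_pairing differentiable_at(4)[OF x] Z']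
          eq_neg_iff_add_eq_0)
  qed
  define C where "C \<nu> X Y = (\<Sum>k\<in>UNIV. X $ k * pairing (\<alpha> \<nu> x) (cmat (christoffel_matrix g x k) *v Y))"
    for \<nu> and X Y :: "complex^'n"
  have C: "C \<nu> X Y = C \<nu> Y X" for \<nu> X Y
  proof -
    have C_eq: "C \<nu> X Y = (\<Sum>k\<in>UNIV. \<Sum>i\<in>UNIV. X $ k * Y $ i * (\<Sum>l\<in>UNIV. \<alpha> \<nu> x $ l * of_real (christoffel g x l k i)))"
      for X Y
    proof -
      have "pairing (\<alpha> \<nu> x) (cmat (christoffel_matrix g x k) *v Y)
          = (\<Sum>i\<in>UNIV. Y $ i * (\<Sum>l\<in>UNIV. \<alpha> \<nu> x $ l * of_real (christoffel g x l k i)))" for k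
        unfolding pairing_def matrix_vector_mult_def
        by (simp add: christoffel_matrix_def sum_distrib_left mult_ac) (rule sum.swap)
      then show ?thesis
        by (simp add: C_def sum_distrib_left mult.assoc)
    qed
    show ?thesis
      unfolding C_eq by (subst sum.swap) (simp add: christoffel_symmetric[OF open_U x pseudo_metric] mult_ac)
  qed
  have "pairing (\<alpha> \<nu> x) (lie_bracket X Y x) = 0" for \<nu>
  proof -
    have "pairing (\<alpha> \<nu> x) (lie_bracket X Y x)
        = (\<Sum>k\<in>UNIV. Y x $ k * pairing (pderiv_coord k (\<alpha> \<nu>) x) (X x))
          - (\<Sum>k\<in>UNIV. X x $ k * pairing (pderiv_coord k (\<alpha> \<nu>) x) (Y x))"
      using deriv[OF X] deriv[OF Y] XY by (simp add: lie_bracket_def sum_subtractf sum_negf)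
    also have "\<dots> = nabla_coform x \<nu> (Y x) (X x) - nabla_coform x \<nu> (X x) (Y x)"
      using C[of \<nu> "X x" "Y x"]
      by (simp add: nabla_coform_def C_def right_diff_distrib sum_subtractf)
    also have "\<dots> = 0"
      using XY \<open>x \<in> W\<close> by (simp add: nabla_coform_vanishes[OF x])
    finally show ?thesis .
  qed
  then show "lie_bracket X Y x \<in> eigendist x"
    using x by (simp add: eigendist_def)
qed

end

section \<open>Complex structures\<close>

lemma neg_mat_1_mult: "(- mat 1) *v Z = - (Z :: 'a::comm_ring_1^'n)"
  by (simp add: vec_eq_iff matrix_vector_mult_def mat_def if_distrib[where f="\<lambda>z. z * _"]
      if_distrib[where f=uminus] cong: if_cong)

text \<open>For real \<open>X\<close> and \<open>Y\<close> the fields \<open>X - i JX\<close> and \<open>Y - i JY\<close> are of type \<open>(1,0)\<close>.  Their bracket is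
  \<open>P - i Q\<close> with \<open>P = [X, Y] - [JX, JY]\<close> and \<open>Q = [JX, Y] + [X, JY]\<close>, and the imaginary part of the condition
  that it is of type \<open>(1,0)\<close> reads \<open>J Q = - P\<close>, which is the vanishing of the Nijenhuis tensor.\<close>

lemma integrable_T10_imp_nijenhuis_zero:
  fixes J :: "real^'n \<Rightarrow> real^'n^'n"
  assumes "smooth_on U J" and J2: "\<And>x. x \<in> U \<Longrightarrow> J x ** J x = - mat 1"
    and integrable: "integrable_distribution U (T10 U J)"
    and W: "open W" "W \<subseteq> U" and X: "smooth_on W X" and Y: "smooth_on W Y" and "x \<in> W"
  shows "nijenhuis J X Y x = 0"
proof -
  define JX where "JX y = J y *v X y" for y
  define JY where "JY y = J y *v Y y" for y
  have J: "smooth_on W J"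
    using assms(1) W(2) by (rule smooth_on_subset)
  have mult: "bounded_bilinear ((*v) :: real^'n^'n \<Rightarrow> real^'n \<Rightarrow> real^'n)"
    by (auto simp: bilinear_conv_bounded_bilinear[symmetric] bilinear_def vec_eq_iff matrix_vector_mult_def
      sum.distrib sum_distrib_left algebra_simps intro!: linearI)
  have smooth_J: "smooth_on W JX" "smooth_on W JY"
    unfolding JX_def JY_def using smooth_on_bilinear[OF mult W(1) J] X Y by blast+
  have JJ: "J y *v (J y *v v) = - v" if "y \<in> W" for y v
  proof -
    have "(J y ** J y) *v v = - v"
      using J2[of y] that W(2) by (auto simp: neg_mat_1_mult)
    then show ?thesis by (simp add: matrix_vector_mul_assoc)
  qed
  define Z where "Z A B y = cvec (A y) - \<i> *s cvec (B y)" for A B :: "real^'n \<Rightarrow> real^'n" and y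
  have iscale: "bounded_linear (\<lambda>v. \<i> *s cvec v :: complex^'n)"
    by (auto simp: linear_conv_bounded_linear[symmetric] vec_eq_iff scaleR_conv_of_real[where 'a=complex]
        algebra_simps intro!: linearI)
  have smooth_Z: "smooth_on W (Z A B)" if "smooth_on W A" "smooth_on W B" for A B
    unfolding Z_def
    using smooth_on_diff[OF W(1) smooth_on_linear[OF bounded_linear_cvec W(1) that(1)]
        smooth_on_linear[OF iscale W(1) that(2)]] .
  have pderiv_Z: "pderiv_coord k (Z A B) x = cvec (pderiv_coord k A x) - \<i> *s cvec (pderiv_coord k B x)"
    if "smooth_on W A" "smooth_on W B" for A B k
  proof -
    have d: "A differentiable (at x)" "B differentiable (at x)"
      using that \<open>x \<in> W\<close> by (auto intro: smooth_on_imp_differentiable)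
    have "(Z A B has_derivative (\<lambda>v. cvec (frechet_derivative A (at x) v)
        - \<i> *s cvec (frechet_derivative B (at x) v))) (at x)"
      unfolding Z_def using d
      by (intro has_derivative_diff bounded_linear.has_derivative[OF bounded_linear_cvec]
          bounded_linear.has_derivative[OF iscale]) (auto simp: frechet_derivative_works)
    then show ?thesis
      by (simp add: pderiv_coord_at) (simp add: pderiv_coord_def)
  qed
  define P where "P = lie_bracket X Y x - lie_bracket JX JY x"
  define Q where "Q = lie_bracket JX Y x + lie_bracket X JY x"
  have "lie_bracket (Z X JX) (Z Y JY) x = cvec P - \<i> *s cvec Q"
    unfolding P_def Q_def lie_bracket_def pderiv_Z[OF X smooth_J(1)] pderiv_Z[OF Y smooth_J(2)]
    by (simp add: Z_def vec_eq_iff complex_eq_iff sum.distrib sum_subtractf algebra_simps)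
  moreover have "Z X JX y \<in> T10 U J y \<and> Z Y JY y \<in> T10 U J y" if "y \<in> W" for y
  proof -
    have "cmat (J y) *v Z A B y = \<i> *s Z A B y" if "B y = J y *v A y" for A B
      using JJ[OF \<open>y \<in> W\<close>] that
      by (simp add: Z_def matrix_vector_mult_diff_distrib vector_scalar_commute cmat_simps
          vector_ssub_ldistrib vector_smult_assoc)
    then show ?thesis
      using that W(2) by (auto simp: T10_def JX_def JY_def)
  qed
  then have "lie_bracket (Z X JX) (Z Y JY) x \<in> T10 U J x"
    using integrable W smooth_Z[OF X smooth_J(1)] smooth_Z[OF Y smooth_J(2)] \<open>x \<in> W\<close>
    unfolding integrable_distribution_def by blast
  ultimately have "cmat (J x) *v (cvec P - \<i> *s cvec Q) = \<i> *s (cvec P - \<i> *s cvec Q)"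
    using \<open>x \<in> W\<close> W(2) by (auto simp: T10_def)
  then have "cvec (J x *v P) - \<i> *s cvec (J x *v Q) = cvec Q + \<i> *s cvec P"
    by (simp add: matrix_vector_mult_diff_distrib vector_scalar_commute cmat_simps
        vector_ssub_ldistrib vector_smult_assoc)
  then have "- (J x *v Q) = P"
    by (simp add: vec_eq_iff complex_eq_iff)
  then have "J x *v Q = - P"
    by (metis minus_minus)
  then show ?thesis
    by (simp add: nijenhuis_def P_def Q_def matrix_vector_right_distrib algebra_simps
        flip: JX_def[abs_def] JY_def[abs_def])
qed

text \<open>The vector \<open>v - i Jv\<close> is of type \<open>(1,0)\<close> for \<open>J\<close>, hence for \<open>J'\<close>; comparing real parts gives
  \<open>J'v = Jv\<close>.\<close>

lemma T10_determines:
  assumes "J \<in> extensional U" "J' \<in> extensional U"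
    and J2: "\<And>x. x \<in> U \<Longrightarrow> J x ** J x = - mat 1"
    and eq: "T10 U J = T10 U J'"
  shows "J = J'"
proof (rule extensionalityI[OF assms(1,2)])
  fix x assume x: "x \<in> U"
  have "J x *v v = J' x *v v" for v
  proof -
    have "(J x ** J x) *v v = - v"
      using J2[OF x] by (simp add: neg_mat_1_mult)
    then have "J x *v (J x *v v) = - v"
      by (simp add: matrix_vector_mul_assoc)
    then have "cvec v - \<i> *s cvec (J x *v v) \<in> T10 U J x"
      using x by (simp add: T10_def matrix_vector_mult_diff_distrib vector_scalar_commute cmat_simps
          vector_ssub_ldistrib vector_smult_assoc)
    then have "cmat (J' x) *v (cvec v - \<i> *s cvec (J x *v v)) = \<i> *s (cvec v - \<i> *s cvec (J x *v v))"
      using x unfolding eq by (simp add: T10_def)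
    then have "cvec (J' x *v v) - \<i> *s cvec (J' x *v (J x *v v)) = \<i> *s cvec v + cvec (J x *v v)"
      by (simp add: matrix_vector_mult_diff_distrib vector_scalar_commute cmat_simps
        vector_ssub_ldistrib vector_smult_assoc)
    then show ?thesis
      by (simp add: vec_eq_iff complex_eq_iff)
  qed
  then show "J x = J' x" by (simp add: matrix_eq)
qed

definition re_outer :: "complex^'n \<Rightarrow> complex^'n \<Rightarrow> real^'n^'n" where
  "re_outer a b = (\<chi> i j. Re (\<i> * (a $ i * b $ j)))"

lemma bounded_bilinear_re_outer: "bounded_bilinear re_outer"
  by (auto simp: bilinear_conv_bounded_bilinear[symmetric] bilinear_def vec_eq_iff re_outer_def
      algebra_simps intro!: linearI)

context cky_frame
begin

text \<open>The entrywise real part of the endomorphism that is multiplication by \<open>i\<close> on the \<open>e\<^sub>\<mu>\<close> and by \<open>-i\<close>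
  on the \<open>f\<^sub>\<mu>\<close>.  In Euclidean signature that endomorphism is already real, by \<open>eigenstructure_apply\<close>.\<close>

definition eigenstructure :: "real^'n \<Rightarrow> real^'n^'n" where
  "eigenstructure = (\<lambda>x\<in>U. \<Sum>\<mu>\<in>UNIV. re_outer (e \<mu> x) (\<beta> \<mu> x) - re_outer (f \<mu> x) (\<alpha> \<mu> x))"

lemma smooth_eigenstructure: "smooth_on U eigenstructure"
  by (rule smooth_on_cong[OF open_U, of "\<lambda>x. \<Sum>\<mu>\<in>UNIV. re_outer (e \<mu> x) (\<beta> \<mu> x) - re_outer (f \<mu> x) (\<alpha> \<mu> x)"])
    (auto simp: eigenstructure_def intro!: smooth_on_sum smooth_on_diff
      smooth_on_bilinear[OF bounded_bilinear_re_outer] open_U smooth_frame)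

context
  fixes x assumes x: "x \<in> U" and euclidean: "euclidean_form (g x)"
begin

interpretation skew_null_frame "g x" c "\<lambda>\<mu>. \<alpha> \<mu> x" "\<lambda>\<mu>. \<beta> \<mu> x" "\<lambda>\<mu>. e \<mu> x" "\<lambda>\<mu>. f \<mu> x" "\<phi> x" "\<lambda>\<mu>. \<kappa> \<mu> x"
  by (rule skew_null_frame_at[OF x])

interpretation flip: skew_null_frame "g x" c "\<lambda>\<mu>. \<beta> \<mu> x" "\<lambda>\<mu>. \<alpha> \<mu> x" "\<lambda>\<mu>. f \<mu> x" "\<lambda>\<mu>. e \<mu> x" "\<phi> x"
  "\<lambda>\<mu>. - \<kappa> \<mu> x"
  by (rule flip_skew)

text \<open>All eigenvalues are imaginary, so conjugation exchanges \<open>\<alpha>\<^sub>\<mu>\<close> with \<open>\<beta>\<^sub>\<mu>\<close> while it also exchanges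
  the factors \<open>-i\<close> and \<open>i\<close>.  The complex matrix \<open>Jc\<close> below therefore commutes with conjugation, that
  is, it has real entries.\<close>

lemma eigenstructure_apply:
  "cmat (eigenstructure x) *v Z = (\<Sum>\<mu>\<in>UNIV. \<i> *s (pairing (\<beta> \<mu> x) Z *s e \<mu> x - pairing (\<alpha> \<mu> x) Z *s f \<mu> x))"
proof -
  define Jc :: "complex^'n^'n" where
    "Jc = (\<chi> i j. \<Sum>\<mu>\<in>UNIV. \<i> * (e \<mu> x $ i * \<beta> \<mu> x $ j - f \<mu> x $ i * \<alpha> \<mu> x $ j))"
  have Jc: "Jc *v Z = (\<Sum>\<mu>\<in>UNIV. \<i> *s (pairing (\<beta> \<mu> x) Z *s e \<mu> x - pairing (\<alpha> \<mu> x) Z *s f \<mu> x))" for Z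
    unfolding Jc_def matrix_vector_mult_def pairing_def
    by (simp add: vec_eq_iff sum_distrib_left sum_distrib_right right_diff_distrib left_diff_distrib
        sum_subtractf mult_ac sum.swap[of _ "UNIV :: 'm set"])
  have \<alpha>: "pairing (\<alpha> \<mu> x) (Jc *v Z) = - \<i> * pairing (\<alpha> \<mu> x) Z"
    and \<beta>: "pairing (\<beta> \<mu> x) (Jc *v Z) = \<i> * pairing (\<beta> \<mu> x) Z" for \<mu> Z
    by (simp_all add: Jc dual if_distrib[where f="\<lambda>z. _ * z"] sum_negf cong: if_cong)
  have cnj: "cnj_vec (Jc *v Z) = Jc *v cnj_vec Z" for Z
  proof -
    have "pairing (\<alpha> \<mu> x) (cnj_vec (Jc *v Z) - Jc *v cnj_vec Z) = 0" for \<mu>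
    proof -
      obtain k where "\<And>Y. pairing (\<alpha> \<mu> x) (cnj_vec Y) = k * cnj (pairing (\<beta> \<mu> x) Y)"
        using coform_cnj_imaginary[OF eigval_imaginary_euclidean[OF euclidean]] by metis
      then show ?thesis by (simp add: \<alpha> \<beta>)
    qed
    moreover have "pairing (\<beta> \<mu> x) (cnj_vec (Jc *v Z) - Jc *v cnj_vec Z) = 0" for \<mu>
    proof -
      obtain k where "\<And>Y. pairing (\<beta> \<mu> x) (cnj_vec Y) = k * cnj (pairing (\<alpha> \<mu> x) Y)"
        using flip.coform_cnj_imaginary[OF flip.eigval_imaginary_euclidean[OF euclidean]] by metis
      then show ?thesis by (simp add: \<alpha> \<beta>)
    qed
    ultimately have "cnj_vec (Jc *v Z) - Jc *v cnj_vec Z = 0"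
      by (rule eq_0I)
    then show ?thesis by simp
  qed
  have "cnj (Jc $ i $ j) = Jc $ i $ j" for i j
  proof -
    have "cnj_vec (axis j 1) = (axis j 1 :: complex^'n)"
      by (simp add: cnj_vec_def axis_def vec_eq_iff)
    then have "cnj_vec (Jc *v axis j 1) $ i = (Jc *v axis j 1) $ i"
      by (simp add: cnj)
    moreover have "(Jc *v axis j 1) $ i = Jc $ i $ j"
      by (simp add: matrix_vector_mult_def axis_def if_distrib[where f="\<lambda>z. _ * z"] cong: if_cong)
    ultimately show ?thesis
      by (simp add: cnj_vec_def)
  qed
  then have "Im (Jc $ i $ j) = 0" for i j
    by (metis cnj.sel(2) equation_minus_iff neg_equal_zero)
  then have "cmat (eigenstructure x) = Jc"
    using x by (simp add: vec_eq_iff complex_eq_iff eigenstructure_def re_outer_def Jc_def)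
      (simp add: algebra_simps)
  then show ?thesis by (simp add: Jc)
qed

lemma coform_eigenstructure:
  "pairing (\<alpha> \<mu> x) (cmat (eigenstructure x) *v Z) = - \<i> * pairing (\<alpha> \<mu> x) Z"
  "pairing (\<beta> \<mu> x) (cmat (eigenstructure x) *v Z) = \<i> * pairing (\<beta> \<mu> x) Z"
  by (simp_all add: eigenstructure_apply dual if_distrib[where f="\<lambda>z. _ * z"] sum_negf cong: if_cong)

lemma eigenstructure_square: "eigenstructure x ** eigenstructure x = - mat 1"
proof -
  have "cmat (eigenstructure x) *v (cmat (eigenstructure x) *v Z) + Z = 0" for Z
    by (rule eq_0I) (simp_all add: coform_eigenstructure)
  then have "cmat (eigenstructure x ** eigenstructure x) *v Z = cmat (- mat 1) *v Z" for Z
    by (simp add: cmat_linear_ops cmat_simps(3,6) eq_neg_iff_add_eq_0 neg_mat_1_mult)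
  then show ?thesis
    by (metis cmat_inject matrix_eq)
qed

lemma eigenstructure_isometry:
  "transpose (eigenstructure x) ** g x ** eigenstructure x = g x"
proof -
  let ?J = "cmat (eigenstructure x)"
  have "cmat (transpose (eigenstructure x) ** g x ** eigenstructure x) = cmat (g x)"
  proof (rule matrix_eq_pairing)
    fix X Y
    have "pairing X (cmat (transpose (eigenstructure x) ** g x ** eigenstructure x) *v Y)
        = pairing (?J *v X) (cmat (g x) *v (?J *v Y))"
      by (simp add: cmat_linear_ops cmat_simps(5) pairing_matrix_left[of X "transpose ?J"] transpose_transpose
          del: transpose_matrix_vector)
    also have "\<dots> = pairing X (cmat (g x) *v Y)"
      unfolding metric_pairing coform_eigenstructure by (simp add: algebra_simps)
    finally show "pairing X (cmat (transpose (eigenstructure x) ** g x ** eigenstructure x) *v Y)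
        = pairing X (cmat (g x) *v Y)" .
  qed
  then show ?thesis by (simp add: cmat_inject)
qed

lemma T10_eigenstructure_at: "T10 U eigenstructure x = eigendist x"
proof -
  have "cmat (eigenstructure x) *v Z - \<i> *s Z = 0 \<longleftrightarrow> (\<forall>\<mu>. pairing (\<alpha> \<mu> x) Z = 0)" for Z
  proof
    assume Z: "cmat (eigenstructure x) *v Z - \<i> *s Z = 0"
    have "pairing (\<alpha> \<mu> x) (cmat (eigenstructure x) *v Z - \<i> *s Z) = - 2 * \<i> * pairing (\<alpha> \<mu> x) Z" for \<mu>
      by (simp add: coform_eigenstructure)
    with Z show "\<forall>\<mu>. pairing (\<alpha> \<mu> x) Z = 0" by simp
  next
    assume "\<forall>\<mu>. pairing (\<alpha> \<mu> x) Z = 0"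
    then show "cmat (eigenstructure x) *v Z - \<i> *s Z = 0"
      by (intro eq_0I) (simp_all add: coform_eigenstructure)
  qed
  then show ?thesis
    using x by (simp add: T10_def eigendist_def)
qed

end

lemma eigenstructure_complex_structure:
  assumes "\<forall>x\<in>U. euclidean_form (g x)"
  shows "T10 U eigenstructure = eigendist" "compatible_complex_structure U g eigenstructure"
proof -
  show T10: "T10 U eigenstructure = eigendist"
  proof
    fix x show "T10 U eigenstructure x = eigendist x"
      using assms T10_eigenstructure_at by (cases "x \<in> U") (auto simp: T10_def eigendist_def)
  qed
  show "compatible_complex_structure U g eigenstructure"
    unfolding compatible_complex_structure_def
  proof (intro conjI ballI allI impI)
    fix W x and X Y :: "real^'n \<Rightarrow> real^'n"
    assume "open W \<and> W \<subseteq> U \<and> smooth_on W X \<and> smooth_on W Y" "x \<in> W"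
    then show "nijenhuis eigenstructure X Y x = 0"
      using integrable_T10_imp_nijenhuis_zero[OF smooth_eigenstructure, of W X Y x]
        eigenstructure_square integrable_eigendist assms
      by (simp add: T10)
  qed (use assms smooth_eigenstructure eigenstructure_square eigenstructure_isometry in auto)
qed

end

section \<open>Affine parameters\<close>

text \<open>The interval may be unbounded, so its end points are taken in the extended reals.\<close>

lemma open_interval_antiderivative:
  fixes r :: "real \<Rightarrow> real"
  assumes "open I" "is_interval I" "continuous_on I r"
  obtains R where "\<And>t. t \<in> I \<Longrightarrow> (R has_real_derivative r t) (at t)"
proof (cases "I = {}")
  case True
  then show thesis by (intro that) auto
next
  case False
  define a where "a = Inf (ereal ` I)"
  define b where "b = Sup (ereal ` I)"
  have between: "t \<in> I" if t: "a < ereal t" "ereal t < b" for t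
  proof -
    obtain p where p: "p \<in> I" "p < t"
      using t(1) unfolding a_def Inf_less_iff by auto
    obtain q where q: "q \<in> I" "t < q"
      using t(2) unfolding b_def less_Sup_iff by auto
    show ?thesis
      using assms(2) p(1) q(1) less_imp_le[OF p(2)] less_imp_le[OF q(2)] unfolding is_interval_1 by blast
  qed
  have bounds: "a < ereal t \<and> ereal t < b" if "t \<in> I" for t
  proof -
    obtain d where d: "d > 0" "cball t d \<subseteq> I"
      using assms(1) \<open>t \<in> I\<close> open_contains_cball by blast
    then have "t - d \<in> I" "t + d \<in> I" by (auto simp: subset_iff dist_real_def)
    then have "a \<le> ereal (t - d)" "ereal (t + d) \<le> b"
      unfolding a_def b_def by (auto intro: Inf_lower Sup_upper)
    moreover have "ereal (t - d) < ereal t" "ereal t < ereal (t + d)" using d by auto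
    ultimately show ?thesis by (meson le_less_trans less_le_trans)
  qed
  with False have "a < b" by (metis all_not_in_conv less_trans)
  moreover have "isCont r t" if "a < ereal t" "ereal t < b" for t
    using between[OF that] assms(1,3) by (simp add: continuous_on_eq_continuous_at)
  ultimately obtain R where "\<forall>t. a < ereal t \<longrightarrow> ereal t < b \<longrightarrow> (R has_vector_derivative r t) (at t)"
    using einterval_antiderivative[of a b r] by blast
  with bounds show thesis
    by (intro that[of R]) (auto simp: has_real_derivative_iff_has_vector_derivative)
qed

lemma increasing_inverse:
  fixes s :: "real \<Rightarrow> real"
  assumes I: "open I" "is_interval I"
    and deriv: "\<And>t. t \<in> I \<Longrightarrow> (s has_real_derivative s' t) (at t)" and pos: "\<And>t. t \<in> I \<Longrightarrow> s' t > 0"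
  obtains J h where "open J" "is_interval J" "bij_betw h J I"
    "\<And>y. y \<in> J \<Longrightarrow> (h has_real_derivative inverse (s' (h y))) (at y)"
proof -
  have "s p < s q" if "p \<in> I" "q \<in> I" "p < q" for p q
  proof (rule DERIV_pos_imp_increasing[OF \<open>p < q\<close>])
    fix t assume "p \<le> t" "t \<le> q"
    then have "t \<in> I"
      using that I(2) unfolding is_interval_1 by blast
    then show "\<exists>y. (s has_real_derivative y) (at t) \<and> 0 < y"
      using deriv pos by blast
  qed
  then have inj: "inj_on s I"
    by (metis inj_onI linorder_neq_iff order_less_irrefl)
  have cont: "continuous_on I s"
    using deriv by (meson DERIV_isCont continuous_at_imp_continuous_on)
  define h where "h = inv_into I s"
  show thesis
  proof (rule that)
    show "open (s ` I)"
      using cont I(1) inj by (rule invariance_of_domain)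
    show "is_interval (s ` I)"
      using cont I(2) by (simp add: connected_continuous_image is_interval_connected_1)
    show "bij_betw h (s ` I) I"
      using inj by (simp add: h_def bij_betw_inv_into inj_on_imp_bij_betw)
    fix y assume "y \<in> s ` I"
    then obtain t where t: "t \<in> I" "y = s t" by blast
    have h: "h (s t) = t" if "t \<in> I" for t
      using inj that by (simp add: h_def)
    have "(h has_derivative (\<lambda>x. inverse (s' t) * x)) (at (s t))"
      using deriv[OF t(1)] pos[OF t(1)]
      by (intro has_derivative_inverse_strong[OF I(1) t(1) cont h])
        (auto simp: has_field_derivative_def fun_eq_iff)
    then show "(h has_real_derivative inverse (s' (h y))) (at y)"
      by (simp add: t h has_field_derivative_def)
  qed
qed

text \<open>If the covariant acceleration is \<open>r \<gamma>'\<close>, then a parameter \<open>s\<close> with \<open>s'' = r s'\<close> is affine.  Such a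
  parameter is found by integrating twice, \<open>s' = exp R\<close> with \<open>R' = r\<close>, and \<open>h\<close> is the inverse of \<open>s\<close>.\<close>

lemma geodesic_reparametrisation:
  fixes \<gamma> v a :: "real \<Rightarrow> real^'n"
  assumes I: "open I" "is_interval I"
    and v: "\<And>t. t \<in> I \<Longrightarrow> (\<gamma> has_vector_derivative v t) (at t)"
    and a: "\<And>t. t \<in> I \<Longrightarrow> (v has_vector_derivative a t) (at t)"
    and r: "continuous_on I r"
    and acc: "\<And>t. t \<in> I \<Longrightarrow>
      a t + (\<chi> k. \<Sum>i\<in>UNIV. \<Sum>j\<in>UNIV. christoffel g (\<gamma> t) k i j * v t $ i * v t $ j) = r t *\<^sub>R v t"
  shows "\<exists>J h. open J \<and> is_interval J \<and> bij_betw h J I \<and>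
    (\<forall>s\<in>J. \<exists>d. (h has_real_derivative d) (at s) \<and> d \<noteq> 0) \<and> geodesic g J (\<gamma> \<circ> h)"
proof -
  obtain R where R: "\<And>t. t \<in> I \<Longrightarrow> (R has_real_derivative r t) (at t)"
    using open_interval_antiderivative[OF I r] by blast
  have "continuous_on I (\<lambda>t. exp (R t))"
    using R by (intro continuous_on_exp) (meson DERIV_isCont continuous_at_imp_continuous_on)
  then obtain s where s: "\<And>t. t \<in> I \<Longrightarrow> (s has_real_derivative exp (R t)) (at t)"
    using open_interval_antiderivative[OF I] by blast
  obtain J h where J: "open J" "is_interval J" "bij_betw h J I"
    and h: "\<And>y. y \<in> J \<Longrightarrow> (h has_real_derivative inverse (exp (R (h y)))) (at y)"
    using increasing_inverse[OF I s] by auto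
  have hI: "h y \<in> I" if "y \<in> J" for y
    using J(3) that by (auto simp: bij_betw_def)
  have h': "(h has_real_derivative exp (- R (h y))) (at y)" if "y \<in> J" for y
    using h[OF that] by (simp add: exp_minus)
  define w where "w y = exp (- R (h y)) *\<^sub>R v (h y)" for y
  have "geodesic g J (\<gamma> \<circ> h)"
    unfolding geodesic_def
  proof (intro exI[of _ w] ballI conjI)
    fix y assume y: "y \<in> J"
    note hv = h'[OF y, unfolded has_real_derivative_iff_has_vector_derivative]
    show "((\<gamma> \<circ> h) has_vector_derivative w y) (at y)"
      using vector_diff_chain_at[OF hv v[OF hI[OF y]]] by (simp add: w_def)
    have 1: "((\<lambda>y. exp (- R (h y))) has_vector_derivative exp (- R (h y)) * (- (r (h y) * exp (- R (h y))))) (at y)"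
      unfolding has_real_derivative_iff_has_vector_derivative[symmetric]
      using DERIV_chain2[OF R[OF hI[OF y]] h'[OF y]]
      by (auto intro!: derivative_eq_intros)
    have 2: "((\<lambda>y. v (h y)) has_vector_derivative exp (- R (h y)) *\<^sub>R a (h y)) (at y)"
      using vector_diff_chain_at[OF hv a[OF hI[OF y]]] by (simp add: o_def)
    have "(w has_vector_derivative exp (- R (h y)) *\<^sub>R (exp (- R (h y)) *\<^sub>R a (h y))
        + (exp (- R (h y)) * (- (r (h y) * exp (- R (h y))))) *\<^sub>R v (h y)) (at y)"
      unfolding w_def using bounded_bilinear.has_vector_derivative[OF bounded_bilinear_scaleR 1 2] .
    moreover have "exp (- R (h y)) *\<^sub>R (exp (- R (h y)) *\<^sub>R a (h y))
        + (exp (- R (h y)) * (- (r (h y) * exp (- R (h y))))) *\<^sub>R v (h y)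
      = (exp (- R (h y)) * exp (- R (h y))) *\<^sub>R (a (h y) - r (h y) *\<^sub>R v (h y))"
      by (simp add: scaleR_right_diff_distrib mult_ac)
    moreover have "a (h y) - r (h y) *\<^sub>R v (h y)
      = - (\<chi> k. \<Sum>i\<in>UNIV. \<Sum>j\<in>UNIV. christoffel g (\<gamma> (h y)) k i j * v (h y) $ i * v (h y) $ j)"
      using acc[OF hI[OF y]] by (simp add: algebra_simps eq_neg_iff_add_eq_0)
    moreover have "(exp (- R (h y)) * exp (- R (h y))) *\<^sub>R
        - (\<chi> k. \<Sum>i\<in>UNIV. \<Sum>j\<in>UNIV. christoffel g (\<gamma> (h y)) k i j * v (h y) $ i * v (h y) $ j)
      = (\<chi> k. - (\<Sum>i\<in>UNIV. \<Sum>j\<in>UNIV. christoffel g ((\<gamma> \<circ> h) y) k i j * w y $ i * w y $ j))"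
      by (simp add: vec_eq_iff w_def sum_distrib_left mult_ac)
    ultimately show "(w has_vector_derivative
        (\<chi> k. - (\<Sum>i\<in>UNIV. \<Sum>j\<in>UNIV. christoffel g ((\<gamma> \<circ> h) y) k i j * w y $ i * w y $ j))) (at y)"
      by simp
  qed
  moreover have "\<exists>d. (h has_real_derivative d) (at y) \<and> d \<noteq> 0" if "y \<in> J" for y
    using h'[OF that] by (metis exp_not_eq_zero)
  ultimately show ?thesis
    using J by blast
qed

section \<open>Null geodesic congruences\<close>

definition real_line :: "(real^'n) set \<Rightarrow> (real^'n \<Rightarrow> complex^'n) \<Rightarrow> real^'n \<Rightarrow> (real^'n) set" where
  "real_line U E = (\<lambda>x\<in>U. {v. \<exists>z. cvec v = z *s E x})"

lemma real_line_iff: "x \<in> U \<Longrightarrow> v \<in> real_line U E x \<longleftrightarrow> (\<exists>z. cvec v = z *s E x)"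
  by (simp add: real_line_def)

lemma cvec_re_multiple:
  assumes "cnj_vec E = y *s E"
  shows "cvec (\<chi> j. Re (w * E $ j)) = ((w + cnj w * y) / 2) *s E"
proof -
  have "cnj (E $ j) = y * E $ j" for j
    using assms by (simp add: cnj_vec_def vec_eq_iff)
  moreover have Re: "complex_of_real (Re z) = (z + cnj z) / 2" for z
    by (simp add: complex_eq_iff)
  ultimately have "complex_of_real (Re (w * E $ j)) = (w + cnj w * y) / 2 * E $ j" for j
    unfolding Re complex_cnj_mult by (simp add: algebra_simps)
  then show ?thesis
    by (simp only: vec_eq_iff cvec_simps(7) vec_lambda_beta vector_smult_component) simp
qed

lemma real_multiple_unique:
  assumes "cvec v = z *s E" "cvec k = z' *s E" "k \<noteq> 0"
  obtains r where "v = r *\<^sub>R k"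
proof -
  obtain i where i: "k $ i \<noteq> 0"
    using assms(3) by (auto simp: vec_eq_iff)
  have eq: "complex_of_real (v $ j) = z * E $ j" "complex_of_real (k $ j) = z' * E $ j" for j
    using assms(1,2) by (simp_all add: vec_eq_iff)
  define r where "r = v $ i / k $ i"
  have "v $ j = r * k $ j" for j
  proof -
    have "complex_of_real (v $ j * k $ i) = complex_of_real (v $ i * k $ j)"
      by (simp add: eq)
    then have "v $ j * k $ i = v $ i * k $ j"
      by (metis of_real_eq_iff)
    with i show ?thesis by (simp add: r_def field_simps)
  qed
  then show thesis
    by (intro that[of r]) (simp add: vec_eq_iff)
qed

lemma real_line_eq_span:
  assumes "x \<in> U" "k \<in> real_line U E x" "k \<noteq> 0"
  shows "real_line U E x = span {k}"
proof -
  obtain z' where k: "cvec k = z' *s E x"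
    using assms(2) unfolding real_line_iff[OF assms(1)] by blast
  have "v \<in> span {k}" if v: "v \<in> real_line U E x" for v
  proof -
    obtain z where "cvec v = z *s E x"
      using v unfolding real_line_iff[OF assms(1)] by blast
    then obtain r where "v = r *\<^sub>R k"
      using k assms(3) by (rule real_multiple_unique)
    then show ?thesis by (simp add: span_base span_scale)
  qed
  moreover have "r *\<^sub>R k \<in> real_line U E x" for r
    unfolding real_line_iff[OF assms(1)] by (simp add: k vector_smult_assoc)
  ultimately show ?thesis
    by (auto simp: span_singleton)
qed

text \<open>A complex line spanned by a vector proportional to its conjugate contains a real line, and a
  local smooth section of it is the real part of a constant multiple of \<open>E\<close>.\<close>

lemma line_field_real_line:
  fixes E :: "real^'n \<Rightarrow> complex^'n"
  assumes "open U" and E: "smooth_on U E" "\<And>x. x \<in> U \<Longrightarrow> E x \<noteq> 0"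
    and real: "\<And>x. x \<in> U \<Longrightarrow> \<exists>y. cnj_vec (E x) = y *s E x"
  shows "line_field U (real_line U E)"
  unfolding line_field_def
proof
  fix x assume x: "x \<in> U"
  obtain i where i: "E x $ i \<noteq> 0"
    using E(2)[OF x] by (auto simp: vec_eq_iff)
  \<comment> \<open>The constant factor makes the component \<open>k x $ i\<close> equal to \<open>\<bar>E x $ i\<bar>\<^sup>2\<close>, hence nonzero near \<open>x\<close>.\<close>
  define k where "k y = (\<chi> j. Re (cnj (E x $ i) * E y $ j))" for y
  have lin: "bounded_linear (\<lambda>v::complex^'n. (\<chi> j. Re (cnj (E x $ i) * v $ j)) :: real^'n)"
    by (auto simp: linear_conv_bounded_linear[symmetric] vec_eq_iff algebra_simps intro!: linearI)
  have smooth: "smooth_on U k"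
    unfolding k_def by (rule smooth_on_linear[OF lin assms(1) E(1)])
  define W where "W = U \<inter> (\<lambda>y. k y $ i) -` (- {0})"
  have "continuous_on U (\<lambda>y. k y $ i)"
    using smooth_on_imp_continuous[OF smooth] by (intro continuous_intros)
  then have W: "open W"
    unfolding W_def by (rule continuous_open_preimage[OF _ assms(1)]) auto
  have "k x $ i = (cmod (E x $ i))\<^sup>2"
    by (simp add: k_def cmod_def power2_eq_square)
  with i x have xW: "x \<in> W" by (simp add: W_def)
  have "k y \<noteq> 0 \<and> real_line U E y = span {k y}" if "y \<in> W" for y
  proof -
    have y: "y \<in> U" "k y \<noteq> 0"
      using that by (auto simp: W_def)
    moreover have "k y \<in> real_line U E y"
      using real[OF y(1)] cvec_re_multiple unfolding real_line_iff[OF y(1)] k_def by blast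
    ultimately show ?thesis using real_line_eq_span by blast
  qed
  then show "\<exists>W k. open W \<and> x \<in> W \<and> W \<subseteq> U \<and> smooth_on W k \<and>
      (\<forall>y\<in>W. k y \<noteq> 0 \<and> real_line U E y = span {k y})"
    using W xW smooth_on_subset[OF smooth, of W] by (intro exI[of _ W] exI[of _ k]) (auto simp: W_def)
qed

lemma smooth_curve_derivative:
  fixes \<gamma> :: "real \<Rightarrow> 'a::real_normed_vector"
  assumes "smooth_on I \<gamma>" "t \<in> I"
  shows "(\<gamma> has_vector_derivative frechet_derivative \<gamma> (at t) 1) (at t)"
proof -
  have "\<gamma> differentiable (at t)"
    using assms by (rule smooth_on_imp_differentiable)
  then have d: "(\<gamma> has_derivative frechet_derivative \<gamma> (at t)) (at t)"
    by (simp add: frechet_derivative_works)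
  then have "frechet_derivative \<gamma> (at t) h = h *\<^sub>R frechet_derivative \<gamma> (at t) 1" for h
    using linear_scale[OF has_derivative_linear[OF d], of h 1] by simp
  then show ?thesis
    using d unfolding has_vector_derivative_def by (metis (no_types, lifting) ext)
qed

context cky_frame
begin

lemma eigendist_iff: "x \<in> U \<Longrightarrow> Z \<in> eigendist x \<longleftrightarrow> (\<forall>\<mu>. pairing (\<alpha> \<mu> x) Z = 0)"
  by (simp add: eigendist_def)

text \<open>Differentiating \<open>\<alpha>\<^sub>\<nu>(\<gamma>') = 0\<close> along the curve gives \<open>\<alpha>\<^sub>\<nu>(\<nabla> \<gamma>') = - (\<nabla> \<alpha>\<^sub>\<nu>)(\<gamma>', \<gamma>')\<close>, which vanishes.\<close>

lemma acceleration_in_eigendist: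
  assumes "open I" "t \<in> I"
    and v: "(\<gamma> has_vector_derivative v t) (at t)" and a: "(v has_vector_derivative a) (at t)"
    and in_D: "\<And>t. t \<in> I \<Longrightarrow> \<gamma> t \<in> U \<and> cvec (v t) \<in> eigendist (\<gamma> t)"
  shows "cvec (a + (\<chi> k. \<Sum>i\<in>UNIV. \<Sum>j\<in>UNIV. christoffel g (\<gamma> t) k i j * v t $ i * v t $ j))
    \<in> eigendist (\<gamma> t)"
proof -
  let ?x = "\<gamma> t"
  let ?Q = "\<chi> k. \<Sum>i\<in>UNIV. \<Sum>j\<in>UNIV. christoffel g ?x k i j * v t $ i * v t $ j"
  have x: "?x \<in> U" and D: "cvec (v t) \<in> eigendist ?x"
    using in_D[OF assms(2)] by auto
  have "pairing (\<alpha> \<nu> ?x) (cvec (a + ?Q)) = 0" for \<nu>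
  proof -
    have "((\<lambda>s. \<alpha> \<nu> (\<gamma> s)) has_derivative (\<lambda>h. \<Sum>k\<in>UNIV. (h *\<^sub>R v t) $ k *\<^sub>R pderiv_coord k (\<alpha> \<nu>) ?x)) (at t)"
      using has_derivative_compose[OF v[unfolded has_vector_derivative_def]
          has_derivative_pderiv_coord[OF differentiable_at(4)[OF x], of \<nu>]] .
    then have 1: "((\<lambda>s. \<alpha> \<nu> (\<gamma> s)) has_vector_derivative (\<Sum>k\<in>UNIV. v t $ k *\<^sub>R pderiv_coord k (\<alpha> \<nu>) ?x)) (at t)"
      by (simp add: has_vector_derivative_def scaleR_sum_right)
    have 2: "((\<lambda>s. cvec (v s)) has_vector_derivative cvec a) (at t)"
      by (rule bounded_linear.has_vector_derivative[OF bounded_linear_cvec a])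
    have "((\<lambda>s. pairing (\<alpha> \<nu> (\<gamma> s)) (cvec (v s))) has_vector_derivative
        pairing (\<alpha> \<nu> ?x) (cvec a) + pairing (\<Sum>k\<in>UNIV. v t $ k *\<^sub>R pderiv_coord k (\<alpha> \<nu>) ?x) (cvec (v t))) (at t)"
      by (rule bounded_bilinear.has_vector_derivative[OF bounded_bilinear_pairing 1 2])
    then have "((\<lambda>s. 0) has_vector_derivative
        pairing (\<alpha> \<nu> ?x) (cvec a) + pairing (\<Sum>k\<in>UNIV. v t $ k *\<^sub>R pderiv_coord k (\<alpha> \<nu>) ?x) (cvec (v t))) (at t)"
      by (rule has_vector_derivative_transform_within_open[OF _ assms(1,2)])
        (use in_D eigendist_iff in blast)
    note vector_derivative_unique_at[OF has_vector_derivative_const this]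
    then have "pairing (\<alpha> \<nu> ?x) (cvec a)
        = - (\<Sum>k\<in>UNIV. cvec (v t) $ k * pairing (pderiv_coord k (\<alpha> \<nu>) ?x) (cvec (v t)))"
      by (simp add: eq_neg_iff_add_eq_0 scaleR_conv_of_real[where 'a=complex])
    moreover have "pairing (\<alpha> \<nu> ?x) (cvec ?Q)
        = (\<Sum>k\<in>UNIV. cvec (v t) $ k * pairing (\<alpha> \<nu> ?x) (cmat (christoffel_matrix g ?x k) *v cvec (v t)))"
    proof -
      have "cvec ?Q = (\<Sum>k\<in>UNIV. cvec (v t) $ k *s (cmat (christoffel_matrix g ?x k) *v cvec (v t)))"
        by (simp add: vec_eq_iff matrix_vector_mult_def christoffel_matrix_def sum_distrib_left mult_ac)
      then show ?thesis by simp
    qed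
    ultimately have "pairing (\<alpha> \<nu> ?x) (cvec (a + ?Q)) = - nabla_coform ?x \<nu> (cvec (v t)) (cvec (v t))"
      by (simp add: nabla_coform_def right_diff_distrib sum_subtractf)
    then show ?thesis
      by (simp add: nabla_coform_vanishes[OF x D D])
  qed
  then show ?thesis
    using x by (simp add: eigendist_def)
qed

lemma real_points_eigendist_iff: "x \<in> U \<Longrightarrow> v \<in> real_points U eigendist x \<longleftrightarrow> cvec v \<in> eigendist x"
proof -
  assume "x \<in> U"
  moreover have "cvec v \<in> cnj_vec ` eigendist x" if "cvec v \<in> eigendist x"
    using that by (metis cnj_vec_simps(5) image_eqI)
  ultimately show ?thesis by (auto simp: real_points_def)
qed

lemma metric_acceleration:
  assumes "x \<in> U"
  shows "g x *v (a + (\<chi> k. \<Sum>i\<in>UNIV. \<Sum>j\<in>UNIV. christoffel g x k i j * v $ i * v $ j))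
    = (\<chi> p. (\<Sum>l\<in>UNIV. g x $ p $ l * a $ l) + (\<Sum>i\<in>UNIV. \<Sum>j\<in>UNIV.
        (pderiv_coord i g x $ j $ p + pderiv_coord j g x $ i $ p - pderiv_coord p g x $ i $ j) / 2 * v $ i * v $ j))"
proof -
  have "(\<Sum>l\<in>UNIV. g x $ p $ l * (\<Sum>i\<in>UNIV. \<Sum>j\<in>UNIV. christoffel g x l i j * v $ i * v $ j))
      = (\<Sum>i\<in>UNIV. \<Sum>j\<in>UNIV. (\<Sum>l\<in>UNIV. g x $ p $ l * christoffel g x l i j) * v $ i * v $ j)" for p
  proof -
    have "(\<Sum>l\<in>UNIV. g x $ p $ l * (\<Sum>i\<in>UNIV. \<Sum>j\<in>UNIV. christoffel g x l i j * v $ i * v $ j))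
        = (\<Sum>l\<in>UNIV. \<Sum>i\<in>UNIV. \<Sum>j\<in>UNIV. g x $ p $ l * christoffel g x l i j * v $ i * v $ j)"
      by (simp add: sum_distrib_left mult_ac)
    also have "\<dots> = (\<Sum>i\<in>UNIV. \<Sum>l\<in>UNIV. \<Sum>j\<in>UNIV. g x $ p $ l * christoffel g x l i j * v $ i * v $ j)"
      by (rule sum.swap)
    also have "\<dots> = (\<Sum>i\<in>UNIV. \<Sum>j\<in>UNIV. \<Sum>l\<in>UNIV. g x $ p $ l * christoffel g x l i j * v $ i * v $ j)"
      by (rule sum.cong[OF refl], rule sum.swap)
    finally show ?thesis by (simp add: sum_distrib_right)
  qed
  then show ?thesis
    unfolding metric_christoffel[OF open_U assms pseudo_metric]
    by (simp add: vec_eq_iff matrix_vector_mult_def distrib_left sum.distrib)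
qed

text \<open>The acceleration of an integral curve is real and lies in the distribution, hence in
  the line spanned by the velocity, so the curve is a geodesic up to its parameter.\<close>

lemma null_geodesic_congruence_real_points:
  assumes line: "line_field U (real_points U eigendist)"
  shows "null_geodesic_congruence U g (real_points U eigendist)"
  unfolding null_geodesic_congruence_def
proof (intro conjI ballI allI impI line)
  fix x v assume x: "x \<in> U" and "v \<in> real_points U eigendist x"
  then have "cvec v \<in> null_frame.D (\<lambda>\<mu>. \<alpha> \<mu> x)"
    by (simp add: real_points_eigendist_iff eigendist_at)
  then have "pairing (cvec v) (cmat (g x) *v cvec v) = 0"
    using null_frame.D_isotropic[OF null_frame_at[OF x]] by blast
  then show "v \<bullet> (g x *v v) = 0"
    by (simp add: cmat_simps pairing_cvec)
next
  fix I \<gamma> assume curve: "integral_curve U (real_points U eigendist) I \<gamma>"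
  then have I: "open I" "is_interval I" and smooth: "smooth_on I \<gamma>"
    by (auto simp: integral_curve_def)
  define v where "v t = frechet_derivative \<gamma> (at t) 1" for t
  define a where "a t = frechet_derivative v (at t) 1" for t
  define A where "A t = a t + (\<chi> k. \<Sum>i\<in>UNIV. \<Sum>j\<in>UNIV. christoffel g (\<gamma> t) k i j * v t $ i * v t $ j)" for t
  have smooth_v: "smooth_on I v" and smooth_a: "smooth_on I a"
    unfolding a_def v_def by (intro smooth_on_frechet_derivative smooth)+
  have v: "(\<gamma> has_vector_derivative v t) (at t)" if "t \<in> I" for t
    unfolding v_def using smooth_curve_derivative[OF smooth that] .
  have a: "(v has_vector_derivative a t) (at t)" if "t \<in> I" for t
    unfolding a_def using smooth_curve_derivative[OF smooth_v that] .
  have in_U: "\<gamma> t \<in> U" and v_nonzero: "v t \<noteq> 0" and v_in: "v t \<in> real_points U eigendist (\<gamma> t)"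
    if "t \<in> I" for t
    using curve that vector_derivative_at[OF v[OF that]] by (auto simp: integral_curve_def)
  have parallel: "\<exists>r. A t = r *\<^sub>R v t" if t: "t \<in> I" for t
  proof -
    have "cvec (A t) \<in> eigendist (\<gamma> t)"
      unfolding A_def using v_in in_U
      by (intro acceleration_in_eigendist[where v=v, OF I(1) t v[OF t] a[OF t]])
        (auto simp: real_points_eigendist_iff)
    then have A: "A t \<in> real_points U eigendist (\<gamma> t)"
      using in_U[OF t] by (simp add: real_points_eigendist_iff)
    obtain k where "real_points U eigendist (\<gamma> t) = span {k}"
      using line in_U[OF t] unfolding line_field_def by blast
    with A v_in[OF t] obtain p q where "A t = p *\<^sub>R k" "v t = q *\<^sub>R k"
      by (auto simp: span_singleton)
    with v_nonzero[OF t] have "A t = (p / q) *\<^sub>R v t" by auto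
    then show ?thesis ..
  qed
  \<comment> \<open>The factor of proportionality is computed from covectors, since the lowered acceleration is
    visibly continuous: it contains no inverse of the metric.\<close>
  define w where "w t = g (\<gamma> t) *v A t" for t
  define u where "u t = g (\<gamma> t) *v v t" for t
  define r where "r t = (w t \<bullet> u t) / (u t \<bullet> u t)" for t
  have u_nonzero: "u t \<noteq> 0" if "t \<in> I" for t
  proof
    assume "u t = 0"
    then have "cmat (g (\<gamma> t)) *v cvec (v t) = 0"
      by (simp add: cmat_simps u_def)
    then have "cvec (v t) = 0"
      by (rule null_frame.metric_nondegenerate[OF null_frame_at[OF in_U[OF that]]])
    then show False using v_nonzero[OF that] by simp
  qed
  have "A t = r t *\<^sub>R v t" if t: "t \<in> I" for t
  proof -
    obtain p where p: "A t = p *\<^sub>R v t" using parallel[OF t] by blast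
    then have "w t = p *\<^sub>R u t"
      by (simp add: w_def u_def matrix_vector_mult_scaleR)
    then have "r t = p"
      using u_nonzero[OF t] by (simp add: r_def)
    with p show ?thesis by simp
  qed
  moreover have "continuous_on I r"
  proof -
    have \<gamma>: "continuous_on I \<gamma>" and cv: "continuous_on I v" and ca: "continuous_on I a"
      using smooth smooth_v smooth_a by (auto intro: smooth_on_imp_continuous)
    have g: "smooth_on U g" using pseudo_metric by (simp add: pseudo_metric_on_def)
    have cg: "continuous_on I (\<lambda>t. g (\<gamma> t))"
      by (rule continuous_on_compose2[OF smooth_on_imp_continuous[OF g] \<gamma>]) (use in_U in auto)
    have cdg: "continuous_on I (\<lambda>t. pderiv_coord i g (\<gamma> t))" for i
      unfolding pderiv_coord_def
      by (rule continuous_on_compose2[OF smooth_on_imp_continuous[OF smooth_on_frechet_derivative[OF g]] \<gamma>])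
        (use in_U in auto)
    have "continuous_on I (\<lambda>t. \<chi> p. (\<Sum>l\<in>UNIV. g (\<gamma> t) $ p $ l * a t $ l) + (\<Sum>i\<in>UNIV. \<Sum>j\<in>UNIV.
        (pderiv_coord i g (\<gamma> t) $ j $ p + pderiv_coord j g (\<gamma> t) $ i $ p - pderiv_coord p g (\<gamma> t) $ i $ j) / 2
        * v t $ i * v t $ j))"
      by (intro continuous_intros cg cdg cv ca) auto
    then have "continuous_on I w"
      by (rule continuous_on_eq) (simp add: w_def A_def metric_acceleration[OF in_U])
    moreover have "continuous_on I u"
      unfolding u_def matrix_vector_mult_def by (intro continuous_intros cg cv)
    ultimately show ?thesis
      unfolding r_def using u_nonzero by (intro continuous_intros) auto
  qed
  ultimately show "\<exists>J h. open J \<and> is_interval J \<and> bij_betw h J I \<and>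
      (\<forall>s\<in>J. \<exists>d. (h has_real_derivative d) (at s) \<and> d \<noteq> 0) \<and> geodesic g J (\<gamma> \<circ> h)"
    using geodesic_reparametrisation[OF I v a, of r g] by (simp add: A_def)
qed

text \<open>For a real vector \<open>v\<close> in the distribution and an imaginary eigenvalue, \<open>\<beta>\<^sub>\<mu>(v)\<close> is proportional to the
  conjugate of \<open>\<alpha>\<^sub>\<mu>(v) = 0\<close>; only the component along the exceptional frame vector survives.\<close>

lemma real_points_eq_real_line:
  assumes "\<And>x \<mu>. x \<in> U \<Longrightarrow> \<mu> \<noteq> \<mu>0 \<Longrightarrow> Re (2 * \<kappa> \<mu> x / c) = 0"
  shows "real_points U eigendist = real_line U (e \<mu>0)"
proof
  fix x show "real_points U eigendist x = real_line U (e \<mu>0) x"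
  proof (cases "x \<in> U")
    case False
    then show ?thesis by (simp add: real_points_def real_line_def)
  next
    case x: True
    interpret skew_null_frame "g x" c "\<lambda>\<mu>. \<alpha> \<mu> x" "\<lambda>\<mu>. \<beta> \<mu> x" "\<lambda>\<mu>. e \<mu> x" "\<lambda>\<mu>. f \<mu> x" "\<phi> x" "\<lambda>\<mu>. \<kappa> \<mu> x"
      by (rule skew_null_frame_at[OF x])
    have "cvec v \<in> eigendist x \<longleftrightarrow> (\<exists>z. cvec v = z *s e \<mu>0 x)" for v
    proof
      assume D: "cvec v \<in> eigendist x"
      have \<beta>: "pairing (\<beta> \<mu> x) (cvec v) = 0" if \<mu>: "\<mu> \<noteq> \<mu>0" for \<mu>
      proof -
        obtain k where k: "k \<noteq> 0" "\<And>Y. pairing (\<alpha> \<mu> x) (cnj_vec Y) = k * cnj (pairing (\<beta> \<mu> x) Y)"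
          using coform_cnj_imaginary[of \<mu>] assms[OF x \<mu>] by (auto simp: eigval_def)
        have "pairing (\<alpha> \<mu> x) (cvec v) = 0"
          using D x by (simp add: eigendist_def)
        with k(1) k(2)[of "cvec v"] show ?thesis by simp
      qed
      have "cvec v = (\<Sum>\<mu>\<in>UNIV. pairing (\<beta> \<mu> x) (cvec v) *s e \<mu> x)"
        using D x by (intro D_expansion) (simp add: eigendist_at)
      also have "\<dots> = (\<Sum>\<mu>\<in>UNIV. if \<mu> = \<mu>0 then pairing (\<beta> \<mu>0 x) (cvec v) *s e \<mu>0 x else 0)"
        by (intro sum.cong) (auto simp: \<beta>)
      finally show "\<exists>z. cvec v = z *s e \<mu>0 x" by auto
    next
      assume "\<exists>z. cvec v = z *s e \<mu>0 x"
      then show "cvec v \<in> eigendist x"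
        using x by (auto simp: eigendist_def dual)
    qed
    then show ?thesis
      by (simp add: set_eq_iff real_points_eigendist_iff[OF x] real_line_iff[OF x])
  qed
qed

lemma line_field_frame_vector:
  assumes "\<And>x. x \<in> U \<Longrightarrow> Im (2 * \<kappa> \<mu>0 x / c) = 0"
  shows "line_field U (real_line U (e \<mu>0))"
proof (rule line_field_real_line[OF open_U smooth_frame(3)])
  fix x assume x: "x \<in> U"
  interpret skew_null_frame "g x" c "\<lambda>\<mu>. \<alpha> \<mu> x" "\<lambda>\<mu>. \<beta> \<mu> x" "\<lambda>\<mu>. e \<mu> x" "\<lambda>\<mu>. f \<mu> x" "\<phi> x" "\<lambda>\<mu>. \<kappa> \<mu> x"
    by (rule skew_null_frame_at[OF x])
  show "e \<mu>0 x \<noteq> 0" by (rule e_nonzero)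
  show "\<exists>y. cnj_vec (e \<mu>0 x) = y *s e \<mu>0 x"
    using cnj_e_real[of \<mu>0] assms[OF x] by (auto simp: eigval_def)
qed

lemma continuous_eigenvalue: "continuous_on U (\<kappa> \<mu>)"
proof -
  have \<phi>: "smooth_on U \<phi>"
    using cky by (simp add: conformal_killing_yano_def two_form_on_def)
  have "smooth_on U (\<lambda>x. pairing (f \<mu> x) (cmat (\<phi> x) *v e \<mu> x))"
    by (intro smooth_on_bilinear[OF bounded_bilinear_pairing] smooth_frame open_U
        smooth_on_bilinear[OF bounded_bilinear_matrix_vector_mult] smooth_on_linear[OF bounded_linear_cmat] \<phi>)
  then have "continuous_on U (\<lambda>x. pairing (f \<mu> x) (cmat (\<phi> x) *v e \<mu> x))"
    by (rule smooth_on_imp_continuous)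
  moreover have "pairing (f \<mu> x) (cmat (\<phi> x) *v e \<mu> x) = \<kappa> \<mu> x" if "x \<in> U" for x
    using that by (simp add: form_null_frame.form_e[OF form_null_frame_at] pairing_commute[of "f \<mu> x"]
        null_frame.dual[OF null_frame_at])
  ultimately show ?thesis
    by (rule continuous_on_eq)
qed

text \<open>At each point exactly one eigenvalue has nonzero real part, and it is real.  The set where
  this happens for a given index is open by the first description and closed by the
  second, so on a connected domain the index is constant.\<close>

lemma lorentzian_real_index:
  assumes conn: "connected U" "U \<noteq> {}" and lorentz: "\<And>x. x \<in> U \<Longrightarrow> lorentzian_form (g x)"
  obtains \<mu>0 where "\<And>x. x \<in> U \<Longrightarrow> Im (2 * \<kappa> \<mu>0 x / c) = 0"
    "\<And>x \<mu>. x \<in> U \<Longrightarrow> \<mu> \<noteq> \<mu>0 \<Longrightarrow> Re (2 * \<kappa> \<mu> x / c) = 0"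
proof -
  let ?l = "\<lambda>\<mu> x. 2 * \<kappa> \<mu> x / c"
  have nonzero: "?l \<mu> x \<noteq> 0" if "x \<in> U" for \<mu> x
    using null_frame.c_nonzero[OF null_frame_at[OF that]] \<kappa>_sum[OF that, of \<mu> \<mu>] by auto
  have pointwise: "Re (?l \<mu> x) \<noteq> 0 \<Longrightarrow> Im (?l \<mu> x) = 0" "\<exists>\<mu>. Re (?l \<mu> x) \<noteq> 0"
    "Re (?l \<mu> x) \<noteq> 0 \<Longrightarrow> Re (?l \<nu> x) \<noteq> 0 \<Longrightarrow> \<mu> = \<nu>" if x: "x \<in> U" for x \<mu> \<nu>
  proof -
    interpret skew_null_frame "g x" c "\<lambda>\<mu>. \<alpha> \<mu> x" "\<lambda>\<mu>. \<beta> \<mu> x" "\<lambda>\<mu>. e \<mu> x" "\<lambda>\<mu>. f \<mu> x" "\<phi> x" "\<lambda>\<mu>. \<kappa> \<mu> x"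
      by (rule skew_null_frame_at[OF x])
    show "Re (?l \<mu> x) \<noteq> 0 \<Longrightarrow> Im (?l \<mu> x) = 0" "\<exists>\<mu>. Re (?l \<mu> x) \<noteq> 0"
      "Re (?l \<mu> x) \<noteq> 0 \<Longrightarrow> Re (?l \<nu> x) \<noteq> 0 \<Longrightarrow> \<mu> = \<nu>"
      using eigval_lorentzian[OF lorentz[OF x]] unfolding eigval_def by blast+
  qed
  have cont: "continuous_on U (?l \<mu>)" for \<mu>
    using conn(2) null_frame.c_nonzero[OF null_frame_at]
    by (intro continuous_intros continuous_eigenvalue) auto
  obtain x0 where x0: "x0 \<in> U" using conn(2) by blast
  obtain \<mu>0 where \<mu>0: "Re (?l \<mu>0 x0) \<noteq> 0"
    using pointwise(2)[OF x0] by blast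
  define V where "V = {x \<in> U. Re (?l \<mu>0 x) \<noteq> 0}"
  have "V = U \<inter> (\<lambda>x. Re (?l \<mu>0 x)) -` (- {0})" by (auto simp: V_def)
  moreover have "openin (top_of_set U) (U \<inter> (\<lambda>x. Re (?l \<mu>0 x)) -` (- {0}))"
    by (rule continuous_openin_preimage_gen[OF continuous_on_Re[OF cont]]) auto
  ultimately have "openin (top_of_set U) V" by simp
  moreover have "V = U \<inter> (\<lambda>x. Im (?l \<mu>0 x)) -` {0}"
    using pointwise(1)[of _ \<mu>0] nonzero[of _ \<mu>0] by (auto simp: V_def complex_eq_iff)
  moreover have "closedin (top_of_set U) (U \<inter> (\<lambda>x. Im (?l \<mu>0 x)) -` {0})"
    by (rule continuous_closedin_preimage[OF continuous_on_Im[OF cont]]) auto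
  ultimately have "V = {} \<or> V = U"
    using conn(1) unfolding connected_clopen by metis
  with x0 \<mu>0 have V: "V = U" by (auto simp: V_def)
  then have real: "Re (?l \<mu>0 x) \<noteq> 0" if "x \<in> U" for x
    using that by (auto simp: V_def)
  show thesis
  proof (rule that)
    show "Im (?l \<mu>0 x) = 0" if "x \<in> U" for x
      using pointwise(1)[OF that real[OF that]] .
    show "Re (?l \<mu> x) = 0" if "x \<in> U" "\<mu> \<noteq> \<mu>0" for x \<mu>
      using pointwise(3)[of x \<mu> \<mu>0] real that by blast
  qed
qed

end

section \<open>The family of associated distributions\<close>

lemma select_apply: "(if b then u else v) x = (if b then u x else v x)"
  by simp

context cky_frame
begin

text \<open>Exchanging \<open>\<alpha>\<^sub>\<mu>\<close> with \<open>\<beta>\<^sub>\<mu>\<close> reverses the sign of \<open>\<alpha>\<^sub>\<mu> \<and> \<beta>\<^sub>\<mu>\<close>, which is compensated by the sign of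
  \<open>\<kappa>\<^sub>\<mu>\<close>.  So every result about the kernel of the \<open>\<alpha>\<^sub>\<mu>\<close> holds for all members of the family.\<close>

lemma select:
  "cky_frame U g \<phi> c (\<lambda>\<mu> x. if \<mu> \<in> S then \<kappa> \<mu> x else - \<kappa> \<mu> x)
    (\<lambda>\<mu>. if \<mu> \<in> S then \<alpha> \<mu> else \<beta> \<mu>) (\<lambda>\<mu>. if \<mu> \<in> S then \<beta> \<mu> else \<alpha> \<mu>)
    (\<lambda>\<mu>. if \<mu> \<in> S then e \<mu> else f \<mu>) (\<lambda>\<mu>. if \<mu> \<in> S then f \<mu> else e \<mu>)"
proof
  have "sym_prod (if \<mu> \<in> S then \<alpha> \<mu> x else \<beta> \<mu> x) (if \<mu> \<in> S then \<beta> \<mu> x else \<alpha> \<mu> x)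
      = sym_prod (\<alpha> \<mu> x) (\<beta> \<mu> x)" for \<mu> x
    by (simp add: sym_prod_def vec_eq_iff algebra_simps)
  then show "null_coframe U g c (\<lambda>\<mu>. if \<mu> \<in> S then \<alpha> \<mu> else \<beta> \<mu>) (\<lambda>\<mu>. if \<mu> \<in> S then \<beta> \<mu> else \<alpha> \<mu>)"
    using coframe by (simp add: null_coframe_def select_apply)
  show "dual_frame U (\<lambda>\<mu>. if \<mu> \<in> S then \<alpha> \<mu> else \<beta> \<mu>) (\<lambda>\<mu>. if \<mu> \<in> S then \<beta> \<mu> else \<alpha> \<mu>)
    (\<lambda>\<mu>. if \<mu> \<in> S then f \<mu> else e \<mu>) (\<lambda>\<mu>. if \<mu> \<in> S then e \<mu> else f \<mu>)"
    using frame by (auto simp: dual_frame_def)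
  show "cmat (\<phi> x) = (\<Sum>\<mu>\<in>UNIV. map_matrix ((*) (if \<mu> \<in> S then \<kappa> \<mu> x else - \<kappa> \<mu> x))
      (wedge11 ((if \<mu> \<in> S then \<alpha> \<mu> else \<beta> \<mu>) x) ((if \<mu> \<in> S then \<beta> \<mu> else \<alpha> \<mu>) x)))" if "x \<in> U" for x
  proof -
    have "map_matrix ((*) (if \<mu> \<in> S then \<kappa> \<mu> x else - \<kappa> \<mu> x))
      (wedge11 ((if \<mu> \<in> S then \<alpha> \<mu> else \<beta> \<mu>) x) ((if \<mu> \<in> S then \<beta> \<mu> else \<alpha> \<mu>) x))
      = map_matrix ((*) (\<kappa> \<mu> x)) (wedge11 (\<alpha> \<mu> x) (\<beta> \<mu> x))" for \<mu>
      by (simp add: map_matrix_def wedge11_def vec_eq_iff algebra_simps)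
    then show ?thesis by (simp add: normal_form[OF that])
  qed
  show "(if \<mu> \<in> S then \<kappa> \<mu> x else - \<kappa> \<mu> x) + (if \<nu> \<in> S then \<kappa> \<nu> x else - \<kappa> \<nu> x) \<noteq> 0"
    if "x \<in> U" for x \<mu> \<nu>
    using \<kappa>_sum[OF that, of \<mu> \<nu>] injD[OF \<kappa>_inj[OF that], of \<mu> \<nu>]
    by (cases "\<mu> \<in> S"; cases "\<nu> \<in> S") (auto simp: add_eq_0_iff2 minus_equation_iff[of "\<kappa> \<mu> x"])
  show "inj (\<lambda>\<mu>. if \<mu> \<in> S then \<kappa> \<mu> x else - \<kappa> \<mu> x)" if "x \<in> U" for x
    using \<kappa>_inj[OF that] \<kappa>_sum[OF that] by (auto simp: inj_def eq_neg_iff_add_eq_0 neg_eq_iff_add_eq_0)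
qed (use open_U pseudo_metric cky tau_\<alpha> tau_\<beta> in auto)

lemma annihilator_eq_eigendist:
  "annihilator_distribution U \<alpha> \<beta> S = cky_frame.eigendist U (\<lambda>\<mu>. if \<mu> \<in> S then \<alpha> \<mu> else \<beta> \<mu>)"
  by (simp add: annihilator_distribution_def cky_frame.eigendist_def[OF select] select_apply)

lemma inj_annihilator:
  assumes "U \<noteq> {}"
  shows "inj (annihilator_distribution U \<alpha> \<beta>)"
proof (rule injI)
  obtain x where x: "x \<in> U" using assms by blast
  interpret null_frame "g x" c "\<lambda>\<mu>. \<alpha> \<mu> x" "\<lambda>\<mu>. \<beta> \<mu> x" "\<lambda>\<mu>. e \<mu> x" "\<lambda>\<mu>. f \<mu> x"
    by (rule null_frame_at[OF x])
  have "e \<mu> x \<in> annihilator_distribution U \<alpha> \<beta> S x \<longleftrightarrow> \<mu> \<in> S" for \<mu> S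
    using x by (auto simp: annihilator_distribution_def dual split: if_splits)
  then show "S = S'" if "annihilator_distribution U \<alpha> \<beta> S = annihilator_distribution U \<alpha> \<beta> S'" for S S'
    using that by (metis set_eq_iff)
qed

lemma card_assoc_distributions:
  assumes "U \<noteq> {}"
  shows "card (assoc_distributions U \<alpha> \<beta>) = 2 ^ CARD('m)"
  unfolding assoc_distributions_def
  by (simp add: card_image[OF inj_annihilator[OF assms]] card_UNIV_set)

lemma assoc_distributions_integrable:
  assumes "CARD('n) = 2 * CARD('m)" "D \<in> assoc_distributions U \<alpha> \<beta>"
  shows "maximal_isotropic U g D" "integrable_distribution U D"
proof -
  obtain S where S: "D = annihilator_distribution U \<alpha> \<beta> S"
    using assms(2) by (auto simp: assoc_distributions_def)
  show "maximal_isotropic U g D" "integrable_distribution U D"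
    unfolding S annihilator_eq_eigendist
    using cky_frame.maximal_isotropic_eigendist[OF select assms(1)] cky_frame.integrable_eigendist[OF select]
    by blast+
qed

lemma euclidean_bij_betw_T10:
  assumes "\<forall>x\<in>U. euclidean_form (g x)"
  shows "bij_betw (T10 U)
    {J \<in> extensional U. compatible_complex_structure U g J \<and> T10 U J \<in> assoc_distributions U \<alpha> \<beta>}
    (assoc_distributions U \<alpha> \<beta>)" (is "bij_betw _ ?\<J> _")
  unfolding bij_betw_def
proof
  show "inj_on (T10 U) ?\<J>"
    by (rule inj_onI) (auto simp: compatible_complex_structure_def intro: T10_determines)
  show "T10 U ` ?\<J> = assoc_distributions U \<alpha> \<beta>"
  proof
    show "assoc_distributions U \<alpha> \<beta> \<subseteq> T10 U ` ?\<J>"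
    proof
      fix D assume D: "D \<in> assoc_distributions U \<alpha> \<beta>"
      then obtain S where S: "D = annihilator_distribution U \<alpha> \<beta> S"
        by (auto simp: assoc_distributions_def)
      interpret sel: cky_frame U g \<phi> c "\<lambda>\<mu> x. if \<mu> \<in> S then \<kappa> \<mu> x else - \<kappa> \<mu> x"
        "\<lambda>\<mu>. if \<mu> \<in> S then \<alpha> \<mu> else \<beta> \<mu>" "\<lambda>\<mu>. if \<mu> \<in> S then \<beta> \<mu> else \<alpha> \<mu>"
        "\<lambda>\<mu>. if \<mu> \<in> S then e \<mu> else f \<mu>" "\<lambda>\<mu>. if \<mu> \<in> S then f \<mu> else e \<mu>"
        by (rule select)
      have "sel.eigenstructure \<in> extensional U"
        by (simp add: sel.eigenstructure_def)
      moreover have "T10 U sel.eigenstructure = D"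
        using sel.eigenstructure_complex_structure(1)[OF assms] by (simp add: S annihilator_eq_eigendist)
      ultimately show "D \<in> T10 U ` ?\<J>"
        using D sel.eigenstructure_complex_structure(2)[OF assms] by blast
    qed
  qed blast
qed

text \<open>The real points of a distribution depend only on which covector was chosen from the one pair with
  real eigenvalues.\<close>

lemma lorentzian_congruences:
  assumes conn: "connected U" "U \<noteq> {}" and lorentz: "\<And>x. x \<in> U \<Longrightarrow> lorentzian_form (g x)"
  shows "card (real_points U ` assoc_distributions U \<alpha> \<beta>) = 2"
    and "\<forall>L \<in> real_points U ` assoc_distributions U \<alpha> \<beta>. null_geodesic_congruence U g L \<and>
      card {D \<in> assoc_distributions U \<alpha> \<beta>. real_points U D = L} = 2 ^ (CARD('m) - 1)"
proof -
  let ?D = "annihilator_distribution U \<alpha> \<beta>"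
  obtain \<mu>0 where real: "\<And>x. x \<in> U \<Longrightarrow> Im (2 * \<kappa> \<mu>0 x / c) = 0"
    and imaginary: "\<And>x \<mu>. x \<in> U \<Longrightarrow> \<mu> \<noteq> \<mu>0 \<Longrightarrow> Re (2 * \<kappa> \<mu> x / c) = 0"
    using lorentzian_real_index[OF conn lorentz] by metis
  define L where "L b = real_line U (if b then e \<mu>0 else f \<mu>0)" for b
  have points: "real_points U (?D S) = L (\<mu>0 \<in> S)"
    and congruence: "null_geodesic_congruence U g (L (\<mu>0 \<in> S))" for S
  proof -
    interpret sel: cky_frame U g \<phi> c "\<lambda>\<mu> x. if \<mu> \<in> S then \<kappa> \<mu> x else - \<kappa> \<mu> x"
        "\<lambda>\<mu>. if \<mu> \<in> S then \<alpha> \<mu> else \<beta> \<mu>" "\<lambda>\<mu>. if \<mu> \<in> S then \<beta> \<mu> else \<alpha> \<mu>"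
        "\<lambda>\<mu>. if \<mu> \<in> S then e \<mu> else f \<mu>" "\<lambda>\<mu>. if \<mu> \<in> S then f \<mu> else e \<mu>"
      by (rule select)
    have "real_points U sel.eigendist = L (\<mu>0 \<in> S)"
      unfolding L_def using imaginary by (intro sel.real_points_eq_real_line) auto
    moreover have "line_field U (L (\<mu>0 \<in> S))"
      unfolding L_def using real by (intro sel.line_field_frame_vector) auto
    ultimately show "real_points U (?D S) = L (\<mu>0 \<in> S)" "null_geodesic_congruence U g (L (\<mu>0 \<in> S))"
      using sel.null_geodesic_congruence_real_points by (auto simp: annihilator_eq_eigendist)
  qed
  have L_neq: "L True \<noteq> L False"
  proof
    assume eq: "L True = L False"
    obtain x where x: "x \<in> U" using conn(2) by blast
    interpret null_frame "g x" c "\<lambda>\<mu>. \<alpha> \<mu> x" "\<lambda>\<mu>. \<beta> \<mu> x" "\<lambda>\<mu>. e \<mu> x" "\<lambda>\<mu>. f \<mu> x"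
      by (rule null_frame_at[OF x])
    have "line_field U (L True)"
      using congruence[of UNIV] by (simp add: null_geodesic_congruence_def)
    then obtain k where k: "k \<noteq> 0" "L True x = span {k}"
      using x unfolding line_field_def by blast
    then have "k \<in> L True x" "k \<in> L False x"
      by (simp_all add: span_base flip: eq)
    then obtain z z' where z: "cvec k = z *s e \<mu>0 x" and z': "cvec k = z' *s f \<mu>0 x"
      using x by (auto simp: L_def real_line_iff)
    have "z = pairing (\<beta> \<mu>0 x) (cvec k)"
      by (simp add: z dual)
    also have "\<dots> = 0"
      by (simp add: z' dual)
    finally show False using z k(1) by simp
  qed
  have image: "real_points U ` assoc_distributions U \<alpha> \<beta> = {L True, L False}"
  proof -
    have "real_points U ` assoc_distributions U \<alpha> \<beta> = L ` range (\<lambda>S. \<mu>0 \<in> S)"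
      by (auto simp: assoc_distributions_def image_image points)
    also have "range (\<lambda>S. \<mu>0 \<in> S) = UNIV"
    proof (rule surjI)
      show "(\<mu>0 \<in> (if b then UNIV else {})) = b" for b by simp
    qed
    finally show ?thesis by (auto simp: UNIV_bool)
  qed
  show "card (real_points U ` assoc_distributions U \<alpha> \<beta>) = 2"
    by (simp add: image L_neq)
  have card: "card {S. (\<mu>0 \<in> S) = b} = 2 ^ (CARD('m) - 1)" for b
  proof (cases b)
    case False
    then have "{S. (\<mu>0 \<in> S) = b} = Pow (UNIV - {\<mu>0})" by auto
    then show ?thesis by (simp add: card_Pow card_Diff_singleton)
  next
    case True
    have "{S. (\<mu>0 \<in> S) = b} = insert \<mu>0 ` Pow (UNIV - {\<mu>0})"
    proof
      show "{S. (\<mu>0 \<in> S) = b} \<subseteq> insert \<mu>0 ` Pow (UNIV - {\<mu>0})"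
      proof
        fix S assume "S \<in> {S. (\<mu>0 \<in> S) = b}"
        with True have "S = insert \<mu>0 (S - {\<mu>0})" by auto
        then show "S \<in> insert \<mu>0 ` Pow (UNIV - {\<mu>0})" by blast
      qed
    qed (use True in auto)
    moreover have "inj_on (insert \<mu>0) (Pow (UNIV - {\<mu>0}))"
      by (rule inj_onI) blast
    ultimately show ?thesis by (simp add: card_image card_Pow card_Diff_singleton)
  qed
  show "\<forall>L \<in> real_points U ` assoc_distributions U \<alpha> \<beta>. null_geodesic_congruence U g L \<and>
      card {D \<in> assoc_distributions U \<alpha> \<beta>. real_points U D = L} = 2 ^ (CARD('m) - 1)"
    unfolding image
  proof
    fix L' assume "L' \<in> {L True, L False}"
    then obtain b where b: "L' = L b" by auto
    have L_inj: "L b' = L b \<longleftrightarrow> b' = b" for b'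
      using L_neq by (cases b; cases b') auto
    have "{D \<in> assoc_distributions U \<alpha> \<beta>. real_points U D = L'} = ?D ` {S. (\<mu>0 \<in> S) = b}"
      by (auto simp: assoc_distributions_def points b L_inj)
    then have "card {D \<in> assoc_distributions U \<alpha> \<beta>. real_points U D = L'} = 2 ^ (CARD('m) - 1)"
      by (simp add: card card_image[OF inj_on_subset[OF inj_annihilator[OF conn(2)]]])
    moreover have "null_geodesic_congruence U g L'"
      using congruence[of "if b then UNIV else {}"] by (cases b) (simp_all add: b)
    ultimately show "null_geodesic_congruence U g L' \<and>
        card {D \<in> assoc_distributions U \<alpha> \<beta>. real_points U D = L'} = 2 ^ (CARD('m) - 1)"
      by simp
  qed
qed

end

theorem theorem3p1:
  fixes U :: "(real^'n) set"
    and g \<phi> :: "real^'n \<Rightarrow> real^'n^'n"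
    and c :: complex
    and ev :: "'m::finite \<Rightarrow> real^'n \<Rightarrow> complex"
    and \<theta>u \<theta>l Vl Vu :: "'m \<Rightarrow> real^'n \<Rightarrow> complex^'n"
  assumes dim: "CARD('n) = 2 * CARD('m)"
    and domain: "open U" "connected U" "U \<noteq> {}"
    and metric: "pseudo_metric_on U g"
    and cky: "conformal_killing_yano U g \<phi>"
    and nondegenerate: "\<And>x. x \<in> U \<Longrightarrow> invertible (cmat (raise_index (g x) (\<phi> x)))"
    and diagonalisable: "\<And>x. x \<in> U \<Longrightarrow> diagonalisable (cmat (raise_index (g x) (\<phi> x)))"
    and distinct_eigenvalues:
      "\<And>x. x \<in> U \<Longrightarrow> card (eigenvalues_of (cmat (raise_index (g x) (\<phi> x)))) = CARD('n)"
    and coframe: "null_coframe U g c \<theta>u \<theta>l"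
    and frame: "dual_frame U \<theta>u \<theta>l Vl Vu"
    and normal_form: "\<And>x. x \<in> U \<Longrightarrow>
      cmat (\<phi> x) = (\<Sum>\<mu>\<in>UNIV. map_matrix ((*) (ev \<mu> x)) (wedge11 (\<theta>u \<mu> x) (\<theta>l \<mu> x)))"
    and tau_upper: "\<And>x \<mu>. x \<in> U \<Longrightarrow>
      wedge12 (\<theta>u \<mu> x) (insert_first (Vu \<mu> x) (cten (ext_deriv2 \<phi> x))) = 0"
    and tau_lower: "\<And>x \<mu>. x \<in> U \<Longrightarrow>
      wedge12 (\<theta>l \<mu> x) (insert_first (Vl \<mu> x) (cten (ext_deriv2 \<phi> x))) = 0"
  shows
    "card (assoc_distributions U \<theta>u \<theta>l) = 2 ^ CARD('m) \<and>
     (\<forall>D \<in> assoc_distributions U \<theta>u \<theta>l. maximal_isotropic U g D \<and> integrable_distribution U D) \<and>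
     ((\<forall>x\<in>U. euclidean_form (g x)) \<longrightarrow>
        (let \<J> = {J \<in> extensional U. compatible_complex_structure U g J \<and>
                     T10 U J \<in> assoc_distributions U \<theta>u \<theta>l}
         in card \<J> = 2 ^ CARD('m) \<and> bij_betw (T10 U) \<J> (assoc_distributions U \<theta>u \<theta>l))) \<and>
     ((\<forall>x\<in>U. lorentzian_form (g x)) \<longrightarrow>
        (let \<L> = real_points U ` assoc_distributions U \<theta>u \<theta>l
         in card \<L> = 2 \<and>
            (\<forall>L\<in>\<L>. null_geodesic_congruence U g L \<and>
               card {D \<in> assoc_distributions U \<theta>u \<theta>l. real_points U D = L} = 2 ^ (CARD('m) - 1))))"
proof -
  have distinct: "ev \<mu> x + ev \<nu> x \<noteq> 0" "inj (\<lambda>\<mu>. ev \<mu> x)" if x: "x \<in> U" for x \<mu> \<nu>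
  proof -
    interpret form_null_frame "g x" c "\<lambda>\<mu>. \<theta>u \<mu> x" "\<lambda>\<mu>. \<theta>l \<mu> x" "\<lambda>\<mu>. Vu \<mu> x" "\<lambda>\<mu>. Vl \<mu> x" "\<phi> x" "\<lambda>\<mu>. ev \<mu> x"
      using x metric coframe frame normal_form
      by unfold_locales (auto simp: pseudo_metric_on_def null_coframe_def dual_frame_def)
    have "card (eigenvalues_of (cmat (raise_index (g x) (\<phi> x)))) = 2 * CARD('m)"
      using distinct_eigenvalues[OF x] dim by simp
    from eigenvalues_distinct[OF this]
    show "ev \<mu> x + ev \<nu> x \<noteq> 0" "inj (\<lambda>\<mu>. ev \<mu> x)" by blast+
  qed
  interpret cky_frame U g \<phi> c ev \<theta>u \<theta>l Vu Vl
    using domain(1) metric cky coframe frame normal_form distinct tau_upper tau_lower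
    by unfold_locales auto
  show ?thesis
    unfolding Let_def
    using card_assoc_distributions[OF domain(3)] assoc_distributions_integrable[OF dim]
      euclidean_bij_betw_T10 bij_betw_same_card[OF euclidean_bij_betw_T10]
      lorentzian_congruences[OF domain(2,3)]
    by (intro conjI impI) (simp_all)
qed

end
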